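(* Let $\overline M_K^k$ denote the optimal interior weight of $K\subset\mathbb R^D$ for polynomials of degree at most $k$. For the box $K=[0,1]^D$, and likewise for any other even polytope and for spherical cells (balls), $\overline M_K^{2n+1}=\overline M_K^{2n}$ for every integer $n\ge 0$. In particular, for a cubic representation space on such a (star-regular) cell, the optimal weight is $\overline M_K^3=\frac{D+2}{D}$, and positivity of the retentional $\overline M_K^3\,\overline{\mathcal C}-\overline{\mathcal B}$ can be enforced simply by enforcing positivity of the value at the origin: if $U$ is a polynomial of degree at most $3$ whose value at the cell center is nonnegative, then $\overline M_K^3\,\overline{\mathcal C}(U)-\overline{\mathcal B}(U)\ge 0$.
   Context: A cell $K\subset\mathbb R^D$ is even if it is symmetric under negation about its center (so that, centered on the origin, its isometries include $\mathbf x\mapsto-\mathbf x$); the cell center is taken as the origin. A star-regular cell is a star-convex cell that can be centered on the origin so that $\hat{\mathbf n}\cdot\mathbf x$ is constant on its boundary ($\hat{\mathbf n}$ the outward unit normal); cubes and balls have this property. $\overline{\mathcal C}(U)$ is the average of $U$ over $K$ and $\overline{\mathcal B}(U)$ is the average of $U$ over $\partial K$. $\overline M_K^k:=\sup\{\overline{\mathcal B}(U)/\overline{\mathcal C}(U): U\text{ a real polynomial in }D\text{ variables of degree}\le k,\ U\ge0\text{ in }K,\ \overline{\mathcal C}(U)>0\}$. *)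

theory Defs
  imports "HOL-Analysis.Analysis"
begin

section \<open>Surface measure\<close>

text \<open>
  The surface measure on the boundary of a cell in dimension D is the (D-1)-dimensional
  Hausdorff measure. The usual normalising constant is left out because it cancels in averages.
  In dimension 0 the convention is that every nonempty covering set counts 1 (as x^0 = 1), so
  that the measure counts points. Coverings by unbounded sets have to be excluded explicitly
  because \<^const>\<open>diameter\<close> is unspecified on them.
\<close>

definition hausdorff_pre :: "nat \<Rightarrow> real \<Rightarrow> 'a::metric_space set \<Rightarrow> ennreal" where
  "hausdorff_pre s \<delta> A =
     (INF C \<in> {C :: nat \<Rightarrow> 'a set. A \<subseteq> (\<Union>i. C i) \<and> (\<forall>i. bounded (C i) \<and> diameter (C i) \<le> \<delta>)}.
        \<Sum>i. if C i = {} then 0 else ennreal (diameter (C i) ^ s))"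

definition hausdorff_outer :: "nat \<Rightarrow> 'a::metric_space set \<Rightarrow> ennreal" where
  "hausdorff_outer s A = (SUP \<delta> \<in> {0<..}. hausdorff_pre s \<delta> A)"

definition hausdorff_measure :: "nat \<Rightarrow> 'a::metric_space measure" where
  "hausdorff_measure s = measure_of UNIV (sets borel) (hausdorff_outer s)"


section \<open>Averages over a cell and over its boundary\<close>

definition cell_avg :: "(real ^ 'n) set \<Rightarrow> (real ^ 'n \<Rightarrow> real) \<Rightarrow> real" where
  "cell_avg K U = (LINT x:K|lborel. U x) / measure lborel K"

definition surface :: "(real ^ 'n) measure" where
  "surface = hausdorff_measure (CARD('n) - 1)"

definition bdry_avg :: "(real ^ 'n) set \<Rightarrow> (real ^ 'n \<Rightarrow> real) \<Rightarrow> real" where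
  "bdry_avg K U = (LINT x:frontier K|surface. U x) / measure surface (frontier K)"


section \<open>Polynomials of bounded total degree and the optimal interior weight\<close>

definition poly_deg_le :: "nat \<Rightarrow> (real ^ 'n \<Rightarrow> real) \<Rightarrow> bool" where
  "poly_deg_le k U \<longleftrightarrow>
     (\<exists>a :: ('n \<Rightarrow> nat) \<Rightarrow> real. \<forall>x.
        U x = (\<Sum>\<alpha> | (\<Sum>i\<in>UNIV. \<alpha> i) \<le> k. a \<alpha> * (\<Prod>i\<in>UNIV. (x $ i) ^ \<alpha> i)))"

text \<open>The supremum is taken in \<^typ>\<open>ereal\<close>, where it always exists.\<close>

definition opt_weight :: "(real ^ 'n) set \<Rightarrow> nat \<Rightarrow> ereal" where
  "opt_weight K k =
     Sup {ereal (bdry_avg K U / cell_avg K U) | U.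
            poly_deg_le k U \<and> (\<forall>x\<in>K. 0 \<le> U x) \<and> 0 < cell_avg K U}"

text \<open>The index set of the sum in \<open>poly_deg_le\<close> is finite, so the sum is a genuine one.\<close>

lemma finite_multi_index: "finite {\<alpha> :: 'n::finite \<Rightarrow> nat. (\<Sum>i\<in>UNIV. \<alpha> i) \<le> k}"
proof (rule finite_subset)
  show "{\<alpha> :: 'n \<Rightarrow> nat. (\<Sum>i\<in>UNIV. \<alpha> i) \<le> k} \<subseteq> Pi\<^sub>E UNIV (\<lambda>_. {..k})"
  proof
    fix \<alpha> :: "'n \<Rightarrow> nat" assume "\<alpha> \<in> {\<alpha>. (\<Sum>i\<in>UNIV. \<alpha> i) \<le> k}"
    hence le: "(\<Sum>i\<in>UNIV. \<alpha> i) \<le> k" by simp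
    have "\<alpha> i \<le> k" for i
      using member_le_sum[of i UNIV \<alpha>] le by (auto intro: order.trans)
    thus "\<alpha> \<in> Pi\<^sub>E UNIV (\<lambda>_. {..k})" by auto
  qed
  show "finite (Pi\<^sub>E (UNIV :: 'n set) (\<lambda>_. {..k}))" by (intro finite_PiE) auto
qed


section \<open>Cells\<close>

text \<open>
  Cells need not be convex, so a polytope is taken here to be a finite union of
  full-dimensional convex polytopes (which are what \<^const>\<open>polytope\<close> means).
\<close>

definition polytopal_cell :: "(real ^ 'n) set \<Rightarrow> bool" where
  "polytopal_cell K \<longleftrightarrow>
     (\<exists>F. finite F \<and> F \<noteq> {} \<and> (\<forall>P\<in>F. polytope P \<and> interior P \<noteq> {}) \<and> K = \<Union>F)"

definition even_about :: "real ^ 'n \<Rightarrow> (real ^ 'n) set \<Rightarrow> bool" where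
  "even_about z K \<longleftrightarrow> (\<forall>y. z + y \<in> K \<longleftrightarrow> z - y \<in> K)"

text \<open>
  \<open>n\<close> is the outward unit normal at \<open>x\<close> if, to first order at \<open>x\<close>, the set \<open>K\<close> is the half-space
  of all \<open>y\<close> with \<open>n \<bullet> (y - x) \<le> 0\<close>. At edges and corners of a polytope there is no such \<open>n\<close>.
\<close>

definition outward_unit_normal :: "(real ^ 'n) set \<Rightarrow> real ^ 'n \<Rightarrow> real ^ 'n \<Rightarrow> bool" where
  "outward_unit_normal K x n \<longleftrightarrow>
     norm n = 1 \<and>
     (\<forall>\<epsilon>>0. \<exists>\<delta>>0. \<forall>y. dist y x < \<delta> \<longrightarrow>
        (n \<bullet> (y - x) < - \<epsilon> * norm (y - x) \<longrightarrow> y \<in> K) \<and>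
        (n \<bullet> (y - x) > \<epsilon> * norm (y - x) \<longrightarrow> y \<notin> K))"

text \<open>Centering the cell on the origin means translating it by \<open>- c\<close>.\<close>

definition star_regular :: "(real ^ 'n) set \<Rightarrow> bool" where
  "star_regular K \<longleftrightarrow>
     starlike K \<and>
     (\<exists>c r. \<forall>x\<in>frontier K. \<forall>n. outward_unit_normal K x n \<longrightarrow> n \<bullet> (x - c) = r)"


section \<open>Convex polytopes, cubes and balls\<close>

lemma polytope_imp_polytopal_cell:
  "polytope K \<Longrightarrow> interior K \<noteq> {} \<Longrightarrow> polytopal_cell K"
  unfolding polytopal_cell_def by (intro exI[of _ "{K}"]) auto

lemma outward_unit_normal_unique:
  assumes n: "outward_unit_normal K x n" and w: "norm w = 1"
    and out: "\<And>v t. w \<bullet> v > 0 \<Longrightarrow> t > 0 \<Longrightarrow> x + t *\<^sub>R v \<notin> K"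
  shows "n = w"
proof -
  have n1: "norm n = 1" using n by (simp add: outward_unit_normal_def)
  have ge: "n \<bullet> v \<ge> 0" if v: "w \<bullet> v > 0" for v
  proof (rule ccontr)
    assume "\<not> n \<bullet> v \<ge> 0"
    hence neg: "n \<bullet> v < 0" by simp
    hence v0: "norm v > 0" by auto
    define \<epsilon> where "\<epsilon> = - (n \<bullet> v) / (2 * norm v)"
    have e: "\<epsilon> > 0" unfolding \<epsilon>_def using neg v0 by (intro divide_pos_pos) auto
    from n e obtain \<delta> where d: "\<delta> > 0"
      and *: "\<And>y. dist y x < \<delta> \<Longrightarrow> n \<bullet> (y - x) < - \<epsilon> * norm (y - x) \<Longrightarrow> y \<in> K"
      unfolding outward_unit_normal_def by blast
    define t where "t = \<delta> / (2 * norm v)"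
    have t: "t > 0" using d v0 by (simp add: t_def)
    have "x + t *\<^sub>R v \<in> K"
    proof (rule *)
      show "dist (x + t *\<^sub>R v) x < \<delta>" using d v0 by (simp add: dist_norm t_def)
      have "n \<bullet> v < - \<epsilon> * norm v" using neg v0 by (simp add: \<epsilon>_def)
      hence "t * (n \<bullet> v) < t * (- \<epsilon> * norm v)" using t by (intro mult_strict_left_mono)
      thus "n \<bullet> (x + t *\<^sub>R v - x) < - \<epsilon> * norm (x + t *\<^sub>R v - x)"
        using t by (simp add: algebra_simps)
    qed
    with out[OF v t] show False by simp
  qed
  have ww: "w \<bullet> w = 1" and nn: "n \<bullet> n = 1" using w n1 by (simp_all add: dot_square_norm)
  have p0: "n \<bullet> w \<ge> 0" using ge[of w] ww by simp
  have p1: "(n \<bullet> w)\<^sup>2 + e * (n \<bullet> w) \<ge> 1" if "e > 0" for e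
  proof -
    have "w \<bullet> ((n \<bullet> w + e) *\<^sub>R w - n) = e"
      using ww by (simp add: inner_diff_right inner_commute)
    hence "n \<bullet> ((n \<bullet> w + e) *\<^sub>R w - n) \<ge> 0" using ge that by simp
    thus ?thesis using nn by (simp add: inner_diff_right algebra_simps power2_eq_square)
  qed
  have le1: "n \<bullet> w \<le> 1" using norm_cauchy_schwarz[of n w] w n1 by simp
  have "(n \<bullet> w)\<^sup>2 \<ge> 1 - e" if "e > 0" for e
  proof -
    have "e * (n \<bullet> w) \<le> e * 1" using le1 that by (intro mult_left_mono) auto
    with p1[OF that] show ?thesis by simp
  qed
  hence "(n \<bullet> w)\<^sup>2 \<ge> 1" by (meson field_le_epsilon le_diff_eq diff_le_eq)
  hence "n \<bullet> w \<ge> 1" using p0 power2_le_imp_le[of 1 "n \<bullet> w"] by simp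
  hence "(n - w) \<bullet> (n - w) \<le> 0"
    using ww nn by (simp add: inner_diff_left inner_diff_right inner_commute)
  thus ?thesis using inner_ge_zero[of "n - w"] by (metis antisym inner_eq_zero_iff right_minus_eq)
qed

lemma star_regular_cball:
  fixes z :: "real ^ 'n"
  assumes r: "r > 0"
  shows "star_regular (cball z r)"
  unfolding star_regular_def
proof (intro conjI exI ballI allI impI)
  show "starlike (cball z r)"
    using r by (intro convex_imp_starlike) auto
next
  fix x n assume x: "x \<in> frontier (cball z r)" and n: "outward_unit_normal (cball z r) x n"
  have nx: "norm (x - z) = r" using x by (simp add: dist_norm norm_minus_commute)
  define w where "w = (1 / r) *\<^sub>R (x - z)"
  have "n = w"
  proof (rule outward_unit_normal_unique[OF n])
    show "norm w = 1" using r nx by (simp add: w_def)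
    fix v :: "real ^ 'n" and t :: real
    assume v: "w \<bullet> v > 0" and t: "t > 0"
    have pos: "(x - z) \<bullet> v > 0" using v r by (simp add: w_def zero_less_mult_iff zero_less_divide_iff)
    have "(norm (x + t *\<^sub>R v - z))\<^sup>2 = (norm ((x - z) + t *\<^sub>R v))\<^sup>2" by (simp add: algebra_simps)
    also have "\<dots> = r\<^sup>2 + (norm (t *\<^sub>R v))\<^sup>2 + 2 * (t * ((x - z) \<bullet> v))"
      using dot_norm[of "x - z" "t *\<^sub>R v"] nx by simp
    also have "\<dots> > r\<^sup>2" using pos t by (smt (verit) mult_pos_pos zero_le_power2)
    finally have "norm (x + t *\<^sub>R v - z) > r"
      by (rule power_less_imp_less_base) simp
    thus "x + t *\<^sub>R v \<notin> cball z r" by (simp add: dist_norm norm_minus_commute)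
  qed
  thus "n \<bullet> (x - z) = r" using nx r by (simp add: w_def dot_square_norm power2_eq_square)
qed

lemma star_regular_unit_cube: "star_regular (cbox 0 (1 :: real ^ 'n))"
  unfolding star_regular_def
proof (intro conjI exI ballI allI impI)
  show "starlike (cbox 0 (1 :: real ^ 'n))"
    by (intro convex_imp_starlike convex_box) (simp add: cbox_interval less_eq_vec_def)
next
  fix x n :: "real ^ 'n"
  assume x: "x \<in> frontier (cbox 0 1)" and n: "outward_unit_normal (cbox 0 1) x n"
  have xin: "x \<in> cbox 0 1" using x closed_cbox frontier_subset_eq by blast
  have "x \<notin> box 0 1" using x by (simp add: frontier_def interior_cbox)
  then obtain i where i: "x $ i = 0 \<or> x $ i = 1"
    using xin by (force simp: mem_box_cart order.order_iff_strict)
  thus "n \<bullet> (x - (\<chi> i. 1 / 2)) = 1 / 2"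
  proof
    assume xi: "x $ i = 1"
    have "n = axis i 1"
      by (rule outward_unit_normal_unique[OF n])
         (auto simp: inner_axis' mem_box_cart xi not_le intro!: exI[of _ i])
    thus ?thesis by (simp add: inner_axis' xi)
  next
    assume xi: "x $ i = 0"
    have "n = - axis i 1"
      by (rule outward_unit_normal_unique[OF n])
         (auto simp: inner_axis' mem_box_cart xi not_le mult_less_0_iff intro!: exI[of _ i])
    thus ?thesis by (simp add: inner_axis' xi)
  qed
qed

end

theory Submission
  imports Defs
begin

text \<open>
  Put the center of the cell at the origin and let \<open>D\<close> be the dimension. Reflection in the origin
  preserves the cell and its boundary, so \<open>U\<close> and its even part \<open>\<lambda>y. (U y + U (- y)) / 2\<close> have the
  same averages. The even part of a polynomial of degree at most \<open>2 * n + 1\<close> has degree at most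
  \<open>2 * n\<close>, and it is nonnegative on the cell if \<open>U\<close> is. Hence the suprema for \<open>2 * n + 1\<close> and
  \<open>2 * n\<close> run over the same ratios (\<open>opt_weight_even_cell\<close>).

  The even part of a cubic \<open>U\<close> is \<open>U 0\<close> plus a quadratic form. On a ball and on a star-regular even
  polytopal cell the boundary average of a quadratic form \<open>Q\<close> is \<open>w = (D + 2) / D\<close> times its cell
  average; in terms of the divergence theorem, \<open>n \<bullet> x\<close> is constant on the boundary and the field \<open>Q x *\<^sub>R x\<close> has divergence
  \<open>(D + 2) * Q x\<close>. So \<open>bdry_avg K U = w * cell_avg K U + (1 - w) * U 0\<close> (\<open>bdry_avg_cubic\<close>). As
  \<open>w \<ge> 1\<close>, this gives the positivity of the retentional if \<open>0 \<le> U 0\<close>, and the bound \<open>w\<close> for the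
  optimal weight, which the squared norm attains (\<open>opt_weight_cubic\<close>).

  The relation for quadratic forms is proved without a divergence theorem, by comparing the Hausdorff
  measure with the volume of cones. For subsets \<open>A\<close> of a hyperplane \<open>{x. m \<bullet> x = 1}\<close>, the
  Hausdorff measure of \<open>A\<close> and the volume of the cone over \<open>A\<close> with apex 0 are both invariant under
  translations along the hyperplane, since these act on cones by volume-preserving shears. Such a
  measure is unique up to a factor (\<open>translation_invariant_measure_unique\<close>), and by rotation the factor
  depends only on the norm of \<open>m\<close> (\<open>hausdorff_facet\<close>). The facets of a star-regular
  polytopal cell have the same distance from the center, so one factor serves all of them, and the
  cones over the facets fill the cell up to a null set (\<open>polytopal_boundary_integral\<close>). The
  ratio \<open>(D + k) / D\<close> for homogeneous functions of degree \<open>k\<close> comes from the scaling of volumes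
  (\<open>nn_integral_homogeneous_cone\<close>). On a ball, rotation invariance replaces every quadratic form, under
  averages, by a multiple of the squared norm (\<open>average_quadratic_rotation_invariant\<close>), and all that is needed of the
  sphere is that its Hausdorff measure is positive and finite.

  The Hausdorff outer measure is countably additive on Borel sets by Caratheodory's criterion
  (\<open>hausdorff_outer_closed_split\<close>).
\<close>

section \<open>Hausdorff measure\<close>

definition diam_weight :: "nat \<Rightarrow> 'a::metric_space set \<Rightarrow> ennreal" where
  "diam_weight s C = (if C = {} then 0 else ennreal (diameter C ^ s))"

definition fine_cover :: "real \<Rightarrow> 'a::metric_space set \<Rightarrow> (nat \<Rightarrow> 'a set) \<Rightarrow> bool" where
  "fine_cover \<delta> A C \<longleftrightarrow> A \<subseteq> (\<Union>i. C i) \<and> (\<forall>i. bounded (C i) \<and> diameter (C i) \<le> \<delta>)"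

lemma hausdorff_pre_alt:
  "hausdorff_pre s \<delta> A = (INF C \<in> Collect (fine_cover \<delta> A). \<Sum>i. diam_weight s (C i))"
  by (simp add: hausdorff_pre_def diam_weight_def fine_cover_def[abs_def])

lemma hausdorff_pre_le: "fine_cover \<delta> A C \<Longrightarrow> hausdorff_pre s \<delta> A \<le> (\<Sum>i. diam_weight s (C i))"
  unfolding hausdorff_pre_alt by (intro INF_lower) auto

lemma hausdorff_pre_less:
  "hausdorff_pre s \<delta> A < e \<Longrightarrow> \<exists>C. fine_cover \<delta> A C \<and> (\<Sum>i. diam_weight s (C i)) < e"
  unfolding hausdorff_pre_alt INF_less_iff by auto

lemma fine_cover_mono:
  "fine_cover \<delta> B C \<Longrightarrow> A \<subseteq> B \<Longrightarrow> \<delta> \<le> \<delta>' \<Longrightarrow> fine_cover \<delta>' A C"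
  unfolding fine_cover_def by (meson order_trans)

lemma hausdorff_pre_mono: "A \<subseteq> B \<Longrightarrow> \<delta>' \<le> \<delta> \<Longrightarrow> hausdorff_pre s \<delta> A \<le> hausdorff_pre s \<delta>' B"
  unfolding hausdorff_pre_alt
  by (intro INF_superset_mono) (auto intro: fine_cover_mono)

lemma hausdorff_outer_mono: "A \<subseteq> B \<Longrightarrow> hausdorff_outer s A \<le> hausdorff_outer s B"
  unfolding hausdorff_outer_def by (intro SUP_mono) (auto intro: hausdorff_pre_mono)

lemma hausdorff_pre_le_outer: "\<delta> > 0 \<Longrightarrow> hausdorff_pre s \<delta> A \<le> hausdorff_outer s A"
  unfolding hausdorff_outer_def by (intro SUP_upper) auto

lemma hausdorff_outer_empty [simp]: "hausdorff_outer s {} = 0"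
proof -
  have "hausdorff_pre s \<delta> ({} :: 'a set) = 0" if "\<delta> > 0" for \<delta>
    using hausdorff_pre_le[of \<delta> "{} :: 'a set" "\<lambda>_. {}" s] that
    by (simp add: fine_cover_def diam_weight_def)
  hence "(SUP \<delta>\<in>{0<..}. hausdorff_pre s \<delta> ({} :: 'a set)) = (SUP \<delta>\<in>{0::real<..}. 0)"
    by (intro SUP_cong) auto
  thus ?thesis unfolding hausdorff_outer_def by simp
qed

lemma hausdorff_outer_lipschitz_image:
  fixes f :: "'a::metric_space \<Rightarrow> 'b::metric_space"
  assumes lip: "\<And>x y. x \<in> A \<Longrightarrow> y \<in> A \<Longrightarrow> dist (f x) (f y) \<le> dist x y"
  shows "hausdorff_outer s (f ` A) \<le> hausdorff_outer s A"
proof -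
  have "hausdorff_pre s \<delta> (f ` A) \<le> hausdorff_pre s \<delta> A" if \<delta>: "\<delta> > 0" for \<delta>
    unfolding hausdorff_pre_alt[of s \<delta> A]
  proof (rule INF_greatest, simp)
    fix C assume C: "fine_cover \<delta> A C"
    have bd: "bounded (C i)" for i using C by (auto simp: fine_cover_def)
    have bdf: "bounded (f ` (C i \<inter> A))" and df: "diameter (f ` (C i \<inter> A)) \<le> diameter (C i)" for i
    proof -
      have *: "dist u v \<le> diameter (C i)" if uv: "u \<in> f ` (C i \<inter> A)" "v \<in> f ` (C i \<inter> A)" for u v
      proof -
        obtain x y where xy: "x \<in> C i" "x \<in> A" "y \<in> C i" "y \<in> A" "u = f x" "v = f y"
          using uv by blast
        have "dist u v \<le> dist x y" using lip xy by simp
        also have "\<dots> \<le> diameter (C i)" using xy by (intro diameter_bounded_bound[OF bd])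
        finally show ?thesis .
      qed
      show "bounded (f ` (C i \<inter> A))" unfolding bounded_two_points using * by blast
      show "diameter (f ` (C i \<inter> A)) \<le> diameter (C i)"
      proof (cases "f ` (C i \<inter> A) = {}")
        case True
        show ?thesis unfolding True using diameter_ge_0[OF bd] by simp
      next
        case False
        show ?thesis unfolding diameter_def[of "f ` (C i \<inter> A)"] if_not_P[OF False]
        proof (rule cSUP_least)
          show "f ` (C i \<inter> A) \<times> f ` (C i \<inter> A) \<noteq> {}" using False by simp
          show "(case x of (u, v) \<Rightarrow> dist u v) \<le> diameter (C i)"
            if "x \<in> f ` (C i \<inter> A) \<times> f ` (C i \<inter> A)" for x
            using * that by (cases x) simp
        qed
      qed
    qed
    have "fine_cover \<delta> (f ` A) (\<lambda>i. f ` (C i \<inter> A))"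
      unfolding fine_cover_def
    proof (intro conjI allI)
      show "f ` A \<subseteq> (\<Union>i. f ` (C i \<inter> A))" using C by (fastforce simp: fine_cover_def)
      show "diameter (f ` (C i \<inter> A)) \<le> \<delta>" for i
        using df[of i] C by (auto simp: fine_cover_def intro: order_trans)
    qed (rule bdf)
    hence "hausdorff_pre s \<delta> (f ` A) \<le> (\<Sum>i. diam_weight s (f ` (C i \<inter> A)))"
      by (rule hausdorff_pre_le)
    also have "\<dots> \<le> (\<Sum>i. diam_weight s (C i))"
      using df diameter_ge_0[OF bdf]
      by (intro suminf_le summableI) (auto simp: diam_weight_def intro!: ennreal_leI power_mono)
    finally show "hausdorff_pre s \<delta> (f ` A) \<le> (\<Sum>i. diam_weight s (C i))" .
  qed
  thus ?thesis unfolding hausdorff_outer_def by (intro SUP_mono) auto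
qed

lemma hausdorff_outer_isometric_image:
  fixes f :: "'a::metric_space \<Rightarrow> 'b::metric_space"
  assumes iso: "\<And>x y. dist (f x) (f y) = dist x y"
  shows "hausdorff_outer s (f ` A) = hausdorff_outer s A"
proof (rule antisym)
  show "hausdorff_outer s (f ` A) \<le> hausdorff_outer s A"
    by (rule hausdorff_outer_lipschitz_image) (simp add: iso)
  have inj: "inj f" by (rule injI) (metis iso dist_eq_0_iff)
  have "A = inv f ` f ` A" using inj by (simp add: image_image)
  also have "hausdorff_outer s (inv f ` f ` A) \<le> hausdorff_outer s (f ` A)"
    by (rule hausdorff_outer_lipschitz_image) (auto simp: inj iso)
  finally show "hausdorff_outer s A \<le> hausdorff_outer s (f ` A)" .
qed

lemma hausdorff_outer_countably_subadditive:
  "hausdorff_outer s (\<Union>n. A n) \<le> (\<Sum>n. hausdorff_outer s (A n))"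
  unfolding hausdorff_outer_def[of s "\<Union>n. A n"]
proof (rule SUP_least)
  fix \<delta> :: real assume "\<delta> \<in> {0<..}"
  hence \<delta>: "\<delta> > 0" by simp
  show "hausdorff_pre s \<delta> (\<Union>n. A n) \<le> (\<Sum>n. hausdorff_outer s (A n))"
  proof (rule ennreal_le_epsilon)
    fix e :: real assume e: "0 < e" and fin: "(\<Sum>n. hausdorff_outer s (A n)) < top"
    have "hausdorff_pre s \<delta> (A n) < hausdorff_outer s (A n) + ennreal (e * (1/2) ^ Suc n)" for n
    proof -
      have "hausdorff_outer s (A n) < top" using fin by (auto dest!: ennreal_suminf_lessD)
      hence "hausdorff_outer s (A n) < hausdorff_outer s (A n) + ennreal (e * (1/2) ^ Suc n)"
        using e by (auto simp: less_top)
      with hausdorff_pre_le_outer[OF \<delta>] show ?thesis by (rule order.strict_trans1)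
    qed
    hence "\<exists>C. fine_cover \<delta> (A n) C \<and>
        (\<Sum>i. diam_weight s (C i)) < hausdorff_outer s (A n) + ennreal (e * (1/2) ^ Suc n)" for n
      by (intro hausdorff_pre_less)
    then obtain B where B: "\<And>n. fine_cover \<delta> (A n) (B n)"
      and Ble: "\<And>n. (\<Sum>i. diam_weight s (B n i)) \<le> hausdorff_outer s (A n) + ennreal (e * (1/2) ^ Suc n)"
      by (metis less_imp_le)
    define C where "C = case_prod B \<circ> prod_decode"
    have "\<Union>(range A) \<subseteq> (\<Union>i. C i)"
      using B by (auto simp: C_def fine_cover_def subset_eq) (metis prod.case prod_encode_inverse)
    moreover have "bounded (C i) \<and> diameter (C i) \<le> \<delta>" for i
      using B by (auto simp: C_def fine_cover_def split: prod.splits)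
    ultimately have "fine_cover \<delta> (\<Union>n. A n) C" by (simp add: fine_cover_def)
    hence "hausdorff_pre s \<delta> (\<Union>n. A n) \<le> (\<Sum>i. diam_weight s (C i))" by (rule hausdorff_pre_le)
    also have "\<dots> = (\<Sum>n. \<Sum>i. diam_weight s (B n i))"
      unfolding C_def comp_def by (intro suminf_ennreal_2dimen) auto
    also have "\<dots> \<le> (\<Sum>n. hausdorff_outer s (A n) + ennreal (e * (1/2) ^ Suc n))"
      by (intro suminf_le summableI Ble)
    also have "\<dots> = (\<Sum>n. hausdorff_outer s (A n)) + (\<Sum>n. ennreal e * ennreal ((1/2) ^ Suc n))"
      using \<open>0 < e\<close> by (subst suminf_add[symmetric])
                       (auto simp del: ennreal_suminf_cmult simp add: ennreal_mult[symmetric])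
    also have "\<dots> = (\<Sum>n. hausdorff_outer s (A n)) + e"
      unfolding ennreal_suminf_cmult
      by (subst suminf_ennreal_eq[OF zero_le_power power_half_series]) auto
    finally show "hausdorff_pre s \<delta> (\<Union>n. A n) \<le> (\<Sum>n. hausdorff_outer s (A n)) + e" .
  qed
qed

lemma outer_measure_space_hausdorff: "outer_measure_space UNIV (hausdorff_outer s)"
  by (auto simp: outer_measure_space_def positive_def increasing_def countably_subadditive_def
      hausdorff_outer_mono hausdorff_outer_countably_subadditive)

lemma hausdorff_outer_Un: "hausdorff_outer s (A \<union> B) \<le> hausdorff_outer s A + hausdorff_outer s B"
proof -
  let ?F = "\<lambda>n::nat. if n = 0 then A else if n = 1 then B else {}"
  have "A \<union> B = (\<Union>n. ?F n)" by (auto split: if_splits)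
  also have "hausdorff_outer s (\<Union>n. ?F n) \<le> (\<Sum>n. hausdorff_outer s (?F n))"
    by (rule hausdorff_outer_countably_subadditive)
  also have "\<dots> = (\<Sum>n\<in>{0,1}. hausdorff_outer s (?F n))"
    by (rule suminf_finite) auto
  finally show ?thesis by simp
qed

text \<open>
  A covering set of diameter less than \<open>\<epsilon>\<close> meets at most one of \<open>A\<close> and \<open>B\<close>, so every fine cover of
  the union splits into a cover of \<open>A\<close> and a cover of \<open>B\<close>.
\<close>

lemma hausdorff_outer_separated:
  assumes "\<epsilon> > 0" and sep: "\<And>a b. a \<in> A \<Longrightarrow> b \<in> B \<Longrightarrow> \<epsilon> \<le> dist a b"
  shows "hausdorff_outer s A + hausdorff_outer s B \<le> hausdorff_outer s (A \<union> B)"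
proof -
  have *: "hausdorff_pre s \<delta> A + hausdorff_pre s \<delta> B \<le> hausdorff_pre s \<delta> (A \<union> B)"
    if \<delta>: "0 < \<delta>" "\<delta> < \<epsilon>" for \<delta>
    unfolding hausdorff_pre_alt[of s \<delta> "A \<union> B"]
  proof (rule INF_greatest, simp)
    fix C assume C: "fine_cover \<delta> (A \<union> B) C"
    let ?CA = "\<lambda>i. if C i \<inter> A = {} then {} else C i"
    let ?CB = "\<lambda>i. if C i \<inter> B = {} then {} else C i"
    have sub: "x \<in> (\<Union>i. C i)" if "x \<in> A \<union> B" for x
      using C that unfolding fine_cover_def by blast
    have "fine_cover \<delta> A ?CA"
      using C sub \<delta> unfolding fine_cover_def by (auto) (metis IntI equals0D)
    moreover have "fine_cover \<delta> B ?CB"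
      using C sub \<delta> unfolding fine_cover_def by (auto) (metis IntI equals0D)
    ultimately have "hausdorff_pre s \<delta> A + hausdorff_pre s \<delta> B
      \<le> (\<Sum>i. diam_weight s (?CA i)) + (\<Sum>i. diam_weight s (?CB i))"
      by (intro add_mono hausdorff_pre_le)
    also have "\<dots> = (\<Sum>i. diam_weight s (?CA i) + diam_weight s (?CB i))"
      by (rule suminf_add) auto
    also have "\<dots> \<le> (\<Sum>i. diam_weight s (C i))"
    proof (intro suminf_le summableI)
      fix i
      have "C i \<inter> A = {} \<or> C i \<inter> B = {}"
      proof (rule ccontr)
        assume "\<not> ?thesis"
        then obtain a b where ab: "a \<in> C i" "a \<in> A" "b \<in> C i" "b \<in> B" by auto
        have "dist a b \<le> diameter (C i)"
          using C ab by (intro diameter_bounded_bound) (auto simp: fine_cover_def)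
        also have "\<dots> \<le> \<delta>" using C by (auto simp: fine_cover_def)
        finally show False using sep[OF ab(2,4)] \<delta> by simp
      qed
      thus "diam_weight s (?CA i) + diam_weight s (?CB i) \<le> diam_weight s (C i)"
        by (auto simp: diam_weight_def)
    qed
    finally show "hausdorff_pre s \<delta> A + hausdorff_pre s \<delta> B \<le> (\<Sum>i. diam_weight s (C i))" .
  qed
  have "hausdorff_outer s A + hausdorff_outer s B
      = (SUP \<delta>\<in>{0<..}. hausdorff_pre s \<delta> A + hausdorff_pre s \<delta> B)"
    unfolding hausdorff_outer_def
  proof (rule SUP_add_directed_ennreal[symmetric])
    fix i j :: real assume "i \<in> {0<..}" "j \<in> {0<..}"
    thus "\<exists>k\<in>{0<..}. hausdorff_pre s i A + hausdorff_pre s j B \<le> hausdorff_pre s k A + hausdorff_pre s k B"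
      by (intro bexI[of _ "min i j"] add_mono hausdorff_pre_mono) auto
  qed
  also have "\<dots> \<le> hausdorff_outer s (A \<union> B)"
  proof (rule SUP_least)
    fix \<delta> :: real assume \<delta>: "\<delta> \<in> {0<..}"
    define \<eta> where "\<eta> = min \<delta> (\<epsilon> / 2)"
    have \<eta>: "0 < \<eta>" "\<eta> < \<epsilon>" "\<eta> \<le> \<delta>" using \<delta> \<open>\<epsilon> > 0\<close> by (auto simp: \<eta>_def)
    have "hausdorff_pre s \<delta> A + hausdorff_pre s \<delta> B \<le> hausdorff_pre s \<eta> A + hausdorff_pre s \<eta> B"
      using \<eta> by (intro add_mono hausdorff_pre_mono) auto
    also have "\<dots> \<le> hausdorff_pre s \<eta> (A \<union> B)" using \<eta> by (intro *)
    also have "\<dots> \<le> hausdorff_outer s (A \<union> B)" using \<eta> by (intro hausdorff_pre_le_outer)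
    finally show "hausdorff_pre s \<delta> A + hausdorff_pre s \<delta> B \<le> hausdorff_outer s (A \<union> B)" .
  qed
  finally show ?thesis .
qed

lemma sum_hausdorff_outer_separated:
  fixes R :: "nat \<Rightarrow> 'a::metric_space set"
  assumes sub: "\<And>k. R k \<subseteq> A"
    and sep: "\<And>k. \<exists>\<epsilon>>0. \<forall>j<k. \<forall>a\<in>R j. \<forall>b\<in>R k. \<epsilon> \<le> dist a b"
  shows "(\<Sum>k<n. hausdorff_outer s (R k)) \<le> hausdorff_outer s A"
proof -
  have "(\<Sum>k<n. hausdorff_outer s (R k)) \<le> hausdorff_outer s (\<Union>k<n. R k)"
  proof (induction n)
    case (Suc n)
    obtain \<epsilon> where e: "\<epsilon> > 0" "\<forall>j<n. \<forall>a\<in>R j. \<forall>b\<in>R n. \<epsilon> \<le> dist a b" using sep by blast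
    have "(\<Sum>k<Suc n. hausdorff_outer s (R k)) \<le> hausdorff_outer s (\<Union>k<n. R k) + hausdorff_outer s (R n)"
      using Suc by (simp add: add_mono)
    also have "\<dots> \<le> hausdorff_outer s ((\<Union>k<n. R k) \<union> R n)"
      using e by (intro hausdorff_outer_separated[of \<epsilon>]) auto
    also have "(\<Union>k<n. R k) \<union> R n = (\<Union>k<Suc n. R k)" by (auto simp: less_Suc_eq)
    finally show ?case .
  qed simp
  also have "\<dots> \<le> hausdorff_outer s A" using sub by (intro hausdorff_outer_mono) auto
  finally show ?thesis .
qed

text \<open>
  Caratheodory's criterion for closed sets. Points of \<open>A\<close> at distance at least \<open>1 / (n + 1)\<close> from
  \<open>F\<close> are separated from \<open>F\<close>; what is left of \<open>A - F\<close> is cut into shells whose measures have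
  a finite sum, so that it is negligible for large \<open>n\<close>.
\<close>

lemma hausdorff_outer_closed_split:
  fixes F :: "'a::metric_space set"
  assumes F: "closed F"
  shows "hausdorff_outer s (A \<inter> F) + hausdorff_outer s (A - F) \<le> hausdorff_outer s A"
proof (cases "F = {} \<or> hausdorff_outer s A = top")
  case True thus ?thesis by auto
next
  case False
  hence F0: "F \<noteq> {}" and fin: "hausdorff_outer s A < top" by (auto simp: less_top)
  let ?h = "hausdorff_outer s"
  define In where "In n = {x\<in>A. 1 / real (Suc n) \<le> infdist x F}" for n
  define R where "R k = {x\<in>A. 1 / real (Suc (Suc k)) \<le> infdist x F \<and> infdist x F < 1 / real (Suc k)}" for k
  have d: "infdist x F \<le> infdist y F + dist x y" for x y by (rule infdist_triangle)
  have sepR: "1 / real (Suc (Suc j)) - 1 / real (Suc k) \<le> dist a b"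
    if "a \<in> R j" "b \<in> R k" for a b j k
    using d[of a b] that by (auto simp: R_def)
  \<comment> \<open>Adjacent shells touch, but shells with indices of the same parity are separated.\<close>
  have parts: "(\<Sum>k<n. ?h (R (2 * k + p))) \<le> ?h A" for n p
  proof (rule sum_hausdorff_outer_separated)
    show "R (2 * k + p) \<subseteq> A" for k by (auto simp: R_def)
    fix k
    define q where "q = 2 * real k + real p"
    define \<epsilon> where "\<epsilon> = 1 / q - 1 / (q + 1)"
    show "\<exists>\<epsilon>>0. \<forall>j<k. \<forall>a\<in>R (2 * j + p). \<forall>b\<in>R (2 * k + p). \<epsilon> \<le> dist a b"
    proof (cases "k = 0")
      case False
      have "q > 0" using False by (simp add: q_def)
      hence "\<epsilon> > 0" by (simp add: \<epsilon>_def field_simps add_pos_pos)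
      moreover have "\<epsilon> \<le> dist a b" if "j < k" "a \<in> R (2 * j + p)" "b \<in> R (2 * k + p)" for j a b
      proof -
        have "2 * j + p + 2 \<le> 2 * k + p" using that by simp
        hence "real (2 * j + p + 2) \<le> real (2 * k + p)" by (rule of_nat_mono)
        hence "1 / (2 * real k + real p) \<le> 1 / real (Suc (Suc (2 * j + p)))"
          by (intro divide_left_mono) (auto)
        thus ?thesis using sepR[OF that(2,3)] unfolding \<epsilon>_def q_def by (simp add: algebra_simps)
      qed
      ultimately show ?thesis by blast
    qed (auto intro: exI[of _ 1])
  qed
  have "(\<Sum>k. ?h (R (2 * k + p))) \<le> ?h A" for p
    by (rule suminf_le_const[OF summableI parts])
  hence fin2: "(\<Sum>k. ?h (R (2 * k + p))) < top" for p using fin by (rule order.strict_trans1)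
  have sumR: "(\<Sum>k. ?h (R k)) < top"
  proof -
    have "(\<Sum>k<n. ?h (R k)) \<le> ?h A + ?h A" for n
    proof -
      have "(\<Sum>k<n. ?h (R k)) \<le> (\<Sum>k<2*n. ?h (R k))" by (rule sum_mono2) auto
      also have "\<dots> = (\<Sum>k<n. ?h (R (2 * k + 0))) + (\<Sum>k<n. ?h (R (2 * k + 1)))"
        by (induction n) (auto simp: algebra_simps)
      also have "\<dots> \<le> ?h A + ?h A" by (intro add_mono parts)
      finally show ?thesis .
    qed
    hence "(\<Sum>k. ?h (R k)) \<le> ?h A + ?h A" by (rule suminf_le_const[OF summableI])
    thus ?thesis using fin by (auto intro: order.strict_trans1)
  qed
  have main: "?h (A \<inter> F) + ?h (A - F) \<le> ?h A + (\<Sum>k. ?h (R (k + n)))" for n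
  proof -
    have "x \<in> In n \<union> (\<Union>k. R (k + n))" if x: "x \<in> A - F" for x
    proof -
      have pos: "infdist x F > 0" using x F F0 in_closed_iff_infdist_zero[OF F F0, of x] infdist_nonneg[of x F] 
        by auto
      show ?thesis
      proof (cases "x \<in> In n")
        case False
        hence lt: "infdist x F < 1 / real (Suc n)" using x by (auto simp: In_def)
        define P where "P m \<longleftrightarrow> 1 / real (Suc m) \<le> infdist x F" for m
        obtain m where "inverse (real (Suc m)) < infdist x F" using reals_Archimedean[OF pos] by blast
        hence m: "P m" by (simp add: P_def inverse_eq_divide)
        define M where "M = (LEAST m. P m)"
        have PM: "P M" unfolding M_def using m by (rule LeastI)
        have nP: "\<not> P j" if "j < M" for j using that not_less_Least unfolding M_def by blast
        have "n < M"
        proof (rule ccontr)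
          assume "\<not> n < M"
          hence "1 / real (Suc n) \<le> 1 / real (Suc M)" by (intro divide_left_mono) auto
          with PM lt show False by (simp add: P_def)
        qed
        then obtain k where k: "M = Suc (k + n)" using less_imp_Suc_add[of n M] by (auto simp: add.commute)
        have "x \<in> R (k + n)" using PM nP[of "k + n"] x k by (auto simp: R_def P_def)
        thus ?thesis by blast
      qed auto
    qed
    hence "?h (A - F) \<le> ?h (In n \<union> (\<Union>k. R (k + n)))" by (intro hausdorff_outer_mono) auto
    also have "\<dots> \<le> ?h (In n) + ?h (\<Union>k. R (k + n))" by (rule hausdorff_outer_Un)
    also have "\<dots> \<le> ?h (In n) + (\<Sum>k. ?h (R (k + n)))"
      by (intro add_left_mono hausdorff_outer_countably_subadditive)
    finally have "?h (A \<inter> F) + ?h (A - F) \<le> (?h (A \<inter> F) + ?h (In n)) + (\<Sum>k. ?h (R (k + n)))"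
      by (simp add: add.assoc add_left_mono)
    also have "?h (A \<inter> F) + ?h (In n) \<le> ?h ((A \<inter> F) \<union> In n)"
    proof (rule hausdorff_outer_separated)
      show "1 / real (Suc n) > 0" by simp
      show "1 / real (Suc n) \<le> dist a b" if "a \<in> A \<inter> F" "b \<in> In n" for a b
        using d[of b a] that by (auto simp: In_def dist_commute)
    qed
    also have "\<dots> \<le> ?h A" by (intro hausdorff_outer_mono) (auto simp: In_def)
    finally show ?thesis by (simp add: add_right_mono)
  qed
  have "(\<lambda>n. \<Sum>k. ?h (R (k + n))) \<longlonglongrightarrow> 0"
  proof -
    have rh: "?h (R k) = ennreal (enn2real (?h (R k)))" for k
      using sumR ennreal_suminf_lessD[of "\<lambda>k. ?h (R k)" top k] by (simp add: less_top)
    have sm: "summable (\<lambda>k. enn2real (?h (R k)))"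
      using sumR by (intro summable_suminf_not_top) (auto simp: rh[symmetric])
    have "(\<lambda>n. ennreal (\<Sum>k. enn2real (?h (R (k + n))))) \<longlonglongrightarrow> ennreal 0"
      using suminf_exist_split2[OF sm] by (intro tendsto_ennrealI)
    moreover have "ennreal (\<Sum>k. enn2real (?h (R (k + n)))) = (\<Sum>k. ?h (R (k + n)))" for n
      using sm by (subst suminf_ennreal2[symmetric]) (auto simp: rh[symmetric] intro: summable_ignore_initial_segment)
    ultimately show ?thesis by simp
  qed
  hence "(\<lambda>n. ?h A + (\<Sum>k. ?h (R (k + n)))) \<longlonglongrightarrow> ?h A + 0" by (intro tendsto_add tendsto_const)
  from tendsto_lowerbound[OF this, of "?h (A \<inter> F) + ?h (A - F)"] main show ?thesis by auto
qed

lemma borel_subset_lambda_system: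
  "sets borel \<subseteq> lambda_system UNIV UNIV (hausdorff_outer s :: 'a::metric_space set \<Rightarrow> ennreal)"
proof -
  interpret sigma_algebra "UNIV :: 'a set" UNIV
    by (rule sigma_algebra_Pow[of UNIV, simplified])
  let ?L = "lambda_system UNIV UNIV (hausdorff_outer s :: 'a set \<Rightarrow> ennreal)"
  have ms: "measure_space UNIV ?L (hausdorff_outer s)"
    by (rule caratheodory_lemma[OF outer_measure_space_hausdorff])
  hence sa: "sigma_algebra UNIV ?L" by (simp add: measure_space_def)
  have "F \<in> ?L" if "closed F" for F
  proof -
    have "hausdorff_outer s (x \<inter> F) + hausdorff_outer s (x - F) = hausdorff_outer s x" for x
    proof (rule antisym[OF hausdorff_outer_closed_split[OF that]])
      have "x = (x \<inter> F) \<union> (x - F)" by auto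
      thus "hausdorff_outer s x \<le> hausdorff_outer s (x \<inter> F) + hausdorff_outer s (x - F)"
        using hausdorff_outer_Un[of s "x \<inter> F" "x - F"] by simp
    qed
    thus ?thesis unfolding lambda_system_eq by simp
  qed
  hence "sigma_sets UNIV (Collect closed) \<subseteq> ?L"
    by (intro sigma_algebra.sigma_sets_subset[OF sa]) auto
  thus ?thesis unfolding borel_eq_closed by simp
qed

lemma measure_space_hausdorff:
  "measure_space UNIV (sets borel) (hausdorff_outer s :: 'a::metric_space set \<Rightarrow> ennreal)"
proof -
  interpret sigma_algebra "UNIV :: 'a set" UNIV
    by (rule sigma_algebra_Pow[of UNIV, simplified])
  have "measure_space UNIV (lambda_system UNIV UNIV (hausdorff_outer s))
    (hausdorff_outer s :: 'a set \<Rightarrow> ennreal)"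
    by (rule caratheodory_lemma[OF outer_measure_space_hausdorff])
  hence ca: "countably_additive (lambda_system UNIV UNIV (hausdorff_outer s))
    (hausdorff_outer s :: 'a set \<Rightarrow> ennreal)"
    by (simp add: measure_space_def)
  have "(\<Sum>i. hausdorff_outer s (A i)) = hausdorff_outer s (\<Union>i. A i)"
    if "range A \<subseteq> sets borel" "disjoint_family A" for A :: "nat \<Rightarrow> 'a set"
  proof -
    have "(\<Union>i. A i) \<in> sets borel" using that by auto
    thus ?thesis
      using ca that borel_subset_lambda_system[of s] unfolding countably_additive_def
      by (meson subset_iff subset_trans)
  qed
  thus ?thesis
    using sets.sigma_algebra_axioms[of "borel :: 'a measure"]
    by (auto simp: measure_space_def positive_def countably_additive_def)
qed

lemma sets_hausdorff_measure [simp, measurable_cong]: "sets (hausdorff_measure s) = sets borel"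
  unfolding hausdorff_measure_def using sets.sigma_sets_eq[of borel] by simp

lemma space_hausdorff_measure [simp]: "space (hausdorff_measure s) = UNIV"
  unfolding hausdorff_measure_def by (simp add: space_measure_of_conv)

lemma emeasure_hausdorff_measure:
  "A \<in> sets borel \<Longrightarrow> emeasure (hausdorff_measure s) A = hausdorff_outer s A"
  unfolding hausdorff_measure_def
  using measure_space_hausdorff[of s] sets.sigma_algebra_axioms[of borel]
  by (intro emeasure_measure_of_sigma) (auto simp: measure_space_def)

section \<open>Uniqueness of translation-invariant measures\<close>

text \<open>
  Integrate \<open>indicator A x * indicator B y\<close> against the product measure. Replacing \<open>x\<close> by \<open>x + y\<close>,
  then \<open>y\<close> by \<open>y - x\<close>, then \<open>x\<close> by \<open>x - y\<close> turns it into \<open>indicator A y * indicator B (- x)\<close>.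
  Only translations by points of \<open>V\<close> occur, because both measures live on \<open>V\<close>.
\<close>

lemma translation_invariant_measure_unique:
  fixes \<mu> \<nu> :: "'a::euclidean_space measure"
  assumes sets_\<mu> [measurable_cong]: "sets \<mu> = sets borel" and sets_\<nu> [measurable_cong]: "sets \<nu> = sets borel"
    and sf: "sigma_finite_measure \<mu>" "sigma_finite_measure \<nu>"
    and V: "subspace V" "AE x in \<mu>. x \<in> V" "AE x in \<nu>. x \<in> V"
    and inv\<mu>: "\<And>v. v \<in> V \<Longrightarrow> distr \<mu> borel (\<lambda>x. x + v) = \<mu>"
    and inv\<nu>: "\<And>v. v \<in> V \<Longrightarrow> distr \<nu> borel (\<lambda>x. x + v) = \<nu>"
    and A [measurable]: "A \<in> sets borel" and B [measurable]: "B \<in> sets borel"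
  shows "emeasure \<nu> A * emeasure \<mu> B = emeasure \<mu> A * emeasure \<nu> (uminus -` B)"
proof -
  interpret pair_sigma_finite \<nu> \<mu> using sf by (simp add: pair_sigma_finite_def)
  let ?A = "indicator A :: 'a \<Rightarrow> ennreal" and ?B = "indicator B :: 'a \<Rightarrow> ennreal"
  have t\<mu>: "(\<integral>\<^sup>+x. f (x + v) \<partial>\<mu>) = (\<integral>\<^sup>+x. f x \<partial>\<mu>)" if "v \<in> V" "f \<in> borel_measurable borel" for f v
    using that by (subst (2) inv\<mu>[symmetric, of v]) (auto simp: nn_integral_distr)
  have t\<nu>: "(\<integral>\<^sup>+x. f (x + v) \<partial>\<nu>) = (\<integral>\<^sup>+x. f x \<partial>\<nu>)" if "v \<in> V" "f \<in> borel_measurable borel" for f v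
    using that by (subst (2) inv\<nu>[symmetric, of v]) (auto simp: nn_integral_distr)
  have [measurable]: "uminus -` B \<in> sets borel"
    using measurable_sets[of uminus borel borel B] by simp
  have "emeasure \<nu> A * emeasure \<mu> B = (\<integral>\<^sup>+y. \<integral>\<^sup>+x. ?A x * ?B y \<partial>\<nu> \<partial>\<mu>)"
    by (simp add: nn_integral_cmult nn_integral_multc sets_\<mu> sets_\<nu>)
  also have "\<dots> = (\<integral>\<^sup>+y. \<integral>\<^sup>+x. ?A (x + y) * ?B y \<partial>\<nu> \<partial>\<mu>)"
    by (rule nn_integral_cong_AE, rule AE_mp[OF V(2)], rule AE_I2, rule impI)
       (subst t\<nu>[of _ "\<lambda>x. ?A x * ?B _", symmetric], auto)
  also have "\<dots> = (\<integral>\<^sup>+x. \<integral>\<^sup>+y. ?A (x + y) * ?B y \<partial>\<mu> \<partial>\<nu>)"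
    by (rule Fubini') measurable
  also have "\<dots> = (\<integral>\<^sup>+x. \<integral>\<^sup>+y. ?A y * ?B (y - x) \<partial>\<mu> \<partial>\<nu>)"
  proof (rule nn_integral_cong_AE, rule AE_mp[OF V(3)], rule AE_I2, rule impI)
    fix x assume "x \<in> V"
    thus "(\<integral>\<^sup>+y. ?A (x + y) * ?B y \<partial>\<mu>) = (\<integral>\<^sup>+y. ?A y * ?B (y - x) \<partial>\<mu>)"
      by (subst t\<mu>[of x "\<lambda>y. ?A y * ?B (y - x)", symmetric]) (auto simp: add.commute)
  qed
  also have "\<dots> = (\<integral>\<^sup>+y. \<integral>\<^sup>+x. ?A y * ?B (y - x) \<partial>\<nu> \<partial>\<mu>)"
    by (rule Fubini'[symmetric]) measurable
  also have "\<dots> = (\<integral>\<^sup>+y. ?A y * emeasure \<nu> (uminus -` B) \<partial>\<mu>)"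
  proof (rule nn_integral_cong_AE, rule AE_mp[OF V(2)], rule AE_I2, rule impI)
    fix y assume y: "y \<in> V"
    have "(\<integral>\<^sup>+x. ?A y * ?B (y - x) \<partial>\<nu>) = ?A y * (\<integral>\<^sup>+x. ?B (y - x) \<partial>\<nu>)"
      by (rule nn_integral_cmult) measurable
    also have "(\<integral>\<^sup>+x. ?B (y - x) \<partial>\<nu>) = (\<integral>\<^sup>+x. ?B (- x) \<partial>\<nu>)"
      using t\<nu>[of "- y" "\<lambda>x. ?B (- x)"] y V(1) by (simp add: subspace_neg)
    also have "\<dots> = (\<integral>\<^sup>+x. indicator (uminus -` B) x \<partial>\<nu>)"
      by (simp add: indicator_vimage)
    also have "\<dots> = emeasure \<nu> (uminus -` B)"
      by (rule nn_integral_indicator) measurable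
    finally show "(\<integral>\<^sup>+x. ?A y * ?B (y - x) \<partial>\<nu>) = ?A y * emeasure \<nu> (uminus -` B)" .
  qed
  also have "\<dots> = emeasure \<mu> A * emeasure \<nu> (uminus -` B)"
    by (simp add: nn_integral_multc sets_\<mu>)
  finally show ?thesis .
qed

lemma sigma_finite_measure_cballs:
  fixes M :: "'a::euclidean_space measure"
  assumes "sets M = sets borel" "\<And>k::nat. emeasure M (cball 0 (real k)) < \<infinity>"
  shows "sigma_finite_measure M"
proof
  have sp: "space M = UNIV" using assms(1) sets_eq_imp_space_eq by fastforce
  show "\<exists>A. countable A \<and> A \<subseteq> sets M \<and> \<Union> A = space M \<and> (\<forall>a\<in>A. emeasure M a \<noteq> \<infinity>)"
  proof (intro exI[of _ "range (\<lambda>k::nat. cball 0 (real k))"] conjI)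
    show "\<Union>(range (\<lambda>k::nat. cball (0::'a) (real k))) = space M"
    proof (intro set_eqI iffI)
      fix x :: 'a
      obtain k :: nat where "norm x \<le> real k" using real_arch_simple by blast
      thus "x \<in> \<Union>(range (\<lambda>k::nat. cball (0::'a) (real k)))" by auto
    qed (simp add: sp)
    show "\<forall>a\<in>range (\<lambda>k::nat. cball (0::'a) (real k)). emeasure M a \<noteq> \<infinity>"
    proof
      fix a assume "a \<in> range (\<lambda>k::nat. cball (0::'a) (real k))"
      then obtain k where a: "a = cball 0 (real k)" by blast
      show "emeasure M a \<noteq> \<infinity>" unfolding a using assms(2)[of k] by (rule less_imp_neq)
    qed
    show "range (\<lambda>k::nat. cball (0::'a) (real k)) \<subseteq> sets M"
      unfolding assms(1) by (intro image_subsetI borel_closed closed_cball)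
  qed simp
qed

lemma borel_measurable_linear:
  fixes T :: "'a::euclidean_space \<Rightarrow> 'b::real_normed_vector"
  assumes "linear T"
  shows "T \<in> borel_measurable borel"
  using assms
  by (intro borel_measurable_continuous_onI linear_continuous_on linear_conv_bounded_linear[THEN iffD1])

text \<open>
  The image of Lebesgue measure under \<open>T\<close> is again translation-invariant, so it is a multiple of
  Lebesgue measure; the unit ball measures the factor.
\<close>

lemma emeasure_lborel_vimage_linear:
  fixes T :: "'a::euclidean_space \<Rightarrow> 'a"
  assumes T: "linear T" "inj T" and A: "A \<in> sets borel"
  shows "emeasure lborel (T -` A) * emeasure lborel (cball 0 1 :: 'a set)
       = emeasure lborel A * emeasure lborel (T -` cball 0 1)"
proof -
  define \<nu> where "\<nu> = distr lborel borel T"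
  have Tm [measurable]: "T \<in> borel_measurable borel"
    by (rule borel_measurable_linear[OF T(1)])
  have e\<nu>: "emeasure \<nu> X = emeasure lborel (T -` X)" if "X \<in> sets borel" for X
    unfolding \<nu>_def using that by (subst emeasure_distr) auto
  have bd: "bounded (T -` cball 0 r)" for r
  proof -
    obtain b where b: "b > 0" "\<And>x. b * norm x \<le> norm (T x)"
      using linear_inj_bounded_below_pos[OF T] by metis
    have "norm x \<le> r / b" if "norm (T x) \<le> r" for x
      using b(2)[of x] that b(1) by (simp add: field_simps)
    thus ?thesis unfolding bounded_iff by (intro exI[of _ "r / b"]) auto
  qed
  have surj: "surj T" using T linear_injective_imp_surjective by blast
  have "emeasure \<nu> A * emeasure lborel (cball 0 1 :: 'a set)
     = emeasure lborel A * emeasure \<nu> (uminus -` cball 0 1)"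
  proof (rule translation_invariant_measure_unique[where V = UNIV])
    show "sigma_finite_measure \<nu>"
    proof (rule sigma_finite_measure_cballs)
      show "emeasure \<nu> (cball 0 (real k)) < \<infinity>" for k
        using emeasure_bounded_finite[OF bd[of "real k"]] by (simp add: e\<nu>)
    qed (simp add: \<nu>_def)
    fix v :: 'a
    show tl: "distr lborel borel (\<lambda>x. x + v) = lborel" for v :: 'a
    proof -
      have "(\<lambda>x. x + v) = (+) v" by (auto simp: add.commute)
      thus ?thesis by (simp add: lborel_distr_plus)
    qed
    obtain w where w: "v = T w" using surj by auto
    have "distr \<nu> borel (\<lambda>x. x + v) = distr lborel borel (\<lambda>x. T x + T w)"
      unfolding \<nu>_def by (subst distr_distr) (auto simp: o_def w)
    also have "\<dots> = distr lborel borel (T \<circ> (\<lambda>x. x + w))"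
      using T by (simp add: o_def linear_add)
    also have "\<dots> = distr (distr lborel borel (\<lambda>x. x + w)) borel T"
      by (subst distr_distr) auto
    also have "\<dots> = \<nu>" unfolding \<nu>_def by (simp only: tl)
    finally show "distr \<nu> borel (\<lambda>x. x + v) = \<nu>" .
  qed (use A in \<open>auto simp: \<nu>_def intro: lborel.sigma_finite_measure_axioms\<close>)
  also have "uminus -` cball 0 1 = (cball 0 1 :: 'a set)" by auto
  finally show ?thesis using A by (simp add: e\<nu>)
qed

lemma emeasure_unit_cball: "0 < emeasure lborel (cball 0 1 :: 'a::euclidean_space set)"
  "emeasure lborel (cball 0 1 :: 'a::euclidean_space set) < \<infinity>"
  using emeasure_lborel_cball_finite[of 0 1] by (auto simp: emeasure_cball)

lemma emeasure_mult_unit_cball_cancel: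
  assumes "x * emeasure lborel (cball 0 1 :: 'a::euclidean_space set) = y * emeasure lborel (cball 0 1 :: 'a set)"
  shows "x = y"
  using assms emeasure_unit_cball[where 'a = 'a]
  by (metis ennreal_mult_cancel_left infinity_ennreal_def less_irrefl mult.commute)

lemma emeasure_lborel_vimage_orthogonal:
  fixes T :: "'a::euclidean_space \<Rightarrow> 'a"
  assumes T: "orthogonal_transformation T" and A: "A \<in> sets borel"
  shows "emeasure lborel (T -` A) = emeasure lborel A"
proof -
  have "T -` cball 0 1 = cball 0 1"
    using T by (auto simp: orthogonal_transformation)
  thus ?thesis
    using emeasure_lborel_vimage_linear[OF orthogonal_transformation_linear[OF T]
        orthogonal_transformation_inj[OF T] A]
    by (simp add: emeasure_mult_unit_cball_cancel)
qed

text \<open>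
  The half-turn \<open>R\<close> about the line through \<open>m\<close> is an isometry that conjugates the shear by \<open>v\<close> into the
  shear by \<open>- v\<close>, which is its inverse. So the factor by which the shear changes volumes equals its
  own inverse.
\<close>

lemma emeasure_lborel_vimage_shear:
  fixes m v :: "'a::euclidean_space"
  assumes mv: "m \<bullet> v = 0" and A: "A \<in> sets borel"
  shows "emeasure lborel ((\<lambda>x. x + (m \<bullet> x) *\<^sub>R v) -` A) = emeasure lborel A"
proof (cases "m = 0")
  case True thus ?thesis by simp
next
  case False
  hence mm: "m \<bullet> m \<noteq> 0" by simp
  define S where "S v = (\<lambda>x. x + (m \<bullet> x) *\<^sub>R v)" for v :: 'a
  define R where "R = (\<lambda>x. (2 * (m \<bullet> x) / (m \<bullet> m)) *\<^sub>R m - x)"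
  have R: "orthogonal_transformation R"
    unfolding orthogonal_transformation_def
  proof
    show "linear R" unfolding R_def
      by (rule linearI) (auto simp: inner_add_right algebra_simps add_divide_distrib)
    show "\<forall>x y. R x \<bullet> R y = x \<bullet> y"
      using mm by (auto simp: R_def inner_diff_left inner_diff_right inner_commute field_simps)
  qed
  have lin: "linear (S w)" for w unfolding S_def
    by (rule linearI) (auto simp: inner_add_right algebra_simps)
  have SS: "S w (S (- w) x) = x" if "m \<bullet> w = 0" for w x
    using that by (simp add: S_def inner_add_right inner_diff_right)
  have inj: "inj (S w)" if "m \<bullet> w = 0" for w
    using SS[of "- w"] that by (intro inj_on_inverseI[of _ "S (- w)"]) simp
  have RR: "R (R x) = x" and mR: "m \<bullet> R x = m \<bullet> x" for x
    using mm by (simp_all add: R_def inner_diff_right)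
  have Rv: "R (R x + c *\<^sub>R v) = x - c *\<^sub>R v" for x c
    using mv RR[of x] orthogonal_transformation_linear[OF R]
    by (simp add: linear_add linear_scale) (simp add: R_def)
  have conj: "R (S v (R x)) = S (- v) x" for x
    by (simp add: S_def mR Rv)
  have meas: "S w -` X \<in> sets borel" if "X \<in> sets borel" for X w
  proof -
    have "S w \<in> borel_measurable borel" unfolding S_def by measurable
    from measurable_sets[OF this that] show ?thesis by simp
  qed
  have Rmeas: "R -` X \<in> sets borel" if "X \<in> sets borel" for X
  proof -
    have "R \<in> borel_measurable borel" unfolding R_def by measurable
    from measurable_sets[OF this that] show ?thesis by simp
  qed
  let ?b = "emeasure lborel (cball 0 1 :: 'a set)"
  let ?s = "emeasure lborel (S v -` cball 0 1)"
  have "S (- v) -` cball 0 1 = R -` (S v -` (R -` cball 0 1))"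
    by (auto simp: conj)
  also have "emeasure lborel \<dots> = emeasure lborel (S v -` (R -` cball 0 1))"
    by (rule emeasure_lborel_vimage_orthogonal[OF R]) (intro meas Rmeas borel_closed closed_cball)
  also have "R -` cball 0 1 = cball 0 1" using R by (auto simp: orthogonal_transformation)
  finally have s': "emeasure lborel (S (- v) -` cball 0 1) = ?s" .
  have "S v -` (S (- v) -` cball 0 1) = cball 0 1"
    using SS[of "- v"] mv by auto
  hence "?b * ?b = ?s * ?s"
    using emeasure_lborel_vimage_linear[OF lin inj, of v "S (- v) -` cball 0 1"] mv meas[of "cball 0 1" "- v"]
    by (simp add: s')
  moreover obtain b s where bs: "?b = ennreal b" "?s = ennreal s" "b \<ge> 0" "s \<ge> 0" "b \<noteq> 0"
  proof -
    have "?s \<noteq> top"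
      using \<open>?b * ?b = ?s * ?s\<close> emeasure_unit_cball[where 'a = 'a] by (auto simp: ennreal_mult_eq_top_iff)
    thus ?thesis using that[of "enn2real ?b" "enn2real ?s"] emeasure_unit_cball[where 'a = 'a, THEN less_imp_neq]
      by (auto simp: enn2real_eq_0_iff ennreal_enn2real_if)
  qed
  ultimately have "b * b = s * s" by (simp add: ennreal_mult[symmetric])
  hence "b = s" using bs by (simp add: power2_eq_square[symmetric] power2_eq_iff_nonneg)
  hence "?s = ?b" using bs by simp
  hence "emeasure lborel (S v -` A) = emeasure lborel A"
    using emeasure_lborel_vimage_linear[OF lin inj[OF mv] A]
    by (simp add: emeasure_mult_unit_cball_cancel)
  thus ?thesis by (simp add: S_def)
qed

section \<open>Sets of finite and of positive Hausdorff measure\<close>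

text \<open>
  The balls of radius \<open>r\<close> around the points of \<open>F\<close> are disjoint and fit into the
  \<open>r\<close>-neighborhood of \<open>A\<close>.
\<close>

lemma separated_card_bound:
  fixes F :: "'a::euclidean_space set"
  assumes F: "finite F" "F \<subseteq> A" and sep: "\<And>x y. x \<in> F \<Longrightarrow> y \<in> F \<Longrightarrow> x \<noteq> y \<Longrightarrow> 2 * r \<le> dist x y"
    and r: "r > 0" and nb: "emeasure lborel (\<Union>a\<in>A. ball a r) \<le> ennreal b" and b: "b \<ge> 0"
  shows "real (card F) * (unit_ball_vol DIM('a) * r ^ DIM('a)) \<le> b"
proof -
  let ?v = "unit_ball_vol DIM('a) * r ^ DIM('a)"
  have v: "?v \<ge> 0" using r by simp
  have disj: "disjoint_family_on (\<lambda>x. ball x r) F"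
    unfolding disjoint_family_on_def
  proof (intro ballI impI)
    fix x y assume xy: "x \<in> F" "y \<in> F" "x \<noteq> y"
    show "ball x r \<inter> ball y r = {}"
    proof (rule ccontr)
      assume "ball x r \<inter> ball y r \<noteq> {}"
      then obtain z where "dist x z < r" "dist y z < r" by auto
      hence "dist x y < 2 * r" using dist_triangle2[of x y z] by simp
      with sep[OF xy] show False by simp
    qed
  qed
  have "ennreal (real (card F) * ?v) = (\<Sum>x\<in>F. emeasure lborel (ball x r))"
    using r v by (simp add: emeasure_ball ennreal_mult ennreal_of_nat_eq_real_of_nat)
  also have "\<dots> = emeasure lborel (\<Union>x\<in>F. ball x r)"
    using F disj by (intro sum_emeasure) auto
  also have "\<dots> \<le> emeasure lborel (\<Union>a\<in>A. ball a r)"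
    using F by (intro emeasure_mono) (auto intro!: borel_open)
  also note nb
  finally show ?thesis using b by simp
qed

text \<open>
  Finite Minkowski content implies finite Hausdorff measure: a maximal \<open>2 * r\<close>-separated subset of
  \<open>A\<close> has \<open>O(r ^ (- s))\<close> points by volume comparison, and the balls of radius \<open>2 * r\<close> around them
  cover \<open>A\<close>.
\<close>

lemma hausdorff_outer_finite:
  fixes A :: "'a::euclidean_space set"
  assumes dim: "DIM('a) = Suc s" and c: "c \<ge> 0" and r0: "r0 > 0"
    and nb: "\<And>r. 0 < r \<Longrightarrow> r < r0 \<Longrightarrow> emeasure lborel (\<Union>a\<in>A. ball a r) \<le> ennreal (c * r)"
  shows "hausdorff_outer s A < \<infinity>"
proof -
  define V where "V = unit_ball_vol DIM('a)"
  have V: "V > 0" by (simp add: V_def)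
  define K where "K = c * 4 ^ s / V"
  have K: "K \<ge> 0" using c V by (simp add: K_def)
  have *: "hausdorff_pre s (4 * r) A \<le> ennreal K" if r: "0 < r" "r < r0" for r
  proof -
    define Sep where "Sep F \<longleftrightarrow> finite F \<and> F \<subseteq> A \<and> (\<forall>x\<in>F. \<forall>y\<in>F. x \<noteq> y \<longrightarrow> 2 * r \<le> dist x y)" for F
    have bound: "real (card F) * (V * r ^ Suc s) \<le> c * r" if "Sep F" for F
      using separated_card_bound[of F A r "c * r"] that r c nb[OF r] by (auto simp: Sep_def V_def dim)
    have Vr: "V * r ^ Suc s > 0" using V r by simp
    have cb: "card F < Suc (nat \<lceil>c * r / (V * r ^ Suc s)\<rceil>)" if "Sep F" for F
    proof -
      have "real (card F) \<le> c * r / (V * r ^ Suc s)" using bound[OF that] Vr by (simp only: pos_le_divide_eq)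
      thus ?thesis by linarith
    qed
    have "Sep {}" by (simp add: Sep_def)
    hence "\<exists>F. Sep F \<and> (\<forall>G. Sep G \<longrightarrow> card G \<le> card F)"
      by (rule ex_has_greatest_nat) (use cb in blast)
    then obtain F where F: "Sep F" and max: "\<And>G. Sep G \<Longrightarrow> card G \<le> card F" by blast
    have cov: "\<exists>f\<in>F. a \<in> cball f (2 * r)" if a: "a \<in> A" for a
    proof (rule ccontr)
      assume no: "\<not> ?thesis"
      have nF: "a \<notin> F" using no r by force
      have "Sep (insert a F)"
        using F a no by (auto simp: Sep_def dist_commute not_le less_imp_le)
      from max[OF this] show False using F nF by (simp add: Sep_def)
    qed
    have "finite F" using F by (simp add: Sep_def)
    from finite_distinct_list[OF this] obtain xs where xs: "set xs = F" "distinct xs" by blast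
    have len: "length xs = card F" using xs distinct_card by metis
    define C where "C i = (if i < length xs then cball (xs ! i) (2 * r) else {})" for i
    have dC: "diameter (C i) \<le> 4 * r" for i using r by (auto simp: C_def)
    have "fine_cover (4 * r) A C"
      unfolding fine_cover_def
    proof (intro conjI allI)
      show "A \<subseteq> (\<Union>i. C i)"
      proof
        fix a assume "a \<in> A"
        then obtain f where "f \<in> F" "a \<in> cball f (2 * r)" using cov by blast
        then obtain i where "i < length xs" "a \<in> cball (xs ! i) (2 * r)" using xs by (metis in_set_conv_nth)
        thus "a \<in> (\<Union>i. C i)" unfolding C_def by (intro UN_I[of i]) auto
      qed
    qed (use dC in \<open>auto simp: C_def\<close>)
    hence "hausdorff_pre s (4 * r) A \<le> (\<Sum>i. diam_weight s (C i))" by (rule hausdorff_pre_le)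
    also have "\<dots> = (\<Sum>i<length xs. diam_weight s (C i))"
      by (rule suminf_finite) (auto simp: C_def diam_weight_def)
    also have "\<dots> \<le> (\<Sum>i<length xs. ennreal ((4 * r) ^ s))"
      using dC diameter_ge_0[of "C _"]
      by (intro sum_mono) (auto simp: diam_weight_def C_def intro!: ennreal_leI power_mono)
    also have "\<dots> = ennreal (real (card F) * (4 * r) ^ s)"
      using r by (simp add: len ennreal_mult ennreal_of_nat_eq_real_of_nat)
    also have "real (card F) * (4 * r) ^ s \<le> K"
    proof -
      have "real (card F) * (4 * r) ^ s * (V * r) = real (card F) * (V * r ^ Suc s) * 4 ^ s"
        by (simp add: power_mult_distrib)
      also have "\<dots> \<le> c * r * 4 ^ s" by (intro mult_right_mono bound F) auto
      also have "\<dots> = K * (V * r)" using V by (simp add: K_def)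
      finally show ?thesis using V r by simp
    qed
    finally show ?thesis by (simp add: ennreal_leI order_trans)
  qed
  have "hausdorff_outer s A \<le> ennreal K"
    unfolding hausdorff_outer_def
  proof (rule SUP_least)
    fix \<delta> :: real assume "\<delta> \<in> {0<..}"
    hence d: "\<delta> > 0" by simp
    define r where "r = min (\<delta> / 4) (r0 / 2)"
    have r: "0 < r" "r < r0" "4 * r \<le> \<delta>" using d r0 by (auto simp: r_def)
    have "hausdorff_pre s \<delta> A \<le> hausdorff_pre s (4 * r) A" using r by (intro hausdorff_pre_mono) auto
    also have "\<dots> \<le> ennreal K" by (rule *) (use r in auto)
    finally show "hausdorff_pre s \<delta> A \<le> ennreal K" .
  qed
  thus ?thesis by (auto intro: order.strict_trans1)
qed

text \<open>
  The cylinder over \<open>C\<close> in direction \<open>n\<close>. Up to a constant factor its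
  volume bounds the Hausdorff measure of \<open>C\<close> from below.
\<close>

definition tube :: "'a::euclidean_space \<Rightarrow> real \<Rightarrow> 'a set \<Rightarrow> 'a set" where
  "tube n L C = (\<lambda>(a, t). a + t *\<^sub>R n) ` (C \<times> {-L..L})"

lemma compact_tube: "compact C \<Longrightarrow> compact (tube n L C)"
  unfolding tube_def case_prod_unfold
  by (intro compact_continuous_image compact_Times compact_Icc continuous_intros)

text \<open>
  A tube over a set of diameter \<open>d\<close> is covered by \<open>O(1 / d)\<close> balls of radius \<open>2 * d\<close> placed along
  its axis.
\<close>

lemma emeasure_tube_le_pow:
  fixes C :: "'a::euclidean_space set"
  assumes dim: "DIM('a) = Suc s" and C: "compact C" "diameter C \<le> d" and d: "0 < d" "d \<le> 1"
    and n: "norm n = 1" and L: "L > 0"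
  shows "emeasure lborel (tube n L C) \<le> ennreal ((2 * L + 2) * unit_ball_vol DIM('a) * 2 ^ Suc s * d ^ s)"
proof (cases "C = {}")
  case True
  thus ?thesis by (simp add: tube_def)
next
  case False
  then obtain x0 where x0: "x0 \<in> C" by auto
  define V where "V = unit_ball_vol DIM('a)"
  have V: "V > 0" by (simp add: V_def)
  define J where "J = {\<lfloor>- L / d\<rfloor> .. \<lfloor>L / d\<rfloor>}"
  have sub: "tube n L C \<subseteq> (\<Union>j\<in>J. cball (x0 + (of_int j * d) *\<^sub>R n) (2 * d))"
  proof
    fix y assume "y \<in> tube n L C"
    then obtain a t where y: "y = a + t *\<^sub>R n" "a \<in> C" "- L \<le> t" "t \<le> L" by (auto simp: tube_def)
    define j where "j = \<lfloor>t / d\<rfloor>"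
    have "j \<in> J" unfolding J_def j_def atLeastAtMost_iff
      by (intro conjI floor_mono divide_right_mono) (use y d in auto)
    have j1: "of_int j * d \<le> t" unfolding j_def using d
      by (metis floor_divide_lower mult.commute)
    have "t / d < of_int j + 1" unfolding j_def by linarith
    hence j2: "t < (of_int j + 1) * d" using d by (simp add: divide_less_eq)
    have "dist (x0 + (of_int j * d) *\<^sub>R n) y = norm ((x0 - a) + (of_int j * d - t) *\<^sub>R n)"
      by (simp add: y dist_norm algebra_simps)
    also have "\<dots> \<le> norm (x0 - a) + \<bar>of_int j * d - t\<bar>"
      using n by (intro order.trans[OF norm_triangle_ineq]) simp
    also have "norm (x0 - a) \<le> d"
      using diameter_bounded_bound[OF compact_imp_bounded[OF C(1)] x0 y(2)] C(2) by (simp add: dist_norm)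
    also have "\<bar>of_int j * d - t\<bar> \<le> d" using j1 j2 by (simp add: algebra_simps)
    finally show "y \<in> (\<Union>j\<in>J. cball (x0 + (of_int j * d) *\<^sub>R n) (2 * d))"
      using \<open>j \<in> J\<close> by auto
  qed
  have "emeasure lborel (tube n L C)
      \<le> emeasure lborel (\<Union>j\<in>J. cball (x0 + (of_int j * d) *\<^sub>R n) (2 * d))"
    by (intro emeasure_mono sub) (auto simp: J_def)
  also have "\<dots> \<le> (\<Sum>j\<in>J. emeasure lborel (cball (x0 + (of_int j * d) *\<^sub>R n) (2 * d)))"
    by (intro emeasure_subadditive_finite) (auto simp: J_def)
  also have "\<dots> = ennreal (real (card J) * (V * (2 * d) ^ Suc s))"
    using d V by (simp add: emeasure_cball dim V_def ennreal_mult ennreal_of_nat_eq_real_of_nat)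
  also have "real (card J) * (V * (2 * d) ^ Suc s) \<le> (2 * L + 2) / d * (V * (2 * d) ^ Suc s)"
  proof (intro mult_right_mono)
    have "0 \<le> L / d" using L d by simp
    hence "real (card J) \<le> 2 * (L / d) + 2"
      by (simp add: J_def) linarith
    also have "\<dots> \<le> (2 * L + 2) / d" using d by (simp add: field_simps)
    finally show "real (card J) \<le> (2 * L + 2) / d" .
  qed (use V d in auto)
  also have "(2 * L + 2) / d * (V * (2 * d) ^ Suc s) = (2 * L + 2) * V * 2 ^ Suc s * d ^ s"
    using d by (simp add: power_mult_distrib field_simps)
  finally show ?thesis by (simp add: V_def ennreal_leI)
qed

text \<open>
  The preceding bound holds for all \<open>d\<close> slightly larger than the diameter. Passing to the limit also
  covers one-point sets, where the power \<open>0 ^ s\<close> is 0 or 1 depending on the dimension.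
\<close>

lemma emeasure_tube_le_diam_weight:
  fixes C :: "'a::euclidean_space set"
  assumes dim: "DIM('a) = Suc s" and C: "compact C" "diameter C < 1"
    and n: "norm n = 1" and L: "L > 0"
  shows "emeasure lborel (tube n L C)
    \<le> ennreal ((2 * L + 2) * unit_ball_vol DIM('a) * 2 ^ Suc s) * diam_weight s C"
proof (cases "C = {}")
  case True
  thus ?thesis by (simp add: tube_def)
next
  case False
  define K where "K = (2 * L + 2) * unit_ball_vol DIM('a) * 2 ^ Suc s"
  have d0: "diameter C \<ge> 0" by (rule diameter_ge_0[OF compact_imp_bounded[OF C(1)]])
  have "eventually (\<lambda>d. diameter C < d \<and> d < 1) (at_right (diameter C))"
    using C(2) by (auto simp: eventually_at_right)
  hence ev: "eventually (\<lambda>d. emeasure lborel (tube n L C) \<le> ennreal (K * d ^ s)) (at_right (diameter C))"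
  proof eventually_elim
    case (elim d)
    show ?case unfolding K_def
      by (rule emeasure_tube_le_pow[OF dim C(1) _ _ _ n L]) (use elim d0 in auto)
  qed
  have lim: "((\<lambda>d. ennreal (K * d ^ s)) \<longlongrightarrow> ennreal (K * diameter C ^ s)) (at_right (diameter C))"
    by (intro tendsto_intros)
  have "emeasure lborel (tube n L C) \<le> ennreal (K * diameter C ^ s)"
    by (rule tendsto_lowerbound[OF lim ev]) simp
  also have "\<dots> = ennreal K * diam_weight s C"
    using False d0 L by (simp add: diam_weight_def ennreal_mult K_def)
  finally show ?thesis by (simp add: K_def)
qed

text \<open>
  A cover of \<open>A\<close> yields a cover of the tube over \<open>A\<close> by tubes, so the weights of a cover cannot add
  up to less than a fixed multiple of the volume of the ball inside that tube.
\<close>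

lemma hausdorff_outer_positive:
  fixes A :: "'a::euclidean_space set"
  assumes dim: "DIM('a) = Suc s" and n: "norm n = 1" and L: "L > 0"
    and ball: "cball 0 L \<subseteq> tube n L A"
  shows "0 < hausdorff_outer s A"
proof (rule ccontr)
  assume "\<not> ?thesis"
  hence "hausdorff_pre s (1/2) A = 0"
    using hausdorff_pre_le_outer[of "1/2" s A] by simp
  define K where "K = (2 * L + 2) * unit_ball_vol DIM('a) * 2 ^ Suc s"
  have K: "K > 0" using L by (simp add: K_def)
  define b where "b = unit_ball_vol DIM('a) * L ^ DIM('a)"
  have b: "b > 0" using L by (simp add: b_def)
  have "hausdorff_pre s (1/2) A < ennreal (b / K)" using \<open>_ = 0\<close> b K by simp
  then obtain C where C: "fine_cover (1/2) A C" "(\<Sum>i. diam_weight s (C i)) < ennreal (b / K)"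
    using hausdorff_pre_less by blast
  have bd: "bounded (C i)" and dC: "diameter (C i) \<le> 1/2" for i using C(1) by (auto simp: fine_cover_def)
  have cc: "compact (closure (C i))" for i using bd by simp
  have dw: "diam_weight s (closure (C i)) = diam_weight s (C i)" for i
    using diameter_closure[OF bd[of i]] by (simp add: diam_weight_def)
  have "cball 0 L \<subseteq> (\<Union>i. tube n L (closure (C i)))"
  proof
    fix y :: 'a assume "y \<in> cball 0 L"
    then obtain a t where y: "y = a + t *\<^sub>R n" "a \<in> A" "t \<in> {-L..L}" using ball by (auto simp: tube_def)
    then obtain i where "a \<in> C i" using C(1) by (auto simp: fine_cover_def)
    hence "a \<in> closure (C i)" using closure_subset by blast
    hence "y \<in> tube n L (closure (C i))" using y by (force simp: tube_def)
    thus "y \<in> (\<Union>i. tube n L (closure (C i)))" by blast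
  qed
  hence sub: "emeasure lborel (cball 0 L :: 'a set) \<le> emeasure lborel (\<Union>i. tube n L (closure (C i)))"
    using compact_tube[OF cc] by (intro emeasure_mono sets.countable_UN) (auto simp: borel_compact)
  have "ennreal b = emeasure lborel (cball 0 L :: 'a set)"
    using L by (simp add: emeasure_cball b_def)
  also note sub
  also have "emeasure lborel (\<Union>i. tube n L (closure (C i)))
      \<le> (\<Sum>i. emeasure lborel (tube n L (closure (C i))))"
    using compact_tube[OF cc] by (intro emeasure_subadditive_countably) (auto simp: borel_compact)
  also have "\<dots> \<le> (\<Sum>i. ennreal K * diam_weight s (closure (C i)))"
    unfolding K_def using dC
    by (intro suminf_le summableI emeasure_tube_le_diam_weight[OF dim cc _ n L])
       (simp add: diameter_closure[OF bd] order.strict_trans1[of _ "1/2"])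
  also have "\<dots> = ennreal K * (\<Sum>i. diam_weight s (C i))"
    by (simp add: dw)
  also have "\<dots> < ennreal K * ennreal (b / K)"
    using K C(2) by (intro ennreal_mult_strict_left_mono) auto
  also have "\<dots> = ennreal b" using K b by (simp add: ennreal_mult[symmetric])
  finally show False by simp
qed

section \<open>Integrals of homogeneous functions over truncated cones\<close>

lemma nn_integral_lborel_scale:
  fixes f :: "'a::euclidean_space \<Rightarrow> ennreal"
  assumes [measurable]: "f \<in> borel_measurable borel" and s: "s > 0"
  shows "(\<integral>\<^sup>+y. f y \<partial>lborel) = ennreal (s ^ DIM('a)) * (\<integral>\<^sup>+y. f (s *\<^sub>R y) \<partial>lborel)"
proof -
  have "(\<integral>\<^sup>+y. f y \<partial>lborel)
      = (\<integral>\<^sup>+y. f y \<partial>(density (distr lborel borel (\<lambda>x. 0 + s *\<^sub>R x)) (\<lambda>_. ennreal (\<bar>s\<bar> ^ DIM('a)))))"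
    using s by (subst lborel_affine[of s 0]) auto
  also have "\<dots> = ennreal (s ^ DIM('a)) * (\<integral>\<^sup>+y. f (s *\<^sub>R y) \<partial>lborel)"
    using s by (simp add: nn_integral_density nn_integral_distr nn_integral_cmult)
  finally show ?thesis .
qed

text \<open>
  Let \<open>L\<close> be the volume of \<open>S\<close> and \<open>I\<close> the integral of \<open>\<rho> ^ k\<close> over \<open>S\<close>. By scaling, the part of
  \<open>S\<close> where \<open>\<rho>\<close> exceeds \<open>s\<close> contributes \<open>(1 - s ^ D) * L\<close> and \<open>(1 - s ^ (D + k)) * I\<close>. As \<open>\<rho> ^ k\<close>
  lies between \<open>s ^ k\<close> and 1 there, dividing by \<open>1 - s\<close> and letting \<open>s\<close> tend to 1 gives
  \<open>(D + k) * I = D * L\<close>.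
\<close>

lemma nn_integral_homogeneous_cone:
  fixes C :: "'a::euclidean_space set" and \<rho> :: "'a \<Rightarrow> real"
  assumes C [measurable]: "C \<in> sets borel" and \<rho> [measurable]: "\<rho> \<in> borel_measurable borel"
    and cone: "\<And>t y. t > 0 \<Longrightarrow> y \<in> C \<Longrightarrow> t *\<^sub>R y \<in> C"
    and hom: "\<And>t y. t > 0 \<Longrightarrow> y \<in> C \<Longrightarrow> \<rho> (t *\<^sub>R y) = t * \<rho> y"
    and pos: "\<And>y. y \<in> C \<Longrightarrow> 0 < \<rho> y"
    and S: "S = {y\<in>C. \<rho> y \<le> 1}" and fin: "emeasure lborel S < \<infinity>"
  shows "ennreal (real (DIM('a) + k)) * (\<integral>\<^sup>+y. ennreal (\<rho> y ^ k) * indicator S y \<partial>lborel)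
       = ennreal (real DIM('a)) * emeasure lborel S"
proof -
  let ?D = "DIM('a)"
  define Ss where "Ss s = {y\<in>C. \<rho> y \<le> s}" for s
  have Sm [measurable]: "Ss s \<in> sets borel" for s unfolding Ss_def by measurable
  have S1: "S = Ss 1" by (simp add: S Ss_def)
  have SsI: "s *\<^sub>R y \<in> Ss s \<longleftrightarrow> y \<in> Ss 1" if s: "s > 0" for s y
  proof -
    have "y \<in> C" if "s *\<^sub>R y \<in> C" using cone[of "1 / s" "s *\<^sub>R y"] that s by simp
    thus ?thesis using s cone[of s y] hom[of s y] by (auto simp: Ss_def)
  qed
  define N where "N j s = (\<integral>\<^sup>+y. ennreal (\<rho> y ^ j) * indicator (Ss s) y \<partial>lborel)" for j s
  have Nscale: "N j s = ennreal (s ^ (?D + j)) * N j 1" if s: "s > 0" for j s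
  proof -
    have "N j s = ennreal (s ^ ?D) * (\<integral>\<^sup>+y. ennreal (\<rho> (s *\<^sub>R y) ^ j) * indicator (Ss s) (s *\<^sub>R y) \<partial>lborel)"
      unfolding N_def by (rule nn_integral_lborel_scale[OF _ s]) measurable
    also have "(\<integral>\<^sup>+y. ennreal (\<rho> (s *\<^sub>R y) ^ j) * indicator (Ss s) (s *\<^sub>R y) \<partial>lborel)
      = (\<integral>\<^sup>+y. ennreal (s ^ j) * (ennreal (\<rho> y ^ j) * indicator (Ss 1) y) \<partial>lborel)"
    proof (rule nn_integral_cong)
      fix y
      show "ennreal (\<rho> (s *\<^sub>R y) ^ j) * indicator (Ss s) (s *\<^sub>R y)
        = ennreal (s ^ j) * (ennreal (\<rho> y ^ j) * indicator (Ss 1) y)"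
      proof (cases "y \<in> Ss 1")
        case True
        hence "y \<in> C" by (simp add: Ss_def)
        hence "\<rho> (s *\<^sub>R y) ^ j = s ^ j * \<rho> y ^ j" "0 \<le> \<rho> y ^ j"
          using hom[OF s] pos[of y] by (auto simp: power_mult_distrib)
        thus ?thesis using True s SsI[OF s, of y] by (simp add: ennreal_mult)
      next
        case False
        thus ?thesis using SsI[OF s, of y] by simp
      qed
    qed
    also have "\<dots> = ennreal (s ^ j) * N j 1"
      unfolding N_def by (rule nn_integral_cmult) measurable
    finally show ?thesis using s by (simp add: power_add ennreal_mult mult.assoc)
  qed
  have N0: "N 0 s = emeasure lborel (Ss s)" for s
    unfolding N_def by simp
  have Nle: "N k 1 \<le> N 0 1"
    unfolding N_def
  proof (rule nn_integral_mono)
    fix y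
    have "\<rho> y ^ k \<le> 1" if "y \<in> Ss 1" using that pos[of y] by (auto simp: Ss_def intro!: power_le_one)
    thus "ennreal (\<rho> y ^ k) * indicator (Ss 1) y \<le> ennreal (\<rho> y ^ 0) * indicator (Ss 1) y"
      by (auto simp: indicator_def)
  qed
  define L where "L = enn2real (N 0 1)"
  define I where "I = enn2real (N k 1)"
  have fin0: "N 0 1 < top" using fin by (simp add: N0 S1)
  have L: "N 0 1 = ennreal L" "L \<ge> 0" using fin0 by (auto simp: L_def)
  have I: "N k 1 = ennreal I" "I \<ge> 0" using Nle fin0 by (auto simp: I_def order.strict_trans1)
  have squeeze: "s ^ k * ((\<Sum>j<?D. s ^ j) * L) \<le> (\<Sum>j<?D + k. s ^ j) * I \<and>
      (\<Sum>j<?D + k. s ^ j) * I \<le> (\<Sum>j<?D. s ^ j) * L" if s: "0 < s" "s < 1" for s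
  proof -
    define P where "P j = (\<integral>\<^sup>+y. ennreal (\<rho> y ^ j) * indicator (Ss 1 - Ss s) y \<partial>lborel)" for j
    have split: "N j 1 = N j s + P j" for j
    proof -
      have "N j 1 = (\<integral>\<^sup>+y. ennreal (\<rho> y ^ j) * indicator (Ss s) y
          + ennreal (\<rho> y ^ j) * indicator (Ss 1 - Ss s) y \<partial>lborel)"
        unfolding N_def using s by (intro nn_integral_cong) (auto simp: indicator_def Ss_def)
      also have "\<dots> = N j s + P j"
        unfolding N_def P_def by (rule nn_integral_add) measurable
      finally show ?thesis .
    qed
    have P1: "P k \<le> P 0"
      unfolding P_def
    proof (rule nn_integral_mono)
      fix y
      have "\<rho> y ^ k \<le> 1" if "y \<in> Ss 1" using that pos[of y] by (auto simp: Ss_def intro!: power_le_one)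
      thus "ennreal (\<rho> y ^ k) * indicator (Ss 1 - Ss s) y \<le> ennreal (\<rho> y ^ 0) * indicator (Ss 1 - Ss s) y"
        by (auto simp: indicator_def)
    qed
    have "ennreal (s ^ k) * P 0 = (\<integral>\<^sup>+y. ennreal (s ^ k) * (ennreal (\<rho> y ^ 0) * indicator (Ss 1 - Ss s) y) \<partial>lborel)"
      unfolding P_def by (rule nn_integral_cmult[symmetric]) measurable
    also have "\<dots> \<le> P k"
      unfolding P_def
    proof (rule nn_integral_mono)
      fix y
      have "s ^ k \<le> \<rho> y ^ k" if "y \<in> Ss 1 - Ss s"
        using that s by (auto simp: Ss_def intro!: power_mono)
      thus "ennreal (s ^ k) * (ennreal (\<rho> y ^ 0) * indicator (Ss 1 - Ss s) y)
        \<le> ennreal (\<rho> y ^ k) * indicator (Ss 1 - Ss s) y"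
        by (auto simp: indicator_def intro!: ennreal_leI)
    qed
    finally have P2: "ennreal (s ^ k) * P 0 \<le> P k" .
    have pw: "1 - s ^ n = (1 - s) * (\<Sum>j<n. s ^ j)" "s ^ n \<le> 1" for n
      using s by (auto simp: one_diff_power_eq intro!: power_le_one)
    have Pv: "P j = ennreal ((1 - s ^ (?D + j)) * x)" if x: "N j 1 = ennreal x" "x \<ge> 0" for j x
    proof -
      have "ennreal (s ^ (?D + j) * x) + P j = N j s + P j"
        using Nscale[OF s(1), of j] x s by (simp add: ennreal_mult)
      also have "\<dots> = ennreal x" using split[of j] x by simp
      also have "ennreal x = ennreal (s ^ (?D + j) * x + (1 - s ^ (?D + j)) * x)" by (simp add: algebra_simps)
      also have "\<dots> = ennreal (s ^ (?D + j) * x) + ennreal ((1 - s ^ (?D + j)) * x)"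
        using s x pw(2)[of "?D + j"] by (intro ennreal_plus) auto
      finally show ?thesis by (simp add: ennreal_add_left_cancel)
    qed
    have P0v: "P 0 = ennreal ((1 - s ^ ?D) * L)" using Pv[OF L] by simp
    have Pkv: "P k = ennreal ((1 - s ^ (?D + k)) * I)" using Pv[OF I] .
    have nn: "0 \<le> (1 - s ^ n) * x" if "x \<ge> 0" for n x using pw(2)[of n] that by simp
    have "s ^ k * ((1 - s ^ ?D) * L) \<le> (1 - s ^ (?D + k)) * I"
      using P2 s nn[OF I(2), of "?D + k"] nn[OF L(2), of ?D]
      by (simp add: P0v Pkv ennreal_mult[symmetric])
    hence "(1 - s) * (s ^ k * ((\<Sum>j<?D. s ^ j) * L)) \<le> (1 - s) * ((\<Sum>j<?D + k. s ^ j) * I)"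
      by (simp only: pw(1) ac_simps)
    moreover have "(1 - s ^ (?D + k)) * I \<le> (1 - s ^ ?D) * L"
      using P1 nn[OF I(2), of "?D + k"] nn[OF L(2), of ?D] by (simp add: P0v Pkv)
    hence "(1 - s) * ((\<Sum>j<?D + k. s ^ j) * I) \<le> (1 - s) * ((\<Sum>j<?D. s ^ j) * L)"
      by (simp only: pw(1) ac_simps)
    ultimately show ?thesis using s by simp
  qed
  have ev: "eventually (\<lambda>s::real. 0 < s \<and> s < 1) (at_left 1)"
    unfolding eventually_at_left[of 0 "1::real", simplified] by (intro exI[of _ 0]) auto
  have t1: "((\<lambda>s::real. s ^ k * ((\<Sum>j<?D. s ^ j) * L)) \<longlongrightarrow> 1 ^ k * ((\<Sum>j<?D. 1 ^ j) * L)) (at_left 1)"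
    by (intro tendsto_intros)
  have t2: "((\<lambda>s::real. (\<Sum>j<?D + k. s ^ j) * I) \<longlongrightarrow> (\<Sum>j<?D + k. 1 ^ j) * I) (at_left 1)"
    by (intro tendsto_intros)
  have t3: "((\<lambda>s::real. (\<Sum>j<?D. s ^ j) * L) \<longlongrightarrow> (\<Sum>j<?D. 1 ^ j) * L) (at_left 1)"
    by (intro tendsto_intros)
  have "1 ^ k * ((\<Sum>j<?D. 1 ^ j) * L) \<le> (\<Sum>j<?D + k. 1 ^ j) * I"
    by (rule tendsto_le[OF _ t2 t1]) (use ev squeeze in \<open>auto elim!: eventually_mono\<close>)
  moreover have "(\<Sum>j<?D + k. 1 ^ j) * I \<le> (\<Sum>j<?D. 1 ^ j) * L"
    by (rule tendsto_le[OF _ t3 t2]) (use ev squeeze in \<open>auto elim!: eventually_mono\<close>)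
  ultimately have "real (?D + k) * I = real ?D * L" by simp
  moreover have "(\<integral>\<^sup>+y. ennreal (\<rho> y ^ k) * indicator S y \<partial>lborel) = ennreal I"
    using I(1) by (simp add: N_def S1)
  moreover have "emeasure lborel S = ennreal L" using L(1) N0[of 1] by (simp add: S1)
  ultimately show ?thesis using I(2) L(2) by (simp add: ennreal_mult[symmetric] del: of_nat_add)
qed

section \<open>Hausdorff measure on hyperplanes\<close>

text \<open>
  A rotation takes \<open>n\<close> to a coordinate axis and the set into a box with one side \<open>2 * r\<close> and all
  others \<open>2 * R\<close>.
\<close>

lemma emeasure_slab_le:
  fixes n :: "real ^ 'n"
  assumes n: "norm n = 1" and r: "r \<ge> 0" and R: "R \<ge> 0"
  shows "emeasure lborel {y. \<bar>n \<bullet> y\<bar> \<le> r \<and> norm y \<le> R} \<le> ennreal (2 * r * (2 * R) ^ (CARD('n) - 1))"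
proof -
  obtain i :: 'n where True by simp
  have "norm (axis i 1 :: real ^ 'n) = 1" by simp
  with n obtain T where T: "orthogonal_transformation T" "T n = (axis i 1 :: real ^ 'n)"
    by (rule orthogonal_transformation_exists_1)
  define a :: "real ^ 'n" where "a = (\<chi> j. if j = i then r else R)"
  have "{y. \<bar>n \<bullet> y\<bar> \<le> r \<and> norm y \<le> R} \<subseteq> T -` cbox (- a) a"
  proof
    fix y assume "y \<in> {y. \<bar>n \<bullet> y\<bar> \<le> r \<and> norm y \<le> R}"
    hence y: "\<bar>n \<bullet> y\<bar> \<le> r" "norm y \<le> R" by auto
    have "n \<bullet> y = T n \<bullet> T y" using T(1) unfolding orthogonal_transformation_def by metis
    also have "\<dots> = T y $ i" by (simp add: T inner_axis')
    finally have "\<bar>T y $ i\<bar> \<le> r" using y by simp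
    moreover have "\<bar>T y $ j\<bar> \<le> R" for j
      using component_le_norm_cart[of "T y" j] y orthogonal_transformation_norm[OF T(1), of y] by simp
    ultimately have "\<bar>T y $ j\<bar> \<le> a $ j" for j by (simp add: a_def)
    thus "y \<in> T -` cbox (- a) a" by (auto simp: mem_box_cart abs_le_iff minus_le_iff)
  qed
  hence "emeasure lborel {y. \<bar>n \<bullet> y\<bar> \<le> r \<and> norm y \<le> R} \<le> emeasure lborel (T -` cbox (- a) a)"
  proof (rule emeasure_mono)
    from measurable_sets[OF borel_measurable_linear[OF orthogonal_transformation_linear[OF T(1)]],
        of "cbox (- a) a"] show "T -` cbox (- a) a \<in> sets lborel" by simp
  qed
  also have "\<dots> = emeasure lborel (cbox (- a) a)"
    by (rule emeasure_lborel_vimage_orthogonal[OF T(1)]) simp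
  also have "\<dots> = ennreal (measure lborel (cbox (- a) a))"
    by (intro emeasure_eq_ennreal_measure) (simp add: emeasure_lborel_cbox_eq)
  also have "measure lborel (cbox (- a) a) = (\<Prod>j\<in>UNIV. a $ j - (- a) $ j)"
    using r R by (intro content_cbox_cart) (auto simp: interval_ne_empty_cart a_def)
  also have "\<dots> = (\<Prod>j\<in>UNIV. if j = i then 2 * r else 2 * R)" by (simp add: a_def if_distrib cong: if_cong)
  also have "\<dots> = 2 * r * (\<Prod>j\<in>UNIV - {i}. if j = i then 2 * r else 2 * R)"
    by (subst prod.remove[of _ i]) auto
  also have "(\<Prod>j\<in>UNIV - {i}. if j = i then 2 * r else 2 * R) = (2 * R) ^ (CARD('n) - 1)"
    by (simp add: card_Diff_singleton)
  finally show ?thesis .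
qed

lemma dim_cart_Suc: "DIM(real ^ 'n) = Suc (CARD('n) - 1)"
  by simp

lemma hausdorff_disc_finite:
  fixes m :: "real ^ 'n"
  assumes m: "m \<noteq> 0"
  shows "hausdorff_outer (CARD('n) - 1) ({v. m \<bullet> v = 0} \<inter> cball 0 R) < \<infinity>"
proof (rule hausdorff_outer_finite[OF dim_cart_Suc])
  define n where "n = m /\<^sub>R norm m"
  have n: "norm n = 1" using m by (simp add: n_def)
  define R' where "R' = max R 0 + 1"
  show "0 \<le> 2 * (2 * R') ^ (CARD('n) - 1)" by (simp add: R'_def)
  show "(0::real) < 1" by simp
  fix r :: real assume r: "0 < r" "r < 1"
  have "(\<Union>a\<in>{v. m \<bullet> v = 0} \<inter> cball 0 R. ball a r) \<subseteq> {y. \<bar>n \<bullet> y\<bar> \<le> r \<and> norm y \<le> R'}"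
  proof clarsimp
    fix a y :: "real ^ 'n" assume a: "m \<bullet> a = 0" "norm a \<le> R" "dist a y < r"
    have "n \<bullet> y = n \<bullet> (y - a)" using a by (simp add: n_def inner_diff_right)
    also have "\<bar>\<dots>\<bar> \<le> norm n * norm (y - a)" by (rule Cauchy_Schwarz_ineq2)
    also have "\<dots> \<le> r" using a n by (simp add: dist_norm norm_minus_commute)
    finally have "\<bar>n \<bullet> y\<bar> \<le> r" .
    moreover have "norm y \<le> norm a + norm (y - a)" by norm
    hence "norm y \<le> R'" using a r by (simp add: R'_def dist_norm norm_minus_commute)
    ultimately show "\<bar>n \<bullet> y\<bar> \<le> r \<and> norm y \<le> R'" by simp
  qed
  hence "emeasure lborel (\<Union>a\<in>{v. m \<bullet> v = 0} \<inter> cball 0 R. ball a r)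
    \<le> emeasure lborel {y. \<bar>n \<bullet> y\<bar> \<le> r \<and> norm y \<le> R'}"
    by (rule emeasure_mono) (measurable)
  also have "\<dots> \<le> ennreal (2 * r * (2 * R') ^ (CARD('n) - 1))"
    using r by (intro emeasure_slab_le n) (auto simp: R'_def)
  finally show "emeasure lborel (\<Union>a\<in>{v. m \<bullet> v = 0} \<inter> cball 0 R. ball a r)
     \<le> ennreal (2 * (2 * R') ^ (CARD('n) - 1) * r)" by (simp add: mult_ac)
qed

lemma hausdorff_disc_positive:
  fixes m :: "real ^ 'n"
  assumes m: "m \<noteq> 0"
  shows "0 < hausdorff_outer (CARD('n) - 1) ({v. m \<bullet> v = 0} \<inter> cball 0 1)"
proof (rule hausdorff_outer_positive[OF dim_cart_Suc])
  define n where "n = m /\<^sub>R norm m"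
  show n: "norm n = 1" using m by (simp add: n_def)
  hence nn: "n \<bullet> n = 1" by (simp add: dot_square_norm)
  show "(0::real) < 1" by simp
  show "cball 0 1 \<subseteq> tube n 1 ({v. m \<bullet> v = 0} \<inter> cball 0 1)"
  proof
    fix y :: "real ^ 'n" assume "y \<in> cball 0 1"
    hence y: "norm y \<le> 1" by simp
    define a where "a = y - (n \<bullet> y) *\<^sub>R n"
    have na: "n \<bullet> a = 0" using nn by (simp add: a_def inner_diff_right)
    have mn: "m = norm m *\<^sub>R n" using m by (simp add: n_def)
    have "m \<bullet> a = 0" by (subst mn) (simp add: na)
    moreover have "a \<bullet> a \<le> y \<bullet> y" using nn
      by (simp add: a_def inner_diff_left inner_diff_right inner_commute)
    hence "norm a \<le> 1" using y by (simp add: norm_le[symmetric])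
    moreover have "\<bar>n \<bullet> y\<bar> \<le> 1" using Cauchy_Schwarz_ineq2[of n y] n y by simp
    moreover have "y = a + (n \<bullet> y) *\<^sub>R n" by (simp add: a_def)
    ultimately show "y \<in> tube n 1 ({v. m \<bullet> v = 0} \<inter> cball 0 1)"
      unfolding tube_def by (intro image_eqI[of _ _ "(a, n \<bullet> y)"]) (auto simp: abs_le_iff)
  qed
qed

text \<open>
  If \<open>A\<close> lies in the hyperplane \<open>{x. m \<bullet> x = 1}\<close>, this is the union of the segments from 0 to the
  points of \<open>A\<close>, without the apex 0.
\<close>

definition facet_cone :: "'a::euclidean_space \<Rightarrow> 'a set \<Rightarrow> 'a set" where
  "facet_cone m A = {y. 0 < m \<bullet> y \<and> m \<bullet> y \<le> 1 \<and> y /\<^sub>R (m \<bullet> y) \<in> A}"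

lemma facet_cone_measurable [measurable]:
  "A \<in> sets borel \<Longrightarrow> facet_cone m A \<in> sets borel"
proof -
  assume A: "A \<in> sets borel"
  have f: "(\<lambda>y. y /\<^sub>R (m \<bullet> y)) \<in> borel_measurable borel" by measurable
  have "facet_cone m A = {y. 0 < m \<bullet> y \<and> m \<bullet> y \<le> 1} \<inter> (\<lambda>y. y /\<^sub>R (m \<bullet> y)) -` A"
    by (auto simp: facet_cone_def)
  also have "\<dots> \<in> sets borel"
    by (intro sets.Int measurable_sets_borel[OF f A]) measurable
  finally show ?thesis .
qed

lemma bounded_facet_cone:
  assumes "bounded A"
  shows "bounded (facet_cone m A)"
proof -
  obtain b where b: "\<And>x. x \<in> A \<Longrightarrow> norm x \<le> b" using assms by (auto simp: bounded_iff)
  have "norm y \<le> b" if "y \<in> facet_cone m A" for y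
  proof -
    define t where "t = m \<bullet> y"
    have t: "0 < t" "t \<le> 1" "y /\<^sub>R t \<in> A" using that by (auto simp: facet_cone_def t_def)
    have "norm y = t * norm (y /\<^sub>R t)" using t by simp
    also have "\<dots> \<le> 1 * norm (y /\<^sub>R t)" using t by (intro mult_right_mono) auto
    also have "\<dots> \<le> b" using b[OF t(3)] by simp
    finally show ?thesis .
  qed
  thus ?thesis by (auto simp: bounded_iff)
qed

lemma facet_base_point:
  assumes "m \<noteq> (0::'a::euclidean_space)"
  shows "m \<bullet> (m /\<^sub>R (m \<bullet> m)) = 1"
  using assms by simp

text \<open>
  Moved by \<open>- x0\<close>, the hyperplane becomes the subspace \<open>{v. m \<bullet> v = 0}\<close>, and both the Hausdorff measure \<open>\<nu>\<close> and the
  cone volume \<open>\<kappa>\<close> become translation-invariant measures on it: translating the base of a cone by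
  \<open>v\<close> shears the cone. The unit ball, which is symmetric, serves as the second set in the uniqueness
  theorem.
\<close>

lemma hausdorff_facet_aux:
  fixes m :: "real ^ 'n"
  assumes m: "m \<noteq> 0" and A [measurable]: "A \<in> sets borel" and Am: "A \<subseteq> {x. m \<bullet> x = 1}"
  defines "x0 \<equiv> m /\<^sub>R (m \<bullet> m)"
  shows "hausdorff_outer (CARD('n) - 1) A * emeasure lborel (facet_cone m (cball x0 1))
       = emeasure lborel (facet_cone m A) * hausdorff_outer (CARD('n) - 1) ({v. m \<bullet> v = 0} \<inter> cball 0 1)"
proof -
  let ?H = "hausdorff_outer (CARD('n) - 1) :: (real ^ 'n) set \<Rightarrow> ennreal"
  let ?V = "{v. m \<bullet> v = 0}"
  have mx0: "m \<bullet> x0 = 1" unfolding x0_def by (rule facet_base_point[OF m])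
  define \<nu> where "\<nu> = density (hausdorff_measure (CARD('n) - 1)) (indicator ?V :: real ^ 'n \<Rightarrow> ennreal)"
  define \<kappa> where "\<kappa> = distr (density lborel (indicator {y. 0 < m \<bullet> y \<and> m \<bullet> y \<le> 1})) borel
     (\<lambda>y. y /\<^sub>R (m \<bullet> y) - x0)"
  have V: "?V \<in> sets borel" by measurable
  have s\<nu> [simp]: "sets \<nu> = sets borel" and s\<kappa> [simp]: "sets \<kappa> = sets borel"
    by (simp_all add: \<nu>_def \<kappa>_def)
  have e\<nu>: "emeasure \<nu> X = ?H (?V \<inter> X)" if "X \<in> sets borel" for X
  proof -
    have "emeasure \<nu> X = (\<integral>\<^sup>+x. indicator (?V \<inter> X) x \<partial>hausdorff_measure (CARD('n) - 1))"
      unfolding \<nu>_def indicator_inter_arith by (rule emeasure_density) (use that V in auto)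
    also have "\<dots> = emeasure (hausdorff_measure (CARD('n) - 1)) (?V \<inter> X)"
      by (rule nn_integral_indicator) (use that V in simp)
    also have "\<dots> = ?H (?V \<inter> X)" by (rule emeasure_hausdorff_measure) (use that V in simp)
    finally show ?thesis .
  qed
  have e\<kappa>: "emeasure \<kappa> X = emeasure lborel (facet_cone m ((\<lambda>x. x - x0) -` X))" if X [measurable]: "X \<in> sets borel" for X
  proof -
    have f: "(\<lambda>y. y /\<^sub>R (m \<bullet> y) - x0) \<in> borel_measurable borel" by measurable
    have "emeasure \<kappa> X = emeasure (density lborel (indicator {y. 0 < m \<bullet> y \<and> m \<bullet> y \<le> 1}))
        ((\<lambda>y. y /\<^sub>R (m \<bullet> y) - x0) -` X)"
      unfolding \<kappa>_def using f by (subst emeasure_distr) auto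
    also have "\<dots> = (\<integral>\<^sup>+y. indicator {y. 0 < m \<bullet> y \<and> m \<bullet> y \<le> 1} y * indicator ((\<lambda>y. y /\<^sub>R (m \<bullet> y) - x0) -` X) y \<partial>lborel)"
      by (rule emeasure_density) (use measurable_sets_borel[OF f X] in auto)
    also have "\<dots> = (\<integral>\<^sup>+y. indicator (facet_cone m ((\<lambda>x. x - x0) -` X)) y \<partial>lborel)"
      by (intro nn_integral_cong) (auto simp: indicator_def facet_cone_def)
    also have "\<dots> = emeasure lborel (facet_cone m ((\<lambda>x. x - x0) -` X))"
      by (rule nn_integral_indicator) (auto intro!: facet_cone_measurable measurable_sets_borel[OF _ X])
    finally show ?thesis .
  qed
  have vim: "(\<lambda>x. x - x0) -` X \<in> sets borel" "(\<lambda>x. x + v) -` X \<in> sets borel" if "X \<in> sets borel" for X v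
    using that by (auto intro!: measurable_sets_borel[OF _ that])
  have main: "emeasure \<nu> X * emeasure \<kappa> (cball 0 1) = emeasure \<kappa> X * emeasure \<nu> (uminus -` cball 0 1)"
    if X: "X \<in> sets borel" for X
  proof (rule translation_invariant_measure_unique[where V = ?V])
    show "subspace ?V" by (rule subspace_hyperplane)
    show "AE x in \<kappa>. x \<in> ?V"
      unfolding \<kappa>_def using V mx0
      by (subst AE_distr_iff) (auto simp: AE_density inner_diff_right indicator_def intro!: AE_I2)
    show "AE x in \<nu>. x \<in> ?V"
      unfolding \<nu>_def using V by (subst AE_density) (auto simp: indicator_def)
    show "sigma_finite_measure \<nu>"
      by (rule sigma_finite_measure_cballs) (use hausdorff_disc_finite[OF m] in \<open>auto simp: e\<nu>\<close>)
    show "sigma_finite_measure \<kappa>"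
    proof (rule sigma_finite_measure_cballs)
      fix k :: nat
      have "(\<lambda>x. x - x0) -` cball 0 (real k) = cball x0 (real k)"
        by (auto simp: dist_norm norm_minus_commute)
      hence "bounded (facet_cone m ((\<lambda>x. x - x0) -` cball 0 (real k)))"
        by (simp add: bounded_facet_cone)
      from emeasure_bounded_finite[OF this] show "emeasure \<kappa> (cball 0 (real k)) < \<infinity>"
        by (simp add: e\<kappa>)
    qed simp
    fix v assume v: "v \<in> ?V"
    show "distr \<kappa> borel (\<lambda>x. x + v) = \<kappa>"
    proof (rule measure_eqI)
      fix X assume "X \<in> sets (distr \<kappa> borel (\<lambda>x. x + v))"
      hence X: "X \<in> sets borel" by simp
      have "emeasure (distr \<kappa> borel (\<lambda>x. x + v)) X = emeasure \<kappa> ((\<lambda>x. x + v) -` X)"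
        using X by (subst emeasure_distr) (auto simp: sets_eq_imp_space_eq[OF s\<kappa>] measurable_def vim)
      also have "\<dots> = emeasure lborel (facet_cone m ((\<lambda>x. x - x0) -` ((\<lambda>x. x + v) -` X)))"
        by (rule e\<kappa>) (rule vim[OF X])
      also have "facet_cone m ((\<lambda>x. x - x0) -` ((\<lambda>x. x + v) -` X))
          = (\<lambda>y. y + (m \<bullet> y) *\<^sub>R v) -` facet_cone m ((\<lambda>x. x - x0) -` X)"
        using v by (auto simp: facet_cone_def inner_add_right scaleR_add_right algebra_simps)
      also have "emeasure lborel \<dots> = emeasure lborel (facet_cone m ((\<lambda>x. x - x0) -` X))"
        using v by (intro emeasure_lborel_vimage_shear) (auto intro!: facet_cone_measurable vim X)
      also have "\<dots> = emeasure \<kappa> X" using X by (simp add: e\<kappa>)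
      finally show "emeasure (distr \<kappa> borel (\<lambda>x. x + v)) X = emeasure \<kappa> X" .
    qed simp
    show "distr \<nu> borel (\<lambda>x. x + v) = \<nu>"
    proof (rule measure_eqI)
      fix X assume "X \<in> sets (distr \<nu> borel (\<lambda>x. x + v))"
      hence X: "X \<in> sets borel" by simp
      have "emeasure (distr \<nu> borel (\<lambda>x. x + v)) X = emeasure \<nu> ((\<lambda>x. x + v) -` X)"
        using X by (subst emeasure_distr) (auto simp: sets_eq_imp_space_eq[OF s\<nu>] measurable_def vim)
      also have "\<dots> = ?H (?V \<inter> (\<lambda>x. x + v) -` X)" by (rule e\<nu>) (rule vim[OF X])
      also have "\<dots> = ?H ((\<lambda>x. x + v) ` (?V \<inter> (\<lambda>x. x + v) -` X))"
        by (rule hausdorff_outer_isometric_image[symmetric]) simp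
      also have "(\<lambda>x. x + v) ` (?V \<inter> (\<lambda>x. x + v) -` X) = ?V \<inter> X"
      proof (intro equalityI subsetI)
        fix x assume "x \<in> ?V \<inter> X"
        thus "x \<in> (\<lambda>x. x + v) ` (?V \<inter> (\<lambda>x. x + v) -` X)"
          using v by (intro image_eqI[of _ _ "x - v"]) (auto simp: inner_diff_right)
      qed (use v in \<open>auto simp: inner_add_right\<close>)
      also have "?H \<dots> = emeasure \<nu> X" using X by (simp add: e\<nu>)
      finally show "emeasure (distr \<nu> borel (\<lambda>x. x + v)) X = emeasure \<nu> X" .
    qed simp
  qed (use X in auto)
  define A' where "A' = (\<lambda>x. x + x0) -` A"
  have A': "A' \<in> sets borel" unfolding A'_def by (rule vim[OF A])
  have "?V \<inter> A' = (\<lambda>x. x - x0) ` A"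
  proof (intro equalityI subsetI)
    fix x assume "x \<in> ?V \<inter> A'"
    thus "x \<in> (\<lambda>x. x - x0) ` A" by (intro image_eqI[of _ _ "x + x0"]) (auto simp: A'_def)
  qed (use Am mx0 in \<open>auto simp: A'_def inner_diff_right\<close>)
  hence "emeasure \<nu> A' = ?H ((\<lambda>x. x - x0) ` A)" using A' by (simp add: e\<nu>)
  also have "\<dots> = ?H A" by (rule hausdorff_outer_isometric_image) (simp add: dist_norm)
  finally have 1: "emeasure \<nu> A' = ?H A" .
  have 2: "emeasure \<kappa> A' = emeasure lborel (facet_cone m A)"
    using A' by (simp add: e\<kappa> A'_def vimage_def)
  have "(\<lambda>x. x - x0) -` cball 0 1 = cball x0 1" by (auto simp: dist_norm norm_minus_commute)
  hence 3: "emeasure \<kappa> (cball 0 1) = emeasure lborel (facet_cone m (cball x0 1))"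
    by (simp add: e\<kappa>)
  have "uminus -` cball 0 1 = (cball 0 1 :: (real ^ 'n) set)" by auto
  hence 4: "emeasure \<nu> (uminus -` cball 0 1) = ?H (?V \<inter> cball 0 1)" by (simp add: e\<nu>)
  show ?thesis using main[OF A'] unfolding 1 2 3 4 .
qed

text \<open>
  Hyperplanes at the same distance from 0 are carried into each other by rotations, so that the factor
  between Hausdorff measure and cone volume is the same for all of them.
\<close>

lemma hausdorff_facet:
  fixes \<rho> :: real
  assumes \<rho>: "\<rho> > 0"
  shows "\<exists>c>0. \<forall>m A. norm (m :: real ^ 'n) = \<rho> \<longrightarrow> A \<in> sets borel \<longrightarrow> A \<subseteq> {x. m \<bullet> x = 1} \<longrightarrow>
     hausdorff_outer (CARD('n) - 1) A = ennreal c * emeasure lborel (facet_cone m A)"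
proof -
  let ?H = "hausdorff_outer (CARD('n) - 1) :: (real ^ 'n) set \<Rightarrow> ennreal"
  define h where "h m = ?H ({v. m \<bullet> v = 0} \<inter> cball 0 1)" for m
  define g where "g m = emeasure lborel (facet_cone m (cball (m /\<^sub>R (m \<bullet> m)) 1))" for m :: "real ^ 'n"
  obtain i :: 'n where True by simp
  define m1 :: "real ^ 'n" where "m1 = \<rho> *\<^sub>R axis i 1"
  have m1: "norm m1 = \<rho>" "m1 \<noteq> 0" using \<rho> by (auto simp: m1_def)
  have same: "h m = h m1 \<and> g m = g m1" if m: "norm m = \<rho>" for m
  proof -
    have "norm m1 = norm m" using m m1 by simp
    then obtain T :: "real ^ 'n \<Rightarrow> real ^ 'n" where T: "orthogonal_transformation T" "T m1 = m"
      by (rule orthogonal_transformation_exists)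
    have lin: "linear T" and dot: "T v \<bullet> T w = v \<bullet> w" for v w
      using T(1) by (auto simp: orthogonal_transformation_def)
    have surj: "surj T" by (rule orthogonal_transformation_surj[OF T(1)])
    have nT: "norm (T x) = norm x" for x using T(1) by (rule orthogonal_transformation_norm)
    have mT: "m \<bullet> T y = m1 \<bullet> y" for y using dot[of m1 y] T(2) by simp
    have mm: "m \<bullet> m = m1 \<bullet> m1" using dot[of m1 m1] T(2) by simp
    have "{v. m \<bullet> v = 0} \<inter> cball 0 1 = T ` ({v. m1 \<bullet> v = 0} \<inter> cball 0 1)"
    proof (intro equalityI subsetI)
      fix v assume v: "v \<in> {v. m \<bullet> v = 0} \<inter> cball 0 1"
      obtain w where "v = T w" using surj by auto
      thus "v \<in> T ` ({v. m1 \<bullet> v = 0} \<inter> cball 0 1)" using v by (auto simp: mT nT)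
    qed (auto simp: mT nT)
    hence "h m = h m1" unfolding h_def
      by (simp only:) (rule hausdorff_outer_isometric_image,
        simp add: dist_norm linear_diff[OF lin, symmetric] nT)
    moreover have "T -` facet_cone m (cball (m /\<^sub>R (m \<bullet> m)) 1) = facet_cone m1 (cball (m1 /\<^sub>R (m1 \<bullet> m1)) 1)"
    proof -
      have "dist (m /\<^sub>R (m \<bullet> m)) (T y /\<^sub>R (m \<bullet> T y)) = dist (m1 /\<^sub>R (m1 \<bullet> m1)) (y /\<^sub>R (m1 \<bullet> y))" for y
      proof -
        have "m /\<^sub>R (m \<bullet> m) - T y /\<^sub>R (m \<bullet> T y) = T (m1 /\<^sub>R (m1 \<bullet> m1) - y /\<^sub>R (m1 \<bullet> y))"
          by (simp add: linear_diff[OF lin] linear_scale[OF lin] T(2) mT mm)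
        thus ?thesis by (simp add: dist_norm nT)
      qed
      thus ?thesis by (auto simp: facet_cone_def mT)
    qed
    hence "g m = g m1"
      unfolding g_def using emeasure_lborel_vimage_orthogonal[OF T(1), of "facet_cone m (cball (m /\<^sub>R (m \<bullet> m)) 1)"]
      by simp
    ultimately show ?thesis by simp
  qed
  have h: "0 < h m1" "h m1 < \<infinity>"
    unfolding h_def by (rule hausdorff_disc_positive[OF m1(2)], rule hausdorff_disc_finite[OF m1(2)])
  define x0 where "x0 = m1 /\<^sub>R (m1 \<bullet> m1)"
  have mx0: "m1 \<bullet> x0 = 1" unfolding x0_def by (rule facet_base_point[OF m1(2)])
  have g_fin: "g m1 < \<infinity>"
    unfolding g_def by (intro emeasure_bounded_finite bounded_facet_cone bounded_cball)
  have g_pos: "0 < g m1"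
  proof -
    define W where "W = {y. m1 \<bullet> y < 1 \<and> norm (y - (m1 \<bullet> y) *\<^sub>R x0) < m1 \<bullet> y}"
    have "open W" unfolding W_def
      by (intro open_Collect_conj open_Collect_less continuous_intros)
    moreover have "x0 /\<^sub>R 2 \<in> W" using mx0 by (simp add: W_def)
    ultimately obtain e where e: "e > 0" "ball (x0 /\<^sub>R 2) e \<subseteq> W" using open_contains_ball by blast
    have "W \<subseteq> facet_cone m1 (cball x0 1)"
    proof
      fix y assume "y \<in> W"
      define t where "t = m1 \<bullet> y"
      have y: "t < 1" "norm (y - t *\<^sub>R x0) < t" using \<open>y \<in> W\<close> by (auto simp: W_def t_def)
      hence t: "t > 0" using norm_ge_zero[of "y - t *\<^sub>R x0"] by linarith
      have "y /\<^sub>R t - x0 = (y - t *\<^sub>R x0) /\<^sub>R t" using t by (simp add: algebra_simps)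
      hence "norm (y /\<^sub>R t - x0) = norm (y - t *\<^sub>R x0) / t" using t by (simp add: divide_inverse mult.commute)
      also have "\<dots> \<le> 1" using y t by simp
      finally have "dist x0 (y /\<^sub>R t) \<le> 1" by (simp add: dist_norm norm_minus_commute)
      thus "y \<in> facet_cone m1 (cball x0 1)" using y t by (simp add: facet_cone_def t_def[symmetric])
    qed
    with e have "emeasure lborel (ball (x0 /\<^sub>R 2) e) \<le> g m1"
      unfolding g_def x0_def by (intro emeasure_mono) auto
    moreover have "0 < emeasure lborel (ball (x0 /\<^sub>R 2) e)"
      using e(1) by (simp add: emeasure_ball)
    ultimately show ?thesis by (rule order.strict_trans2[rotated])
  qed
  define c where "c = enn2real (h m1) / enn2real (g m1)"
  have hr: "h m1 = ennreal (enn2real (h m1))" "enn2real (h m1) > 0"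
    using h by (auto simp: enn2real_positive_iff)
  have gr: "g m1 = ennreal (enn2real (g m1))" "enn2real (g m1) > 0"
    using g_fin g_pos by (auto simp: enn2real_positive_iff)
  have c: "c > 0" "h m1 = ennreal c * g m1"
  proof -
    show "c > 0" using hr gr by (simp add: c_def)
    have "ennreal c * g m1 = ennreal (c * enn2real (g m1))"
      using \<open>c > 0\<close> by (subst gr(1)) (simp add: ennreal_mult)
    also have "c * enn2real (g m1) = enn2real (h m1)" using gr by (simp add: c_def)
    finally show "h m1 = ennreal c * g m1" using hr by simp
  qed
  show ?thesis
  proof (intro exI[of _ c] conjI allI impI c(1))
    fix m :: "real ^ 'n" and A assume m: "norm m = \<rho>" and A: "A \<in> sets borel" "A \<subseteq> {x. m \<bullet> x = 1}"
    have m0: "m \<noteq> 0" using m \<rho> by auto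
    have "?H A * g m = emeasure lborel (facet_cone m A) * h m"
      unfolding g_def h_def by (rule hausdorff_facet_aux[OF m0 A])
    hence "g m1 * ?H A = g m1 * (ennreal c * emeasure lborel (facet_cone m A))"
      using same[OF m] c by (simp add: mult_ac)
    thus "?H A = ennreal c * emeasure lborel (facet_cone m A)"
      using g_pos g_fin by (auto simp: ennreal_mult_cancel_left)
  qed
qed

lemma set_integrable_bounded:
  fixes U :: "'a::euclidean_space \<Rightarrow> real"
  assumes M: "sets M = sets borel" and S: "S \<in> sets borel" "bounded S" "emeasure M S < \<infinity>"
    and U: "continuous_on UNIV U"
  shows "set_integrable M S U"
proof -
  have "compact (U ` closure S)"
    using S U by (intro compact_continuous_image) (auto intro: continuous_on_subset)
  then obtain B where "\<And>y. y \<in> U ` closure S \<Longrightarrow> norm y \<le> B" using compact_imp_bounded bounded_iff by metis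
  hence B: "norm (U x) \<le> B" if "x \<in> S" for x using that closure_subset by blast
  have m: "U \<in> borel_measurable M" using borel_measurable_continuous_onI[OF U] M
    by (simp cong: measurable_cong_sets)
  show ?thesis unfolding set_integrable_def
    by (rule integrableI_bounded_set_indicator[where B = B])
       (use S B m M in \<open>auto simp: less_top\<close>)
qed

text \<open>
  The volume of a cone weighted with \<open>(m \<bullet> y) ^ k\<close> is \<open>D / (D + k)\<close> times its volume. So the
  Hausdorff measure on \<open>A\<close> is a multiple of the image \<open>\<kappa>\<close> of this weighted volume under the radial
  projection to \<open>A\<close>, and homogeneity of \<open>U\<close> makes the weight cancel in
  \<open>(m \<bullet> y) ^ k * U (y /\<^sub>R (m \<bullet> y)) = U y\<close>.
\<close>

lemma facet_integral:
  fixes m :: "real ^ 'n" and U :: "real ^ 'n \<Rightarrow> real"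
  assumes m: "m \<noteq> 0" and A [measurable]: "A \<in> sets borel" and Am: "A \<subseteq> {x. m \<bullet> x = 1}" and bd: "bounded A"
    and c: "c > 0" and H: "\<And>X. X \<in> sets borel \<Longrightarrow> X \<subseteq> {x. m \<bullet> x = 1} \<Longrightarrow>
        hausdorff_outer (CARD('n) - 1) X = ennreal c * emeasure lborel (facet_cone m X)"
    and U: "continuous_on UNIV U" and hom: "\<And>t y. t > 0 \<Longrightarrow> U (t *\<^sub>R y) = t ^ k * U y"
  shows "(LINT x:A|surface. U x)
      = c * (real (CARD('n) + k) / real CARD('n)) * (LINT y:facet_cone m A|lborel. U y)"
    and "set_integrable surface A U"
    and "emeasure surface A < \<infinity>"
proof -
  let ?H = "hausdorff_outer (CARD('n) - 1) :: (real ^ 'n) set \<Rightarrow> ennreal"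
  have [measurable]: "U \<in> borel_measurable borel" using U by (rule borel_measurable_continuous_onI)
  have ss [simp, measurable_cong]: "sets (surface :: (real ^ 'n) measure) = sets borel" by (simp add: surface_def)
  have es: "emeasure surface X = ?H X" if "X \<in> sets borel" for X
    unfolding surface_def using that by (rule emeasure_hausdorff_measure)
  have bdc: "bounded (facet_cone m A)" using bd by (rule bounded_facet_cone)
  have fin: "emeasure lborel (facet_cone m X) < \<infinity>" if "X \<subseteq> A" for X
    by (rule emeasure_bounded_finite, rule bounded_subset[OF bdc]) (use that in \<open>auto simp: facet_cone_def\<close>)
  show finA: "emeasure surface A < \<infinity>"
    using fin[of A] unfolding es[OF A] H[OF A Am] by (simp add: ennreal_mult_less_top)
  show "set_integrable surface A U"
    by (rule set_integrable_bounded[OF ss A bd finA U])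
  define q where "q = real (CARD('n) + k) / real CARD('n)"
  have q: "q > 0" by (simp add: q_def add_pos_nonneg)
  define \<kappa> where "\<kappa> = distr (density lborel (\<lambda>y. ennreal ((m \<bullet> y) ^ k * indicator (facet_cone m A) y))) borel
     (\<lambda>y. y /\<^sub>R (m \<bullet> y))"
  have fm: "facet_cone m A \<in> sets borel" by measurable
  have wm [measurable]: "(\<lambda>y. (m \<bullet> y) ^ k * indicator (facet_cone m A) y) \<in> borel_measurable borel"
    using fm by measurable
  have pm: "(\<lambda>y. y /\<^sub>R (m \<bullet> y)) \<in> borel_measurable borel" by measurable
  have "density surface (\<lambda>x. ennreal (indicator A x)) = density \<kappa> (\<lambda>_. ennreal (c * q))"
  proof (rule measure_eqI)
    fix X assume "X \<in> sets (density surface (\<lambda>x. ennreal (indicator A x)))"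
    hence X [measurable]: "X \<in> sets borel" by simp
    have "emeasure (density surface (\<lambda>x. ennreal (indicator A x))) X
       = (\<integral>\<^sup>+x. ennreal (indicator A x) * indicator X x \<partial>surface)"
      by (rule emeasure_density) (use X in measurable)
    also have "\<dots> = (\<integral>\<^sup>+x. indicator (A \<inter> X) x \<partial>surface)"
      by (intro nn_integral_cong) (auto simp: indicator_def)
    also have "\<dots> = emeasure surface (A \<inter> X)" by (rule nn_integral_indicator) (use A X in auto)
    also have "\<dots> = ennreal c * emeasure lborel (facet_cone m (A \<inter> X))"
      using H[of "A \<inter> X"] es[of "A \<inter> X"] Am A X by auto
    finally have 1: "emeasure (density surface (\<lambda>x. ennreal (indicator A x))) X
        = ennreal c * emeasure lborel (facet_cone m (A \<inter> X))" .
    have "emeasure \<kappa> X = emeasure (density lborel (\<lambda>y. ennreal ((m \<bullet> y) ^ k * indicator (facet_cone m A) y)))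
        ((\<lambda>y. y /\<^sub>R (m \<bullet> y)) -` X)"
      unfolding \<kappa>_def using pm X by (subst emeasure_distr) auto
    also have "\<dots> = (\<integral>\<^sup>+y. ennreal ((m \<bullet> y) ^ k * indicator (facet_cone m A) y) * indicator ((\<lambda>y. y /\<^sub>R (m \<bullet> y)) -` X) y \<partial>lborel)"
      by (rule emeasure_density) (use wm measurable_sets_borel[OF pm X] in auto)
    also have "\<dots> = (\<integral>\<^sup>+y. ennreal ((m \<bullet> y) ^ k) * indicator (facet_cone m (A \<inter> X)) y \<partial>lborel)"
      by (intro nn_integral_cong) (auto simp: indicator_def facet_cone_def)
    finally have 2: "emeasure \<kappa> X = (\<integral>\<^sup>+y. ennreal ((m \<bullet> y) ^ k) * indicator (facet_cone m (A \<inter> X)) y \<partial>lborel)" .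
    define C where "C = {y. 0 < m \<bullet> y} \<inter> (\<lambda>y. y /\<^sub>R (m \<bullet> y)) -` (A \<inter> X)"
    have "ennreal (real (DIM(real ^ 'n) + k)) * (\<integral>\<^sup>+y. ennreal ((m \<bullet> y) ^ k) * indicator (facet_cone m (A \<inter> X)) y \<partial>lborel)
       = ennreal (real DIM(real ^ 'n)) * emeasure lborel (facet_cone m (A \<inter> X))"
    proof (rule nn_integral_homogeneous_cone[of C])
      show "C \<in> sets borel" unfolding C_def
        by (intro sets.Int[of _ borel] measurable_sets_borel[OF pm] sets.Int A X) measurable
      show "t *\<^sub>R y \<in> C" if "t > 0" "y \<in> C" for t y
      proof -
        have "inverse (m \<bullet> (t *\<^sub>R y)) * t = inverse (m \<bullet> y)" using that by (simp add: field_simps)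
        hence "(t *\<^sub>R y) /\<^sub>R (m \<bullet> (t *\<^sub>R y)) = y /\<^sub>R (m \<bullet> y)" by (simp only: scaleR_scaleR)
        moreover have "0 < m \<bullet> (t *\<^sub>R y)" using that by (simp add: C_def)
        ultimately show ?thesis using that by (simp only: C_def Int_iff vimage_eq mem_Collect_eq)
      qed
      show "facet_cone m (A \<inter> X) = {y \<in> C. m \<bullet> y \<le> 1}" by (auto simp: C_def facet_cone_def)
    qed (use fin in \<open>auto simp: C_def\<close>)
    hence 3: "ennreal (real (CARD('n) + k)) * emeasure \<kappa> X
        = ennreal (real CARD('n)) * emeasure lborel (facet_cone m (A \<inter> X))"
      by (simp add: 2)
    have "ennreal q * emeasure \<kappa> X = emeasure lborel (facet_cone m (A \<inter> X))"
    proof -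
      have "ennreal (real CARD('n)) * (ennreal q * emeasure \<kappa> X) = ennreal (real (CARD('n) + k)) * emeasure \<kappa> X"
        using q by (simp add: mult.assoc[symmetric] ennreal_mult[symmetric] q_def del: of_nat_add)
      also note 3
      finally show ?thesis by (simp add: ennreal_mult_cancel_left)
    qed
    hence "ennreal (c * q) * emeasure \<kappa> X = ennreal c * emeasure lborel (facet_cone m (A \<inter> X))"
      using c q by (simp add: ennreal_mult mult.assoc)
    thus "emeasure (density surface (\<lambda>x. ennreal (indicator A x))) X = emeasure (density \<kappa> (\<lambda>_. ennreal (c * q))) X"
      using 1 X by (simp add: emeasure_density_const \<kappa>_def)
  qed (simp add: \<kappa>_def)
  hence "integral\<^sup>L (density surface (\<lambda>x. ennreal (indicator A x))) U = integral\<^sup>L (density \<kappa> (\<lambda>_. ennreal (c * q))) U"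
    by simp
  also have "integral\<^sup>L (density surface (\<lambda>x. ennreal (indicator A x))) U = (LINT x:A|surface. U x)"
    unfolding set_lebesgue_integral_def by (rule integral_density) auto
  also have "integral\<^sup>L (density \<kappa> (\<lambda>_. ennreal (c * q))) U = c * q * integral\<^sup>L \<kappa> U"
    using c q by (subst integral_density) (auto simp: \<kappa>_def)
  also have "integral\<^sup>L \<kappa> U = integral\<^sup>L (density lborel (\<lambda>y. ennreal ((m \<bullet> y) ^ k * indicator (facet_cone m A) y)))
      (\<lambda>y. U (y /\<^sub>R (m \<bullet> y)))"
    unfolding \<kappa>_def using pm by (intro integral_distr) auto
  also have "\<dots> = (LINT y|lborel. ((m \<bullet> y) ^ k * indicator (facet_cone m A) y) *\<^sub>R U (y /\<^sub>R (m \<bullet> y)))"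
    by (rule integral_density) (use pm wm in \<open>auto simp: indicator_def facet_cone_def\<close>)
  also have "\<dots> = (LINT y:facet_cone m A|lborel. U y)"
    unfolding set_lebesgue_integral_def
  proof (intro Bochner_Integration.integral_cong refl)
    fix y
    show "((m \<bullet> y) ^ k * indicator (facet_cone m A) y) *\<^sub>R U (y /\<^sub>R (m \<bullet> y)) = indicator (facet_cone m A) y *\<^sub>R U y"
    proof (cases "y \<in> facet_cone m A")
      case True
      hence "m \<bullet> y > 0" by (simp add: facet_cone_def)
      thus ?thesis using hom[of "inverse (m \<bullet> y)" y] True by (simp add: power_inverse)
    qed simp
  qed
  finally show "(LINT x:A|surface. U x)
      = c * (real (CARD('n) + k) / real CARD('n)) * (LINT y:facet_cone m A|lborel. U y)"
    by (simp add: q_def)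
qed

section \<open>Polynomials of bounded total degree\<close>

abbreviation mon :: "('n::finite \<Rightarrow> nat) \<Rightarrow> real ^ 'n \<Rightarrow> real" where
  "mon \<alpha> x \<equiv> (\<Prod>i\<in>UNIV. (x $ i) ^ \<alpha> i)"

lemma poly_deg_le_monomial:
  assumes "(\<Sum>i\<in>UNIV. \<alpha> i) \<le> k"
  shows "poly_deg_le k (mon \<alpha>)"
  unfolding poly_deg_le_def
proof (intro exI allI)
  fix x :: "real ^ 'a"
  have "(\<Sum>\<beta> | (\<Sum>i\<in>UNIV. \<beta> i) \<le> k. (if \<beta> = \<alpha> then 1 else 0) * mon \<beta> x)
     = (\<Sum>\<beta> | (\<Sum>i\<in>UNIV. \<beta> i) \<le> k. if \<beta> = \<alpha> then mon \<alpha> x else 0)"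
    by (intro sum.cong) auto
  also have "\<dots> = mon \<alpha> x" using assms finite_multi_index[of k] by (subst sum.delta) auto
  finally show "mon \<alpha> x = (\<Sum>\<beta> | (\<Sum>i\<in>UNIV. \<beta> i) \<le> k. (if \<beta> = \<alpha> then 1 else 0) * mon \<beta> x)" ..
qed

lemma poly_deg_le_add:
  assumes "poly_deg_le k U" "poly_deg_le k V"
  shows "poly_deg_le k (\<lambda>x. U x + V x)"
proof -
  obtain a b where "\<forall>x. U x = (\<Sum>\<alpha> | (\<Sum>i\<in>UNIV. \<alpha> i) \<le> k. a \<alpha> * mon \<alpha> x)"
    "\<forall>x. V x = (\<Sum>\<alpha> | (\<Sum>i\<in>UNIV. \<alpha> i) \<le> k. b \<alpha> * mon \<alpha> x)"
    using assms unfolding poly_deg_le_def by blast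
  thus ?thesis unfolding poly_deg_le_def
    by (intro exI[of _ "\<lambda>\<alpha>. a \<alpha> + b \<alpha>"]) (simp add: sum.distrib distrib_right)
qed

lemma poly_deg_le_scale:
  assumes "poly_deg_le k U"
  shows "poly_deg_le k (\<lambda>x. c * U x)"
proof -
  obtain a where "\<forall>x. U x = (\<Sum>\<alpha> | (\<Sum>i\<in>UNIV. \<alpha> i) \<le> k. a \<alpha> * mon \<alpha> x)"
    using assms unfolding poly_deg_le_def by blast
  thus ?thesis unfolding poly_deg_le_def
    by (intro exI[of _ "\<lambda>\<alpha>. c * a \<alpha>"]) (simp add: sum_distrib_left mult.assoc)
qed

lemma poly_deg_le_0: "poly_deg_le k (\<lambda>x. 0)"
  unfolding poly_deg_le_def by (intro exI[of _ "\<lambda>_. 0"]) simp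

lemma poly_deg_le_sum:
  "(\<And>i. i \<in> I \<Longrightarrow> poly_deg_le k (U i)) \<Longrightarrow> poly_deg_le k (\<lambda>x. \<Sum>i\<in>I. U i x)"
  by (induction I rule: infinite_finite_induct) (simp_all add: poly_deg_le_0 poly_deg_le_add)

lemma poly_deg_le_mono:
  assumes "poly_deg_le k U" "k \<le> l"
  shows "poly_deg_le l U"
proof -
  obtain a where a: "\<forall>x. U x = (\<Sum>\<alpha> | (\<Sum>i\<in>UNIV. \<alpha> i) \<le> k. a \<alpha> * mon \<alpha> x)"
    using assms unfolding poly_deg_le_def by blast
  have "poly_deg_le l (\<lambda>x. \<Sum>\<alpha> | (\<Sum>i\<in>UNIV. \<alpha> i) \<le> k. a \<alpha> * mon \<alpha> x)"
    using assms(2) by (intro poly_deg_le_sum poly_deg_le_scale poly_deg_le_monomial) auto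
  also have "(\<lambda>x. \<Sum>\<alpha> | (\<Sum>i\<in>UNIV. \<alpha> i) \<le> k. a \<alpha> * mon \<alpha> x) = U" using a by auto
  finally show ?thesis .
qed

lemma poly_deg_le_mult:
  assumes "poly_deg_le k U" "poly_deg_le l V"
  shows "poly_deg_le (k + l) (\<lambda>x. U x * V x)"
proof -
  obtain a b where ab: "\<forall>x. U x = (\<Sum>\<alpha> | (\<Sum>i\<in>UNIV. \<alpha> i) \<le> k. a \<alpha> * mon \<alpha> x)"
    "\<forall>x. V x = (\<Sum>\<beta> | (\<Sum>i\<in>UNIV. \<beta> i) \<le> l. b \<beta> * mon \<beta> x)"
    using assms unfolding poly_deg_le_def by blast
  have "(\<lambda>x. U x * V x) = (\<lambda>x. \<Sum>\<alpha> | (\<Sum>i\<in>UNIV. \<alpha> i) \<le> k. \<Sum>\<beta> | (\<Sum>i\<in>UNIV. \<beta> i) \<le> l.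
      (a \<alpha> * b \<beta>) * mon (\<lambda>i. \<alpha> i + \<beta> i) x)"
    by (rule ext) (simp add: ab sum_product power_add prod.distrib mult_ac)
  moreover have "poly_deg_le (k + l) \<dots>"
    by (intro poly_deg_le_sum poly_deg_le_scale poly_deg_le_monomial)
       (auto simp: sum.distrib intro!: add_mono)
  ultimately show ?thesis by simp
qed

lemma poly_deg_le_const: "poly_deg_le k (\<lambda>x. c)"
  using poly_deg_le_scale[OF poly_deg_le_monomial[of "\<lambda>_. 0" k], of c] by simp

lemma poly_deg_le_component: "poly_deg_le 1 (\<lambda>x. x $ i)"
proof -
  have "mon (\<lambda>j. if j = i then 1 else 0) x = x $ i" for x :: "real ^ 'a"
    using prod.delta[of UNIV i "\<lambda>j. x $ j"] by (simp add: if_distrib cong: if_cong)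
  thus ?thesis using poly_deg_le_monomial[of "\<lambda>j. if j = i then 1 else 0" 1] by simp
qed

lemma poly_deg_le_power: "poly_deg_le k U \<Longrightarrow> poly_deg_le (n * k) (\<lambda>x. U x ^ n)"
  by (induction n) (simp_all add: poly_deg_le_const poly_deg_le_mult)

lemma poly_deg_le_prod:
  "(\<And>i. i \<in> I \<Longrightarrow> poly_deg_le (k i) (U i)) \<Longrightarrow> poly_deg_le (\<Sum>i\<in>I. k i) (\<lambda>x. \<Prod>i\<in>I. U i x)"
  by (induction I rule: infinite_finite_induct) (simp_all add: poly_deg_le_const poly_deg_le_mult)

lemma poly_deg_le_translate:
  assumes "poly_deg_le k U"
  shows "poly_deg_le k (\<lambda>y. U (z + y))"
proof -
  obtain a where a: "\<forall>x. U x = (\<Sum>\<alpha> | (\<Sum>i\<in>UNIV. \<alpha> i) \<le> k. a \<alpha> * mon \<alpha> x)"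
    using assms unfolding poly_deg_le_def by blast
  have "poly_deg_le (\<Sum>i\<in>UNIV. \<alpha> i * 1) (\<lambda>y. \<Prod>i\<in>UNIV. (z $ i + y $ i) ^ \<alpha> i)" for \<alpha>
    by (intro poly_deg_le_prod poly_deg_le_power poly_deg_le_add poly_deg_le_const poly_deg_le_component)
  hence "poly_deg_le k (\<lambda>y. mon \<alpha> (z + y))" if "(\<Sum>i\<in>UNIV. \<alpha> i) \<le> k" for \<alpha>
    using that by (intro poly_deg_le_mono[OF _ that]) simp
  hence "poly_deg_le k (\<lambda>y. \<Sum>\<alpha> | (\<Sum>i\<in>UNIV. \<alpha> i) \<le> k. a \<alpha> * mon \<alpha> (z + y))"
    by (intro poly_deg_le_sum poly_deg_le_scale) auto
  thus ?thesis using a by simp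
qed

lemma poly_deg_le_continuous:
  assumes "poly_deg_le k U"
  shows "continuous_on S U"
proof -
  obtain a where a: "\<forall>x. U x = (\<Sum>\<alpha> | (\<Sum>i\<in>UNIV. \<alpha> i) \<le> k. a \<alpha> * mon \<alpha> x)"
    using assms unfolding poly_deg_le_def by blast
  have "continuous_on S (\<lambda>x. \<Sum>\<alpha> | (\<Sum>i\<in>UNIV. \<alpha> i) \<le> k. a \<alpha> * mon \<alpha> x)"
    by (intro continuous_intros)
  thus ?thesis using a by (simp cong: continuous_on_cong)
qed

lemma mon_scale: "mon \<alpha> (t *\<^sub>R y) = t ^ (\<Sum>i\<in>UNIV. \<alpha> i) * mon \<alpha> y"
  by (simp add: power_mult_distrib prod.distrib power_sum)

lemma poly_homogeneous_parts:
  assumes "poly_deg_le k U"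
  obtains a where "\<And>x. U x = (\<Sum>j\<le>k. \<Sum>\<alpha> | (\<Sum>i\<in>UNIV. \<alpha> i) = j. a \<alpha> * mon \<alpha> x)"
proof -
  obtain a where a: "\<forall>x. U x = (\<Sum>\<alpha> | (\<Sum>i\<in>UNIV. \<alpha> i) \<le> k. a \<alpha> * mon \<alpha> x)"
    using assms unfolding poly_deg_le_def by blast
  have "U x = (\<Sum>j\<le>k. \<Sum>\<alpha> | (\<Sum>i\<in>UNIV. \<alpha> i) = j. a \<alpha> * mon \<alpha> x)" for x
  proof -
    have "U x = (\<Sum>\<alpha> | (\<Sum>i\<in>UNIV. \<alpha> i) \<le> k. a \<alpha> * mon \<alpha> x)" using a by blast
    also have "\<dots> = (\<Sum>j\<le>k. sum (\<lambda>\<alpha>. a \<alpha> * mon \<alpha> x)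
        {\<alpha>. \<alpha> \<in> {\<alpha>. (\<Sum>i\<in>UNIV. \<alpha> i) \<le> k} \<and> (\<Sum>i\<in>UNIV. \<alpha> i) = j})"
      by (rule sum.group[symmetric]) (auto simp: finite_multi_index)
    also have "\<dots> = (\<Sum>j\<le>k. \<Sum>\<alpha> | (\<Sum>i\<in>UNIV. \<alpha> i) = j. a \<alpha> * mon \<alpha> x)"
      by (intro sum.cong refl) auto
    finally show ?thesis .
  qed
  thus thesis by (rule that)
qed

definition homogeneous_part :: "(('n::finite \<Rightarrow> nat) \<Rightarrow> real) \<Rightarrow> nat \<Rightarrow> real ^ 'n \<Rightarrow> real" where
  "homogeneous_part a j x = (\<Sum>\<alpha> | (\<Sum>i\<in>UNIV. \<alpha> i) = j. a \<alpha> * mon \<alpha> x)"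

lemma homogeneous_part_scale: "homogeneous_part a j (t *\<^sub>R y) = t ^ j * homogeneous_part a j y"
  unfolding homogeneous_part_def sum_distrib_left
  by (intro sum.cong refl) (simp add: mon_scale mult_ac del: vector_scaleR_component)

lemma homogeneous_part_poly: "poly_deg_le j (homogeneous_part a j)"
  unfolding homogeneous_part_def[abs_def]
  by (intro poly_deg_le_sum poly_deg_le_scale poly_deg_le_monomial) auto

text \<open>
  The homogeneous parts of odd degree cancel, among them the part of degree \<open>2 * n + 1\<close>.
\<close>

lemma even_part_poly:
  assumes U: "poly_deg_le (2 * n + 1) U"
  shows "poly_deg_le (2 * n) (\<lambda>y. (U y + U (- y)) / 2)"
proof -
  obtain a where a: "\<And>x. U x = (\<Sum>j\<le>2 * n + 1. homogeneous_part a j x)"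
    using poly_homogeneous_parts[OF U] unfolding homogeneous_part_def by blast
  have "(U y + U (- y)) / 2 = (\<Sum>j\<le>2 * n. ((1 + (- 1) ^ j) / 2) * homogeneous_part a j y)" for y
  proof -
    have m: "homogeneous_part a j (- y) = (- 1) ^ j * homogeneous_part a j y" for j
      using homogeneous_part_scale[of a j "- 1" y] by simp
    have "(U y + U (- y)) / 2
        = (\<Sum>j\<le>Suc (2 * n). homogeneous_part a j y + (- 1) ^ j * homogeneous_part a j y) / 2"
      by (simp only: a m Suc_eq_plus1 sum.distrib)
    also have "\<dots> = (\<Sum>j\<le>Suc (2 * n). ((1 + (- 1) ^ j) / 2) * homogeneous_part a j y)"
      unfolding sum_divide_distrib by (intro sum.cong refl) (simp add: field_simps)
    also have "\<dots> = (\<Sum>j\<le>2 * n. ((1 + (- 1) ^ j) / 2) * homogeneous_part a j y)"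
      by simp
    finally show ?thesis .
  qed
  moreover have "poly_deg_le (2 * n) (\<lambda>y. \<Sum>j\<le>2 * n. ((1 + (- 1) ^ j) / 2) * homogeneous_part a j y)"
    by (intro poly_deg_le_sum poly_deg_le_scale poly_deg_le_mono[OF homogeneous_part_poly]) auto
  ultimately show ?thesis by simp
qed

section \<open>Averages\<close>

text \<open>
  Cell averages and boundary averages are both of this form, so that linearity and invariance are
  proved once for both.
\<close>

definition average :: "'a::euclidean_space measure \<Rightarrow> 'a set \<Rightarrow> ('a \<Rightarrow> real) \<Rightarrow> real" where
  "average M S U = (LINT x:S|M. U x) / measure M S"

lemma cell_avg_eq: "cell_avg K = average lborel K"
  by (rule ext) (simp add: cell_avg_def average_def)

lemma bdry_avg_eq: "bdry_avg K = average surface (frontier K)"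
  by (rule ext) (simp add: bdry_avg_def average_def)

lemma sets_surface [simp, measurable_cong]: "sets surface = sets borel"
  by (simp add: surface_def)

lemma emeasure_surface: "A \<in> sets borel \<Longrightarrow> emeasure (surface :: (real ^ 'n) measure) A = hausdorff_outer (CARD('n) - 1) A"
  unfolding surface_def by (rule emeasure_hausdorff_measure)

lemma average_linear:
  fixes U V :: "'a::euclidean_space \<Rightarrow> real"
  assumes M: "sets M = sets borel" and S: "compact S"
    and U: "continuous_on UNIV U" and V: "continuous_on UNIV V"
  shows "average M S (\<lambda>x. a * U x + b * V x) = a * average M S U + b * average M S V"
proof (cases "emeasure M S < \<infinity>")
  case True
  have "set_integrable M S U" "set_integrable M S V"
    by (intro set_integrable_bounded M borel_compact compact_imp_bounded S True U V)+
  hence "(LINT x:S|M. a * U x + b * V x) = a * (LINT x:S|M. U x) + b * (LINT x:S|M. V x)"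
    by (subst set_integral_add(2)) auto
  thus ?thesis by (simp add: average_def add_divide_distrib)
next
  case False
  \<comment> \<open>The real-valued measure of a set of infinite measure is 0, and division by 0 makes all
    averages over it 0.\<close>
  hence "measure M S = 0" by (simp add: measure_def not_less top_unique)
  thus ?thesis by (simp add: average_def)
qed

lemma average_image:
  fixes U :: "'a::euclidean_space \<Rightarrow> real"
  assumes M: "sets M = sets borel" and f: "f \<in> borel_measurable borel" "inj f" and inv: "distr M borel f = M"
    and fS: "f ` S \<in> sets borel" and U: "continuous_on UNIV U"
  shows "average M (f ` S) U = average M S (\<lambda>x. U (f x))"
proof -
  have Um: "U \<in> borel_measurable borel" by (rule borel_measurable_continuous_onI[OF U])
  have fM: "f \<in> measurable M borel" using f(1) M by (simp cong: measurable_cong_sets)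
  have sp: "space M = UNIV" using sets_eq_imp_space_eq[OF M] by simp
  have "(LINT x:f ` S|M. U x) = (LINT x|distr M borel f. indicator (f ` S) x *\<^sub>R U x)"
    unfolding inv set_lebesgue_integral_def ..
  also have "\<dots> = (LINT x|M. indicator (f ` S) (f x) *\<^sub>R U (f x))"
    by (intro integral_distr[OF fM] borel_measurable_scaleR borel_measurable_indicator fS Um)
  also have "\<dots> = (LINT x:S|M. U (f x))"
    unfolding set_lebesgue_integral_def using f(2)
    by (intro Bochner_Integration.integral_cong) (auto simp: indicator_def inj_image_mem_iff)
  finally have "(LINT x:f ` S|M. U x) = (LINT x:S|M. U (f x))" .
  moreover have "measure M (f ` S) = measure (distr M borel f) (f ` S)" by (simp add: inv)
  hence "measure M (f ` S) = measure M S"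
    using f(2) by (simp add: measure_distr[OF fM fS] sp inj_vimage_image_eq)
  ultimately show ?thesis by (simp add: average_def)
qed

lemma distr_surface_isometry:
  fixes f :: "real ^ 'n \<Rightarrow> real ^ 'n"
  assumes iso: "\<And>x y. dist (f x) (f y) = dist x y" and surj: "surj f"
  shows "distr surface borel f = (surface :: (real ^ 'n) measure)" "f \<in> borel_measurable borel"
proof -
  have "continuous_on UNIV f"
    unfolding continuous_on_iff by (auto simp: iso)
  thus f: "f \<in> borel_measurable borel" by (rule borel_measurable_continuous_onI)
  show "distr surface borel f = (surface :: (real ^ 'n) measure)"
  proof (rule measure_eqI)
    fix A assume "A \<in> sets (distr (surface :: (real ^ 'n) measure) borel f)"
    hence A: "A \<in> sets borel" by simp
    have "emeasure (distr surface borel f) A = emeasure surface (f -` A)"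
      using f A by (subst emeasure_distr) (auto simp: surface_def)
    also have "\<dots> = hausdorff_outer (CARD('n) - 1) (f -` A)"
      by (rule emeasure_surface) (rule measurable_sets_borel[OF f A])
    also have "\<dots> = hausdorff_outer (CARD('n) - 1) (f ` (f -` A))"
      by (rule hausdorff_outer_isometric_image[symmetric]) (rule iso)
    also have "f ` (f -` A) = A" using surj by (simp add: surj_image_vimage_eq)
    also have "hausdorff_outer (CARD('n) - 1) A = emeasure surface A"
      by (rule emeasure_surface[OF A, symmetric])
    finally show "emeasure (distr surface borel f) A = emeasure surface A" .
  qed simp
qed

lemma distr_lborel_orthogonal:
  fixes f :: "'a::euclidean_space \<Rightarrow> 'a"
  assumes f: "orthogonal_transformation f"
  shows "distr lborel borel f = lborel"
proof (rule measure_eqI)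
  fix A assume "A \<in> sets (distr lborel borel f)"
  hence A: "A \<in> sets borel" by simp
  have "f \<in> borel_measurable borel"
    by (intro borel_measurable_linear orthogonal_transformation_linear f)
  thus "emeasure (distr lborel borel f) A = emeasure lborel A"
    using A emeasure_lborel_vimage_orthogonal[OF f A] by (subst emeasure_distr) auto
qed simp

lemma orthogonal_transformation_uminus: "orthogonal_transformation (uminus :: 'a::real_inner \<Rightarrow> 'a)"
  by (auto simp: orthogonal_transformation_def intro!: linear_uminus linearI)

lemma frontier_symmetric:
  fixes K :: "'a::real_normed_vector set"
  assumes K: "uminus ` K = K"
  shows "uminus ` frontier K = frontier K"
proof -
  have mem: "- y \<in> K \<longleftrightarrow> y \<in> K" for y
    using K by (metis imageI minus_minus)
  have *: "- x \<in> frontier K" if x: "x \<in> frontier K" for x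
    unfolding frontier_straddle
  proof (intro allI impI)
    fix e :: real assume "e > 0"
    then obtain y y' where y: "y \<in> K" "dist x y < e" "y' \<notin> K" "dist x y' < e"
      using x unfolding frontier_straddle by blast
    thus "(\<exists>y\<in>K. dist (- x) y < e) \<and> (\<exists>y. y \<notin> K \<and> dist (- x) y < e)"
      using mem[of y] mem[of y']
      by (intro conjI bexI[of _ "- y"] exI[of _ "- y'"]) (auto simp: dist_norm norm_minus_commute)
  qed
  show ?thesis
  proof (intro equalityI subsetI)
    fix x assume "x \<in> frontier K"
    thus "x \<in> uminus ` frontier K" using *[of x] by (intro image_eqI[of _ _ "- x"]) auto
  qed (use * in auto)
qed

lemma average_reflect:
  fixes K :: "(real ^ 'n) set" and U :: "real ^ 'n \<Rightarrow> real"
  assumes K: "compact K" "uminus ` K = K" and U: "continuous_on UNIV U"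
  shows "cell_avg K (\<lambda>x. U (- x)) = cell_avg K U" "bdry_avg K (\<lambda>x. U (- x)) = bdry_avg K U"
proof -
  have f: "(uminus :: real ^ 'n \<Rightarrow> real ^ 'n) \<in> borel_measurable borel" by measurable
  have "average lborel (uminus ` K) U = average lborel K (\<lambda>x. U (- x))"
    using K by (intro average_image f U distr_lborel_orthogonal orthogonal_transformation_uminus)
      (auto simp: borel_compact)
  thus "cell_avg K (\<lambda>x. U (- x)) = cell_avg K U" by (simp add: K cell_avg_eq)
  have fr: "uminus ` frontier K = frontier K" by (rule frontier_symmetric[OF K(2)])
  have "average surface (uminus ` frontier K) U = average surface (frontier K) (\<lambda>x. U (- x))"
    using fr by (intro average_image f U distr_surface_isometry)
      (auto simp: dist_norm norm_minus_commute borel_closed)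
  thus "bdry_avg K (\<lambda>x. U (- x)) = bdry_avg K U" by (simp add: fr bdry_avg_eq)
qed

lemma average_translate:
  fixes K :: "(real ^ 'n) set" and U :: "real ^ 'n \<Rightarrow> real"
  assumes K: "compact K" and U: "continuous_on UNIV U"
  shows "cell_avg ((+) z ` K) U = cell_avg K (\<lambda>y. U (z + y))"
    and "bdry_avg ((+) z ` K) U = bdry_avg K (\<lambda>y. U (z + y))"
proof -
  have f: "(+) z \<in> borel_measurable borel" by measurable
  show "cell_avg ((+) z ` K) U = cell_avg K (\<lambda>y. U (z + y))"
    unfolding cell_avg_eq using K
    by (intro average_image f U lborel_distr_plus) (auto simp: borel_compact compact_translation)
  have "average surface ((+) z ` frontier K) U = average surface (frontier K) (\<lambda>y. U (z + y))"
    by (intro average_image f U distr_surface_isometry)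
       (auto simp: borel_closed closed_translation)
  thus "bdry_avg ((+) z ` K) U = bdry_avg K (\<lambda>y. U (z + y))"
    by (simp add: bdry_avg_eq frontier_translation)
qed

lemma opt_weight_translate:
  fixes K :: "(real ^ 'n) set"
  assumes K: "compact K"
  shows "opt_weight ((+) z ` K) k = opt_weight K k"
proof -
  let ?S = "\<lambda>K. {ereal (bdry_avg K U / cell_avg K U) | U.
            poly_deg_le k U \<and> (\<forall>x\<in>K. 0 \<le> U x) \<and> 0 < cell_avg K U}"
  have sub: "?S ((+) z ` K) \<subseteq> ?S K" if "compact K" for K :: "(real ^ 'n) set" and z
  proof
    fix v assume "v \<in> ?S ((+) z ` K)"
    then obtain U where U: "v = ereal (bdry_avg ((+) z ` K) U / cell_avg ((+) z ` K) U)"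
      "poly_deg_le k U" "\<forall>x\<in>(+) z ` K. 0 \<le> U x" "0 < cell_avg ((+) z ` K) U" by blast
    have tr: "cell_avg ((+) z ` K) U = cell_avg K (\<lambda>y. U (z + y))"
      "bdry_avg ((+) z ` K) U = bdry_avg K (\<lambda>y. U (z + y))"
      by (rule average_translate[OF that poly_deg_le_continuous[OF U(2)]])+
    show "v \<in> ?S K"
      using U poly_deg_le_translate[OF U(2), of z] unfolding tr by blast
  qed
  have "?S K = ?S ((+) (- z) ` (+) z ` K)" by (simp add: image_image)
  hence "?S K \<subseteq> ?S ((+) z ` K)"
    using sub[of "(+) z ` K" "- z"] K by (simp only: compact_translation)
  with sub[OF K, of z] have "?S ((+) z ` K) = ?S K" by blast
  thus ?thesis unfolding opt_weight_def by (rule arg_cong)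
qed

section \<open>Even cells\<close>

text \<open>
  Replacing \<open>U\<close> by its even part changes neither average, so the two sets of ratios coincide.
\<close>

lemma opt_weight_even_cell:
  fixes K :: "(real ^ 'n) set"
  assumes K: "compact K" "uminus ` K = K"
  shows "opt_weight K (2 * n + 1) = opt_weight K (2 * n)"
proof -
  let ?S = "\<lambda>k. {ereal (bdry_avg K U / cell_avg K U) | U.
            poly_deg_le k U \<and> (\<forall>x\<in>K. 0 \<le> U x) \<and> 0 < cell_avg K U}"
  have "?S (2 * n + 1) \<subseteq> ?S (2 * n)"
  proof
    fix v assume "v \<in> ?S (2 * n + 1)"
    then obtain U where U: "v = ereal (bdry_avg K U / cell_avg K U)"
      "poly_deg_le (2 * n + 1) U" "\<forall>x\<in>K. 0 \<le> U x" "0 < cell_avg K U" by blast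
    define V where "V = (\<lambda>y. (U y + U (- y)) / 2)"
    have c: "continuous_on UNIV U" by (rule poly_deg_le_continuous[OF U(2)])
    have c': "continuous_on UNIV (\<lambda>y. U (- y))"
      by (rule continuous_on_compose2[OF c]) (auto intro: continuous_intros)
    have V': "V = (\<lambda>y. (1/2) * U y + (1/2) * U (- y))" by (simp add: V_def add_divide_distrib)
    have "cell_avg K V = cell_avg K U"
      using average_linear[OF _ K(1) c c', of lborel "1/2" "1/2"] average_reflect(1)[OF K c]
      by (simp add: V' cell_avg_eq)
    moreover have "compact (frontier K)" using K(1) by (rule compact_frontier)
    hence "bdry_avg K V = bdry_avg K U"
      using average_linear[OF _ _ c c', of surface "frontier K" "1/2" "1/2"] average_reflect(2)[OF K c]
      by (simp add: V' bdry_avg_eq)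
    moreover have "\<forall>x\<in>K. 0 \<le> V x" using U(3) K(2) by (auto simp: V_def) (metis add_nonneg_nonneg imageI)
    moreover have "poly_deg_le (2 * n) V" unfolding V_def by (rule even_part_poly[OF U(2)])
    ultimately show "v \<in> ?S (2 * n)" using U(1,4)
      by (intro CollectI exI[of _ V] conjI) simp_all
  qed
  moreover have "?S (2 * n) \<subseteq> ?S (2 * n + 1)"
    using poly_deg_le_mono[of "2 * n" _ "2 * n + 1"] by fastforce
  ultimately show ?thesis unfolding opt_weight_def by (intro arg_cong[where f = Sup]) blast
qed

text \<open>
  Only the homogeneous parts of degree 0 and 2 contribute to the averages: the odd ones change sign
  under the reflection. The constant part has the same average \<open>U 0\<close> over the cell and over its
  boundary, which leaves \<open>(1 - w) * U 0\<close> when the quadratic parts are compared.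
\<close>

lemma bdry_avg_cubic:
  fixes K :: "(real ^ 'n) set"
  assumes K: "compact K" "uminus ` K = K"
    and vol: "0 < measure lborel K" and area: "0 < measure surface (frontier K)"
    and quad: "\<And>P. poly_deg_le 2 P \<Longrightarrow> (\<And>t y. P (t *\<^sub>R y) = t\<^sup>2 * P y) \<Longrightarrow>
        bdry_avg K P = w * cell_avg K P"
    and U: "poly_deg_le 3 U"
  shows "bdry_avg K U = w * cell_avg K U + (1 - w) * U 0"
proof -
  obtain a where a: "\<And>x. U x = (\<Sum>j\<le>3. homogeneous_part a j x)"
    using poly_homogeneous_parts[OF U] unfolding homogeneous_part_def by blast
  let ?h = "homogeneous_part a"
  have ch: "continuous_on UNIV (?h j)" for j
    by (rule poly_deg_le_continuous[OF homogeneous_part_poly])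
  have h0: "?h 0 y = U 0" for y
  proof -
    have "?h j 0 = (if j = 0 then ?h 0 y else 0)" for j
      using homogeneous_part_scale[of a j 0 y] by auto
    thus ?thesis by (simp add: a)
  qed
  have odd: "average M S (?h j) = 0"
    if "odd j" and "sets M = sets borel" "compact S" and sym: "average M S (\<lambda>x. ?h j (- x)) = average M S (?h j)"
    for j M S
  proof -
    have "(\<lambda>x. ?h j (- x)) = (\<lambda>x. (-1) * ?h j x + 0 * ?h j x)"
      using homogeneous_part_scale[of a j "- 1"] \<open>odd j\<close> by (auto simp: fun_eq_iff)
    hence "average M S (\<lambda>x. ?h j (- x)) = - average M S (?h j)"
      using average_linear[OF that(2,3) ch ch, of "-1" j 0 j] by simp
    with sym show ?thesis by simp
  qed
  have dec: "average M S U = U 0 + average M S (?h 2)"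
    if M: "sets M = sets borel" and S: "compact S" "0 < measure M S"
    and sym: "\<And>j. average M S (\<lambda>x. ?h j (- x)) = average M S (?h j)" for M S
  proof -
    have add: "average M S (\<lambda>x. V x + W x) = average M S V + average M S W"
      if "continuous_on UNIV V" "continuous_on UNIV W" for V W
      using average_linear[OF M S(1) that, of 1 1] by simp
    have "U = (\<lambda>x. (?h 0 x + ?h 1 x) + (?h 2 x + ?h 3 x))"
      by (rule ext) (simp add: a eval_nat_numeral)
    hence "average M S U = average M S \<dots>" by (rule arg_cong)
    also have "\<dots> = average M S (?h 0) + average M S (?h 1) + (average M S (?h 2) + average M S (?h 3))"
      by (simp only: add ch continuous_on_add)
    also have "average M S (?h 1) = 0" by (rule odd[OF _ M S(1) sym]) simp
    also have "average M S (?h 3) = 0" by (rule odd[OF _ M S(1) sym]) simp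
    also have "average M S (?h 0) = U 0"
    proof -
      have "emeasure M S \<noteq> \<infinity>" using S(2) by (auto simp: measure_def)
      hence "(LINT x:S|M. U 0) = measure M S * U 0"
        using M S(1) by (subst set_integral_const) (auto simp: borel_compact)
      moreover have "?h 0 = (\<lambda>_. U 0)" using h0 by auto
      ultimately show ?thesis using S(2) by (simp add: average_def)
    qed
    finally show ?thesis by simp
  qed
  have C: "cell_avg K U = U 0 + cell_avg K (?h 2)"
    unfolding cell_avg_eq using vol
    by (intro dec K(1)) (auto simp: average_reflect(1)[OF K ch, unfolded cell_avg_eq])
  have "bdry_avg K U = U 0 + bdry_avg K (?h 2)"
    unfolding bdry_avg_eq using area K(1)
    by (intro dec) (auto simp: average_reflect(2)[OF K ch, unfolded bdry_avg_eq])
  also have "bdry_avg K (?h 2) = w * cell_avg K (?h 2)"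
    by (intro quad homogeneous_part_poly homogeneous_part_scale)
  finally show ?thesis using C by (simp add: algebra_simps)
qed

text \<open>
  The bound \<open>w\<close> holds because \<open>U 0\<close> is nonnegative and \<open>1 - w\<close> is not positive. The squared norm
  vanishes at 0 and attains it.
\<close>

lemma opt_weight_cubic:
  fixes K :: "(real ^ 'n) set"
  assumes K: "compact K" "0 \<in> K" and vol: "0 < measure lborel K" and w: "w \<ge> 1"
    and eq: "\<And>U. poly_deg_le 3 U \<Longrightarrow> bdry_avg K U = w * cell_avg K U + (1 - w) * U 0"
  shows "opt_weight K 3 = ereal w"
proof (rule antisym)
  show "opt_weight K 3 \<le> ereal w"
    unfolding opt_weight_def
  proof (rule Sup_least, clarify)
    fix U assume U: "poly_deg_le 3 U" "\<forall>x\<in>K. 0 \<le> U x" "0 < cell_avg K U"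
    have "bdry_avg K U \<le> w * cell_avg K U"
      using eq[OF U(1)] U(2) K(2) w by (simp add: mult_nonpos_nonneg)
    thus "ereal (bdry_avg K U / cell_avg K U) \<le> ereal w" using U(3) by (simp add: field_simps)
  qed
  define Q where "Q = (\<lambda>x :: real ^ 'n. \<Sum>i\<in>UNIV. (x $ i) ^ 2)"
  have Q: "poly_deg_le 3 Q"
    unfolding Q_def
    by (intro poly_deg_le_sum poly_deg_le_mono[OF poly_deg_le_power[OF poly_deg_le_component]]) simp
  have Qn: "Q x = (norm x)\<^sup>2" for x
    by (simp add: Q_def norm_vec_def L2_set_def real_sqrt_pow2 sum_nonneg)
  have pos: "0 < cell_avg K Q"
  proof -
    have fin: "emeasure lborel K < \<infinity>" using K(1) by (rule emeasure_compact_finite)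
    have int: "set_integrable lborel K Q"
      by (rule set_integrable_bounded[OF _ borel_compact[OF K(1)] compact_imp_bounded[OF K(1)] fin
            poly_deg_le_continuous[OF Q]]) simp
    have "(LINT x:K|lborel. Q x) \<noteq> 0"
    proof
      assume "(LINT x:K|lborel. Q x) = 0"
      hence "AE x in lborel. indicator K x *\<^sub>R Q x = 0"
        using int unfolding set_lebesgue_integral_def set_integrable_def
        by (subst (asm) integral_nonneg_eq_0_iff_AE) (auto simp: Qn)
      moreover have "AE x in lborel. x \<noteq> (0 :: real ^ 'n)"
        by (rule AE_lborel_singleton)
      ultimately have "AE x in lborel. x \<notin> K"
        by eventually_elim (auto simp: Qn indicator_def split: if_splits)
      hence "emeasure lborel K = 0"
        using K(1) by (subst (asm) AE_iff_measurable[OF _ refl]) (auto simp: borel_compact)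
      thus False using vol by (simp add: measure_def)
    qed
    moreover have "0 \<le> (LINT x:K|lborel. Q x)"
      unfolding set_lebesgue_integral_def by (rule Bochner_Integration.integral_nonneg) (simp add: Qn)
    ultimately show ?thesis using vol by (simp add: cell_avg_def)
  qed
  have "bdry_avg K Q / cell_avg K Q = w"
    using eq[OF Q] pos by (simp add: Qn)
  thus "ereal w \<le> opt_weight K 3"
    unfolding opt_weight_def using Q pos by (intro Sup_upper) (force simp: Qn)
qed

section \<open>Polytopal cells\<close>

lemma polytope_frontier_hyperplanes:
  fixes P :: "'a::euclidean_space set"
  assumes "polytope P"
  shows "\<exists>F. finite F \<and> (\<forall>(a, b)\<in>F. norm a = 1) \<and> frontier P \<subseteq> (\<Union>(a, b)\<in>F. {x. a \<bullet> x = b})"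
proof -
  obtain G where G: "finite G" "P = \<Inter> G"
    and h: "\<And>h. h \<in> G \<Longrightarrow> \<exists>a b. a \<noteq> 0 \<and> h = {x. a \<bullet> x \<le> b}"
    using polytope_imp_polyhedron[OF assms] unfolding polyhedron_def by blast
  obtain a b where ab: "\<And>h. h \<in> G \<Longrightarrow> a h \<noteq> 0 \<and> h = {x. a h \<bullet> x \<le> (b h :: real)}"
    using h by metis
  define F where "F = (\<lambda>h. (a h /\<^sub>R norm (a h), b h / norm (a h))) ` G"
  have "frontier P \<subseteq> (\<Union>h\<in>G. {x. a h \<bullet> x = b h})"
  proof
    fix x assume x: "x \<in> frontier P"
    have "closed P" unfolding G(2) using ab by (intro closed_Inter ballI) (metis closed_halfspace_le)
    hence xP: "x \<in> P" using x frontier_subset_closed by blast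
    show "x \<in> (\<Union>h\<in>G. {x. a h \<bullet> x = b h})"
    proof (rule ccontr)
      assume no: "\<not> ?thesis"
      have "x \<in> (\<Inter>h\<in>G. {x. a h \<bullet> x < b h})"
      proof
        fix h assume hG: "h \<in> G"
        hence "a h \<bullet> x \<le> b h" using xP G(2) ab[OF hG] by blast
        thus "x \<in> {x. a h \<bullet> x < b h}" using no hG by auto
      qed
      moreover have "open (\<Inter>h\<in>G. {x. a h \<bullet> x < b h})"
        using G(1) by (intro open_INT ballI open_halfspace_lt)
      moreover have "(\<Inter>h\<in>G. {x. a h \<bullet> x < b h}) \<subseteq> P"
        unfolding G(2)
      proof (intro subsetI InterI)
        fix y h assume y: "y \<in> (\<Inter>h\<in>G. {x. a h \<bullet> x < b h})" and hG: "h \<in> G"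
        hence "a h \<bullet> y \<le> b h" by (auto simp: less_imp_le)
        thus "y \<in> h" using ab[OF hG] by blast
      qed
      ultimately have "x \<in> interior P" by (meson interiorI)
      thus False using x by (simp add: frontier_def)
    qed
  qed
  also have "\<dots> \<subseteq> (\<Union>(u, c)\<in>F. {x. u \<bullet> x = c})"
  proof
    fix x assume "x \<in> (\<Union>h\<in>G. {x. a h \<bullet> x = b h})"
    then obtain h where hG: "h \<in> G" "a h \<bullet> x = b h" by blast
    have "(a h /\<^sub>R norm (a h)) \<bullet> x = b h / norm (a h)"
      using hG(2) by (simp add: divide_inverse mult.commute)
    thus "x \<in> (\<Union>(u, c)\<in>F. {x. u \<bullet> x = c})" unfolding F_def using hG(1) by blast
  qed
  finally have "frontier P \<subseteq> (\<Union>(u, c)\<in>F. {x. u \<bullet> x = c})" .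
  moreover have "finite F" "\<forall>(u, c)\<in>F. norm u = 1" using G(1) ab by (auto simp: F_def)
  ultimately show ?thesis by blast
qed

lemma polytopal_cell_props:
  fixes K :: "(real ^ 'n) set"
  assumes "polytopal_cell K"
  shows "compact K" "K \<subseteq> closure (interior K)" "interior K \<noteq> {}"
    "\<exists>F. finite F \<and> (\<forall>(a, b)\<in>F. norm a = 1) \<and> frontier K \<subseteq> (\<Union>(a, b)\<in>F. {x. a \<bullet> x = b})"
proof -
  obtain G where G: "finite G" "G \<noteq> {}" "\<And>P. P \<in> G \<Longrightarrow> polytope P \<and> interior P \<noteq> {}" "K = \<Union>G"
    using assms unfolding polytopal_cell_def by blast
  show "compact K" unfolding G(4) using G(1,3) by (intro compact_Union) (auto intro: polytope_imp_compact)
  have sub: "interior P \<subseteq> interior K" if "P \<in> G" for P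
    using that by (intro interior_mono) (auto simp: G(4))
  show "interior K \<noteq> {}" using G(2,3) sub by blast
  show "K \<subseteq> closure (interior K)"
  proof
    fix x assume "x \<in> K"
    then obtain P where P: "P \<in> G" "x \<in> P" by (auto simp: G(4))
    have "closure (interior P) = closure P"
      using G(3)[OF P(1)] by (intro convex_closure_interior) (auto intro: polytope_imp_convex)
    hence "x \<in> closure (interior P)" using P(2) closure_subset by blast
    thus "x \<in> closure (interior K)" using closure_mono[OF sub[OF P(1)]] by blast
  qed
  have "\<exists>F. finite F \<and> (\<forall>(a, b)\<in>F. norm a = 1) \<and> frontier P \<subseteq> (\<Union>(a, b)\<in>F. {x. a \<bullet> x = b})"
    if "P \<in> G" for P
    using G(3)[OF that] by (intro polytope_frontier_hyperplanes) simp
  then obtain F where F: "\<And>P. P \<in> G \<Longrightarrow> finite (F P) \<and> (\<forall>(a, b)\<in>F P. norm a = 1)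
      \<and> frontier P \<subseteq> (\<Union>(a, b)\<in>F P. {x. a \<bullet> x = b})" by metis
  have fr: "frontier K \<subseteq> (\<Union>P\<in>G. frontier P)"
  proof
    fix x assume x: "x \<in> frontier K"
    have "closed K" using \<open>compact K\<close> by (rule compact_imp_closed)
    hence "x \<in> K" using x frontier_subset_closed by blast
    then obtain P where P: "P \<in> G" "x \<in> P" by (auto simp: G(4))
    have "x \<notin> interior P" using x sub[OF P(1)] by (auto simp: frontier_def)
    hence "x \<in> frontier P" using P(2) closure_subset by (auto simp: frontier_def)
    thus "x \<in> (\<Union>P\<in>G. frontier P)" using P(1) by blast
  qed
  show "\<exists>F. finite F \<and> (\<forall>(a, b)\<in>F. norm a = 1) \<and> frontier K \<subseteq> (\<Union>(a, b)\<in>F. {x. a \<bullet> x = b})"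
  proof (intro exI[of _ "\<Union>(F ` G)"] conjI)
    show "finite (\<Union>(F ` G))" using G(1) F by blast
    show "\<forall>(a, b)\<in>\<Union>(F ` G). norm a = 1" using F by blast
    show "frontier K \<subseteq> (\<Union>(a, b)\<in>\<Union>(F ` G). {x. a \<bullet> x = b})"
    proof
      fix x assume "x \<in> frontier K"
      then obtain P where P: "P \<in> G" "x \<in> frontier P" using fr by blast
      hence "x \<in> (\<Union>(a, b)\<in>F P. {x. a \<bullet> x = b})" using F by blast
      thus "x \<in> (\<Union>(a, b)\<in>\<Union>(F ` G). {x. a \<bullet> x = b})" using P(1) by blast
    qed
  qed
qed

lemma emeasure_lborel_hyperplane:
  fixes q :: "'a::euclidean_space"
  assumes "q \<noteq> 0"
  shows "emeasure lborel {x. q \<bullet> x = b} = 0"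
proof -
  have "negligible {x. q \<bullet> x = b}" using assms by (intro negligible_hyperplane) simp
  hence "{x. q \<bullet> x = b} \<in> null_sets lebesgue" by (simp add: negligible_iff_null_sets)
  hence "emeasure lebesgue {x. q \<bullet> x = b} = 0" by (rule null_setsD1)
  thus ?thesis by (simp add: emeasure_completion main_part_sets)
qed

text \<open>
  The cone with apex 0 over the intersection of two hyperplanes lies in a hyperplane through 0. Its normal
  \<open>q\<close> is the combination of \<open>a\<close> and \<open>a'\<close> that cancels the right-hand sides, unless this is zero; then
  both hyperplanes pass through 0 or do not meet at all.
\<close>

lemma distinct_hyperplanes_cone:
  fixes a a' :: "'a::euclidean_space"
  assumes a: "a \<noteq> 0" "a' \<noteq> 0" and ne: "{x. a \<bullet> x = b} \<noteq> {x. a' \<bullet> x = b'}"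
  shows "\<exists>q. q \<noteq> 0 \<and> {x. a \<bullet> x = b} \<inter> {x. a' \<bullet> x = b'} \<subseteq> {x. q \<bullet> x = 0}"
proof (cases "b *\<^sub>R a' - b' *\<^sub>R a = 0")
  case False
  thus ?thesis by (intro exI[of _ "b *\<^sub>R a' - b' *\<^sub>R a"]) (auto simp: inner_diff_left)
next
  case True
  have "b = 0"
  proof (rule ccontr)
    assume b: "b \<noteq> 0"
    have a': "b *\<^sub>R a' = b' *\<^sub>R a" using True by simp
    hence b': "b' \<noteq> 0" using b a by auto
    have "a \<bullet> x = b \<longleftrightarrow> a' \<bullet> x = b'" for x
    proof -
      have "b * (a' \<bullet> x) = b' * (a \<bullet> x)" using arg_cong[OF a', of "\<lambda>v. v \<bullet> x"] by simp
      thus ?thesis using b b' by (metis mult.commute mult_cancel_left)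
    qed
    thus False using ne by simp
  qed
  thus ?thesis using a by (intro exI[of _ a]) auto
qed

lemma hausdorff_outer_null:
  fixes m :: "real ^ 'n"
  assumes m: "m \<noteq> 0" and A: "A \<in> sets borel" "A \<subseteq> {x. m \<bullet> x = 1}"
    and null: "emeasure lborel (facet_cone m A) = 0"
  shows "hausdorff_outer (CARD('n) - 1) A = 0"
proof -
  have "norm m > 0" using m by simp
  from hausdorff_facet[OF this, where 'n = 'n] obtain c where
    "\<And>m' A. norm (m' :: real ^ 'n) = norm m \<Longrightarrow> A \<in> sets borel \<Longrightarrow> A \<subseteq> {x. m' \<bullet> x = 1} \<Longrightarrow>
     hausdorff_outer (CARD('n) - 1) A = ennreal c * emeasure lborel (facet_cone m' A)" by blast
  from this[OF refl A] null show ?thesis by simp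
qed

text \<open>
  After a translation the intersection lies in \<open>{x. a \<bullet> x = 1}\<close>, and the cone over it is contained
  in a hyperplane, hence has volume 0.
\<close>

lemma hausdorff_outer_ridge:
  fixes a a' :: "real ^ 'n"
  assumes a: "a \<noteq> 0" "a' \<noteq> 0" and ne: "{x. a \<bullet> x = b} \<noteq> {x. a' \<bullet> x = b'}"
  shows "hausdorff_outer (CARD('n) - 1) ({x. a \<bullet> x = b} \<inter> {x. a' \<bullet> x = b'}) = 0"
proof (cases "{x. a \<bullet> x = b} \<inter> {x. a' \<bullet> x = b'} = {}")
  case False
  then obtain p where p: "a \<bullet> p = b" "a' \<bullet> p = b'" by auto
  define \<beta> where "\<beta> = (a' \<bullet> a) / (a \<bullet> a)"
  have aa: "a \<bullet> a \<noteq> 0" using a by simp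
  define X where "X = {x. a \<bullet> x = 1} \<inter> {x. a' \<bullet> x = \<beta>}"
  define s where "s = a /\<^sub>R (a \<bullet> a) - p"
  have "(+) s ` ({x. a \<bullet> x = b} \<inter> {x. a' \<bullet> x = b'}) \<subseteq> X"
    using p aa by (auto simp: X_def s_def inner_add_right inner_diff_right \<beta>_def divide_inverse mult.commute)
  hence "hausdorff_outer (CARD('n) - 1) ((+) s ` ({x. a \<bullet> x = b} \<inter> {x. a' \<bullet> x = b'}))
      \<le> hausdorff_outer (CARD('n) - 1) X" by (rule hausdorff_outer_mono)
  also have "hausdorff_outer (CARD('n) - 1) X = 0"
  proof (rule hausdorff_outer_null[OF a(1)])
    show "X \<in> sets borel" "X \<subseteq> {x. a \<bullet> x = 1}" by (auto simp: X_def)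
    have "a' - \<beta> *\<^sub>R a \<noteq> 0"
    proof
      assume "a' - \<beta> *\<^sub>R a = 0"
      hence a': "a' = \<beta> *\<^sub>R a" by simp
      hence "\<beta> \<noteq> 0" using a by auto
      hence "{x. a \<bullet> x = b} = {x. a' \<bullet> x = b'}" using p by (auto simp: a')
      with ne show False by simp
    qed
    hence "emeasure lborel {y. (a' - \<beta> *\<^sub>R a) \<bullet> y = 0} = 0" by (rule emeasure_lborel_hyperplane)
    moreover have "facet_cone a X \<subseteq> {y. (a' - \<beta> *\<^sub>R a) \<bullet> y = 0}"
      by (auto simp: facet_cone_def X_def inner_diff_left field_simps)
    hence "emeasure lborel (facet_cone a X) \<le> emeasure lborel {y. (a' - \<beta> *\<^sub>R a) \<bullet> y = 0}"
      by (rule emeasure_mono) simp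
    ultimately show "emeasure lborel (facet_cone a X) = 0" by simp
  qed
  finally have "hausdorff_outer (CARD('n) - 1) ((+) s ` ({x. a \<bullet> x = b} \<inter> {x. a' \<bullet> x = b'})) = 0" by simp
  thus ?thesis by (subst (asm) hausdorff_outer_isometric_image) auto
qed simp

text \<open>
  Each of the two open half-balls is connected and disjoint from the boundary, so it lies inside or
  outside of \<open>K\<close>. Both inside would make \<open>x\<close> an interior point; both outside would leave \<open>K\<close> without
  interior points near \<open>x\<close>.
\<close>

lemma local_halfspace:
  fixes K :: "'a::euclidean_space set"
  assumes K: "closed K" "K \<subseteq> closure (interior K)" and x: "x \<in> frontier K" and e: "e > 0"
    and n: "norm n = 1" "n \<bullet> x = b" and fr: "frontier K \<inter> ball x e \<subseteq> {y. n \<bullet> y = b}"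
  shows "\<exists>s\<in>{n, - n}. \<forall>y\<in>ball x e. y \<in> K \<longleftrightarrow> s \<bullet> (y - x) \<le> 0"
proof -
  define H where "H s = ball x e \<inter> {y. s \<bullet> y < s \<bullet> x}" for s
  have conn: "H s \<subseteq> K \<or> H s \<inter> K = {}" if s: "s = n \<or> s = - n" for s
  proof (rule ccontr)
    assume no: "\<not> ?thesis"
    have "connected (H s)" unfolding H_def
      by (intro convex_connected convex_Int convex_ball convex_halfspace_lt)
    with no have "H s \<inter> frontier K \<noteq> {}" by (intro connected_Int_frontier) auto
    thus False using fr n(2) s by (auto simp: H_def)
  qed
  have Kx: "x \<in> K" using x K(1) frontier_subset_closed by blast
  have cl: "ball x e \<inter> {y. s \<bullet> y \<le> s \<bullet> x} \<subseteq> K" if sub: "H s \<subseteq> K" and s: "norm s = 1" for s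
  proof
    fix y assume y: "y \<in> ball x e \<inter> {y. s \<bullet> y \<le> s \<bullet> x}"
    have "y \<in> closure (H s)"
      unfolding closure_approachable
    proof (intro allI impI)
      fix d :: real assume d: "d > 0"
      define r where "r = min (d / 2) ((e - dist x y) / 2)"
      have "dist x y < e" using y by simp
      moreover have "r \<le> d / 2" "r \<le> (e - dist x y) / 2" unfolding r_def by (rule min.cobounded1, rule min.cobounded2)
      moreover have "r > 0" using d \<open>dist x y < e\<close> by (simp add: r_def)
      ultimately have r: "r > 0" "r < d" "dist x y + r < e" using d by (simp_all add: field_simps)
      have "dist x (y - r *\<^sub>R s) \<le> dist x y + r"
        using dist_triangle[of x "y - r *\<^sub>R s" y] s r by (simp add: dist_norm)
      moreover have "s \<bullet> (y - r *\<^sub>R s) < s \<bullet> x"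
        using y r s by (simp add: inner_diff_right dot_square_norm)
      ultimately have "y - r *\<^sub>R s \<in> H s" using r by (simp add: H_def)
      moreover have "dist (y - r *\<^sub>R s) y < d" using r s by (simp add: dist_norm)
      ultimately show "\<exists>z\<in>H s. dist z y < d" by blast
    qed
    thus "y \<in> K" using closure_minimal[OF sub K(1)] by blast
  qed
  have n': "norm (- n) = 1" using n by simp
  have "\<not> (H n \<subseteq> K \<and> H (- n) \<subseteq> K)"
  proof
    assume *: "H n \<subseteq> K \<and> H (- n) \<subseteq> K"
    have "ball x e \<subseteq> K" using cl[OF conjunct1[OF *] n(1)] cl[OF conjunct2[OF *] n'] by force
    hence "x \<in> interior K" using e by (meson centre_in_ball interiorI open_ball)
    thus False using x by (simp add: frontier_def)
  qed
  moreover have "\<not> (H n \<inter> K = {} \<and> H (- n) \<inter> K = {})"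
  proof
    assume *: "H n \<inter> K = {} \<and> H (- n) \<inter> K = {}"
    have sub: "ball x e \<inter> interior K \<subseteq> {y. n \<bullet> y = n \<bullet> x}"
    proof
      fix y assume y: "y \<in> ball x e \<inter> interior K"
      hence "y \<in> K" using interior_subset by blast
      hence "y \<notin> H n" "y \<notin> H (- n)" using * by auto
      thus "y \<in> {y. n \<bullet> y = n \<bullet> x}" using y by (auto simp: H_def)
    qed
    have "x \<in> closure (interior K)" using Kx K(2) by blast
    then obtain y where y: "y \<in> interior K" "dist y x < e"
      using e unfolding closure_approachable by blast
    have "open (ball x e \<inter> interior K)" by (intro open_Int open_ball open_interior)
    hence "y \<in> interior {y. n \<bullet> y = n \<bullet> x}"
      using y sub by (intro interiorI[of "ball x e \<inter> interior K"]) (auto simp: dist_commute)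
    moreover have "interior {y. n \<bullet> y = n \<bullet> x} = {}"
      using n(1) by (intro interior_hyperplane) auto
    ultimately show False by simp
  qed
  moreover have "\<forall>y\<in>ball x e. y \<in> K \<longleftrightarrow> s \<bullet> (y - x) \<le> 0"
    if "norm s = 1" "H s \<subseteq> K" "H (- s) \<inter> K = {}" for s
  proof
    fix y assume y: "y \<in> ball x e"
    show "y \<in> K \<longleftrightarrow> s \<bullet> (y - x) \<le> 0"
    proof
      assume "y \<in> K"
      hence "y \<notin> H (- s)" using that by auto
      thus "s \<bullet> (y - x) \<le> 0" using y by (simp add: H_def inner_diff_right)
    next
      assume "s \<bullet> (y - x) \<le> 0"
      thus "y \<in> K" using cl[OF that(2,1)] y by (auto simp: inner_diff_right)
    qed
  qed
  ultimately show ?thesis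
    using conn[of n] conn[of "- n"] n n' by (metis insertCI minus_minus)
qed

lemma local_halfspace_outward_unit_normal:
  assumes "norm n = 1" "e > 0" "\<forall>y\<in>ball x e. y \<in> K \<longleftrightarrow> n \<bullet> (y - x) \<le> 0"
  shows "outward_unit_normal K x n"
  unfolding outward_unit_normal_def
proof (intro conjI allI impI)
  fix \<epsilon> :: real assume \<epsilon>: "\<epsilon> > 0"
  show "\<exists>\<delta>>0. \<forall>y. dist y x < \<delta> \<longrightarrow>
        (n \<bullet> (y - x) < - \<epsilon> * norm (y - x) \<longrightarrow> y \<in> K) \<and> (n \<bullet> (y - x) > \<epsilon> * norm (y - x) \<longrightarrow> y \<notin> K)"
  proof (intro exI[of _ e] conjI allI impI assms(2))
    fix y assume y: "dist y x < e"
    have "0 \<le> \<epsilon> * norm (y - x)" using \<epsilon> by simp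
    moreover have "y \<in> K \<longleftrightarrow> n \<bullet> (y - x) \<le> 0" using assms(3) y by (simp add: dist_commute)
    ultimately show "n \<bullet> (y - x) < - \<epsilon> * norm (y - x) \<Longrightarrow> y \<in> K"
      and "n \<bullet> (y - x) > \<epsilon> * norm (y - x) \<Longrightarrow> y \<notin> K" by auto
  qed
qed (rule assms(1))

lemma compact_ray_exit:
  fixes K :: "'a::euclidean_space set"
  assumes K: "compact K" and y: "y \<in> K" "y \<noteq> 0"
  shows "\<exists>t\<ge>1. t *\<^sub>R y \<in> frontier K \<and> t *\<^sub>R y \<in> K \<and> (\<forall>u>t. u *\<^sub>R y \<notin> K)"
proof -
  obtain B where B: "\<And>x. x \<in> K \<Longrightarrow> norm x \<le> B" using compact_imp_bounded[OF K] bounded_iff by metis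
  define T where "T = {0..B / norm y} \<inter> (\<lambda>t. t *\<^sub>R y) -` K"
  have "closed ((\<lambda>t::real. t *\<^sub>R y) -` K)"
    using compact_imp_closed[OF K] by (intro closed_vimage continuous_intros)
  hence "compact T" unfolding T_def by (intro compact_Int_closed compact_Icc)
  have TI: "t \<in> T" if "t \<ge> 0" "t *\<^sub>R y \<in> K" for t
    using B[OF that(2)] that y by (simp add: T_def pos_le_divide_eq)
  have "1 \<in> T" using y by (intro TI) auto
  then obtain t where t: "t \<in> T" "\<And>u. u \<in> T \<Longrightarrow> u \<le> t"
    using compact_attains_sup[OF \<open>compact T\<close>] by blast
  have t1: "t \<ge> 1" using t(2)[OF \<open>1 \<in> T\<close>] .
  have tK: "t *\<^sub>R y \<in> K" using t(1) by (simp add: T_def)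
  have out: "u *\<^sub>R y \<notin> K" if "u > t" for u using TI[of u] t(2)[of u] that t1 by force
  have "t *\<^sub>R y \<notin> interior K"
  proof
    assume "t *\<^sub>R y \<in> interior K"
    then obtain e where e: "e > 0" "ball (t *\<^sub>R y) e \<subseteq> K" using mem_interior by blast
    define u where "u = t + e / (2 * norm y)"
    have "dist (t *\<^sub>R y) (u *\<^sub>R y) = norm ((t - u) *\<^sub>R y)" by (simp add: dist_norm scaleR_diff_left)
    also have "\<dots> = e / 2" using e y by (simp add: u_def)
    finally have "u *\<^sub>R y \<in> K" using e by (intro subsetD[OF e(2)]) simp
    moreover have "u > t" using e y by (simp add: u_def)
    ultimately show False using out by blast
  qed
  hence "t *\<^sub>R y \<in> frontier K" using tK closure_subset by (auto simp: frontier_def)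
  thus ?thesis using t1 tK out by blast
qed

text \<open>
  Off the ridges, \<open>K\<close> is locally a half-space at each boundary point, which then lies in one of finitely
  many hyperplanes \<open>{x. m \<bullet> x = 1}\<close> with \<open>m = n /\<^sub>R r\<close> for an outward unit normal \<open>n\<close>. All these \<open>m\<close>
  have norm \<open>1 / r\<close>, so the same factor \<open>c\<close> relates Hausdorff measure and cone volume on all
  of them. A ray from 0 that avoids a null set \<open>N\<close> leaves \<open>K\<close> through exactly one such point, so
  the cones over the pieces \<open>Rm m\<close> of the boundary are disjoint and fill \<open>K - N\<close>.
\<close>

lemma polytopal_boundary_integral:
  fixes K :: "(real ^ 'n) set"
  assumes P: "polytopal_cell K"
    and star: "\<And>x t. x \<in> K \<Longrightarrow> 0 \<le> t \<Longrightarrow> t \<le> 1 \<Longrightarrow> t *\<^sub>R x \<in> K"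
    and nrm: "\<And>x n. x \<in> frontier K \<Longrightarrow> outward_unit_normal K x n \<Longrightarrow> n \<bullet> x = r"
  shows "\<exists>c>0. emeasure surface (frontier K) < \<infinity> \<and>
    (\<forall>k U. continuous_on UNIV U \<and> (\<forall>t>0. \<forall>y. U (t *\<^sub>R y) = t ^ k * U y) \<longrightarrow>
       (LINT x:frontier K|surface. U x) = c * (real (CARD('n) + k) / real CARD('n)) * (LINT x:K|lborel. U x))"
proof -
  let ?H = "hausdorff_outer (CARD('n) - 1) :: (real ^ 'n) set \<Rightarrow> ennreal"
  note comp = polytopal_cell_props(1)[OF P] and reg = polytopal_cell_props(2)[OF P]
  have cl: "closed K" using comp by (rule compact_imp_closed)
  have frK: "frontier K \<subseteq> K" using cl by (rule frontier_subset_closed)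
  obtain F where F: "finite F" "\<forall>(a, b)\<in>F. norm a = 1" "frontier K \<subseteq> (\<Union>(a, b)\<in>F. {x. a \<bullet> x = b})"
    using polytopal_cell_props(4)[OF P] by blast
  define N1 where "N1 = fst ` F \<union> uminus ` fst ` F"
  have N1: "finite N1" "\<And>n. n \<in> N1 \<Longrightarrow> norm n = 1" "\<And>n. n \<in> N1 \<Longrightarrow> - n \<in> N1"
    using F(1,2) by (auto simp: N1_def image_image intro: rev_image_eqI)
  \<comment> \<open>With the hyperplanes at signed distance r included, a point that lies on two different
    hyperplanes of the form needed for the cones is a ridge point.\<close>
  define F' where "F' = F \<union> N1 \<times> {r}"
  have F': "finite F'" "\<And>p. p \<in> F' \<Longrightarrow> fst p \<in> N1"
    using F(1) N1(1) by (force simp: F'_def N1_def)+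
  define hy where "hy p = {x. fst p \<bullet> x = snd p}" for p :: "(real ^ 'n) \<times> real"
  have hyc: "closed (hy p)" for p unfolding hy_def by (rule closed_hyperplane)
  have frH: "frontier K \<subseteq> (\<Union>p\<in>F'. hy p)"
    using F(3) by (force simp: hy_def F'_def)
  define PP where "PP = {(p, p'). p \<in> F' \<and> p' \<in> F' \<and> hy p \<noteq> hy p'}"
  have "finite PP" by (rule finite_subset[of _ "F' \<times> F'"]) (use F' in \<open>auto simp: PP_def\<close>)
  define E where "E = (\<Union>(p, p')\<in>PP. hy p \<inter> hy p')"
  have EI: "x \<in> E" if "p \<in> F'" "p' \<in> F'" "hy p \<noteq> hy p'" "x \<in> hy p" "x \<in> hy p'" for x p p'
    unfolding E_def using that by (intro UN_I[of "(p, p')"]) (auto simp: PP_def)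
  have n0: "fst p \<noteq> 0" if "p \<in> F'" for p using N1(2)[OF F'(2)[OF that]] by auto
  have "\<exists>q. q \<noteq> 0 \<and> hy (fst pp) \<inter> hy (snd pp) \<subseteq> {x. q \<bullet> x = 0}" if "pp \<in> PP" for pp
  proof -
    have p: "fst pp \<in> F'" "snd pp \<in> F'" "hy (fst pp) \<noteq> hy (snd pp)" using that by (auto simp: PP_def)
    show ?thesis unfolding hy_def
      by (rule distinct_hyperplanes_cone[OF n0[OF p(1)] n0[OF p(2)] p(3)[unfolded hy_def]])
  qed
  then obtain q where q: "\<And>pp. pp \<in> PP \<Longrightarrow> q pp \<noteq> 0 \<and> hy (fst pp) \<inter> hy (snd pp) \<subseteq> {x. q pp \<bullet> x = 0}"
    by metis
  \<comment> \<open>A closed null cone that contains the ridges. The apex is included so that every point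
    outside of N spans a ray.\<close>
  define N where "N = (\<Union>pp\<in>PP. {x. q pp \<bullet> x = 0}) \<union> {0}"
  have EN: "E \<subseteq> N" unfolding E_def N_def using q by fastforce
  have Ncl: "closed N" unfolding N_def using \<open>finite PP\<close>
    by (intro closed_Un closed_UN ballI closed_hyperplane closed_singleton)
  have Nb [measurable]: "N \<in> sets borel" using Ncl by (rule borel_closed)
  have N0: "N \<in> null_sets lborel"
  proof -
    have "{x. q pp \<bullet> x = 0} \<in> null_sets lborel" if "pp \<in> PP" for pp
      using q[OF that] by (intro null_setsI emeasure_lborel_hyperplane) auto
    thus ?thesis unfolding N_def using \<open>finite PP\<close>
      by (intro null_sets.Un null_sets_UN' countable_finite) (auto simp: null_sets_def)
  qed
  have Ncone: "t *\<^sub>R x \<in> N \<longleftrightarrow> x \<in> N" if "t > 0" for t x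
    using that by (auto simp: N_def)
  \<comment> \<open>Off the ridges only one hyperplane passes near x, so K is locally a half-space.\<close>
  have loc: "\<exists>n\<in>N1. n \<bullet> x = r \<and> (\<exists>e>0. \<forall>y\<in>ball x e. y \<in> K \<longleftrightarrow> n \<bullet> (y - x) \<le> 0)"
    if x: "x \<in> frontier K" "x \<notin> E" for x
  proof -
    obtain p where p: "p \<in> F'" "x \<in> hy p" using x(1) frH by blast
    define Oth where "Oth = \<Union>(hy ` {p'\<in>F'. hy p' \<noteq> hy p})"
    have "closed Oth" unfolding Oth_def using F'(1) hyc by (intro closed_UN) auto
    moreover have "x \<notin> Oth"
    proof
      assume "x \<in> Oth"
      then obtain p' where "p' \<in> F'" "hy p' \<noteq> hy p" "x \<in> hy p'" unfolding Oth_def by blast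
      hence "x \<in> E" using p by (intro EI[of p' p])
      with x(2) show False ..
    qed
    ultimately obtain e where e: "e > 0" "ball x e \<subseteq> - Oth"
      using open_contains_ball[of "- Oth"] by (auto simp: closed_def)
    have "frontier K \<inter> ball x e \<subseteq> hy p"
    proof
      fix y assume y: "y \<in> frontier K \<inter> ball x e"
      then obtain p' where p': "p' \<in> F'" "y \<in> hy p'" using frH by blast
      have "hy p' = hy p"
      proof (rule ccontr)
        assume "hy p' \<noteq> hy p"
        hence "y \<in> Oth" using p' unfolding Oth_def by blast
        thus False using y e(2) by blast
      qed
      thus "y \<in> hy p" using p'(2) by simp
    qed
    hence "\<exists>s\<in>{fst p, - fst p}. \<forall>y\<in>ball x e. y \<in> K \<longleftrightarrow> s \<bullet> (y - x) \<le> 0"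
      using p by (intro local_halfspace[OF cl reg x(1) e(1), of _ "snd p"] N1(2) F'(2)) (auto simp: hy_def)
    then obtain s where s: "s \<in> N1" "\<forall>y\<in>ball x e. y \<in> K \<longleftrightarrow> s \<bullet> (y - x) \<le> 0"
      using F'(2)[OF p(1)] N1(3) by blast
    have "outward_unit_normal K x s"
      by (rule local_halfspace_outward_unit_normal[OF N1(2)[OF s(1)] e(1) s(2)])
    hence "s \<bullet> x = r" by (rule nrm[OF x(1)])
    thus ?thesis using s e(1) by blast
  qed
  \<comment> \<open>Just beyond x on its ray, membership in K depends only on the sign of n . x = r.\<close>
  have move: "\<exists>d>0. \<forall>u. 1 < u \<and> u \<le> 1 + d \<longrightarrow> (u *\<^sub>R x \<in> K \<longleftrightarrow> r \<le> 0)"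
    if x: "x \<in> frontier K" "x \<notin> E" "x \<noteq> 0" for x
  proof -
    from loc[OF x(1,2)] obtain n e where n: "n \<bullet> x = r" "e > 0"
      "\<forall>y\<in>ball x e. y \<in> K \<longleftrightarrow> n \<bullet> (y - x) \<le> 0" by blast
    show ?thesis
    proof (intro exI[of _ "e / (2 * norm x)"] conjI allI impI)
      fix u :: real assume u: "1 < u \<and> u \<le> 1 + e / (2 * norm x)"
      have eq: "u *\<^sub>R x - x = (u - 1) *\<^sub>R x" by (simp add: scaleR_diff_left)
      hence "dist x (u *\<^sub>R x) = (u - 1) * norm x"
        using u by (simp add: dist_norm norm_minus_commute[of x])
      also have "\<dots> \<le> e / (2 * norm x) * norm x" using u by (intro mult_right_mono) auto
      also have "\<dots> < e" using x(3) n(2) by simp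
      finally have "u *\<^sub>R x \<in> K \<longleftrightarrow> (u - 1) * r \<le> 0" using n(1,3) eq by simp
      thus "u *\<^sub>R x \<in> K \<longleftrightarrow> r \<le> 0" using u by (simp add: mult_le_0_iff)
    qed (use n x(3) in auto)
  qed
  have r: "r > 0"
  proof -
    \<comment> \<open>Beyond the last point of K on a ray outside of N there are no points of K.\<close>
    have "\<not> interior K \<subseteq> N"
    proof
      assume sub: "interior K \<subseteq> N"
      obtain x where "x \<in> interior K" using polytopal_cell_props(3)[OF P] by blast
      then obtain e where e: "e > 0" "ball x e \<subseteq> interior K" using open_contains_ball[of "interior K"] by auto
      have "emeasure lborel (ball x e) \<le> emeasure lborel N" using e sub by (intro emeasure_mono) auto
      also have "\<dots> = 0" using N0 by (rule null_setsD1)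
      finally show False using e(1) unit_ball_vol_pos[of "real CARD('n)"] by (simp add: emeasure_ball)
    qed
    then obtain y where y: "y \<in> K" "y \<notin> N" using interior_subset by blast
    have "y \<noteq> 0" using y(2) by (auto simp: N_def)
    with compact_ray_exit[OF comp y(1)] obtain t where t: "t \<ge> 1" "t *\<^sub>R y \<in> frontier K" "\<And>u. u > t \<Longrightarrow> u *\<^sub>R y \<notin> K"
      by blast
    have "t *\<^sub>R y \<notin> E" using Ncone[of t y] t(1) y(2) EN by auto
    moreover have "t *\<^sub>R y \<noteq> 0" using \<open>y \<noteq> 0\<close> t(1) by simp
    ultimately obtain d where d: "d > 0" "\<forall>u. 1 < u \<and> u \<le> 1 + d \<longrightarrow> (u *\<^sub>R t *\<^sub>R y \<in> K \<longleftrightarrow> r \<le> 0)"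
      using move[OF t(2)] by blast
    hence u: "(1 + d) *\<^sub>R t *\<^sub>R y \<in> K \<longleftrightarrow> r \<le> 0" by simp
    have "(1 + d) * t > t" using d(1) t(1) by simp
    hence "(1 + d) *\<^sub>R t *\<^sub>R y \<notin> K" using t(3)[of "(1 + d) * t"] by simp
    thus ?thesis using u by simp
  qed
  define M where "M = (\<lambda>n. n /\<^sub>R r) ` N1"
  have M: "finite M" "\<And>m. m \<in> M \<Longrightarrow> norm m = 1 / r" "\<And>m. m \<in> M \<Longrightarrow> m \<noteq> 0"
    using N1 r by (force simp: M_def divide_inverse)+
  have M1: "m \<bullet> x = 1 \<longleftrightarrow> (r *\<^sub>R m) \<bullet> x = r" for m x using r by auto
  have MN: "r *\<^sub>R m \<in> N1" if "m \<in> M" for m using that r by (auto simp: M_def)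
  have uniq: "m = m'" if m: "m \<in> M" "m' \<in> M" and x: "m \<bullet> x = 1" "m' \<bullet> x = 1" "x \<notin> E" for m m' x
  proof -
    let ?p = "(r *\<^sub>R m, r)" and ?p' = "(r *\<^sub>R m', r)"
    have pF: "?p \<in> F'" "?p' \<in> F'" using MN m by (auto simp: F'_def)
    have "x \<in> hy ?p" "x \<in> hy ?p'" using x(1,2) by (simp_all add: hy_def)
    hence eq: "hy ?p = hy ?p'" using x(3) pF EI by blast
    have n: "norm (r *\<^sub>R m) = 1" "norm (r *\<^sub>R m') = 1" using N1(2) MN m by blast+
    have "r *\<^sub>R (r *\<^sub>R m) \<in> hy ?p"
    proof -
      have "u \<bullet> (r *\<^sub>R u) = r" if "norm u = 1" for u :: "real ^ 'n"
        using that by (simp add: dot_square_norm)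
      from this[OF n(1)] show ?thesis by (simp only: hy_def fst_conv snd_conv mem_Collect_eq)
    qed
    hence "(r *\<^sub>R m') \<bullet> (r *\<^sub>R (r *\<^sub>R m)) = r" unfolding eq by (simp only: hy_def fst_conv snd_conv mem_Collect_eq)
    hence "r * ((r *\<^sub>R m') \<bullet> (r *\<^sub>R m)) = r * 1" by (simp only: inner_scaleR_right mult_1_right)
    hence "(r *\<^sub>R m') \<bullet> (r *\<^sub>R m) = 1" using r by (simp only: mult_cancel_left) simp
    hence "(r *\<^sub>R m - r *\<^sub>R m') \<bullet> (r *\<^sub>R m - r *\<^sub>R m') = 0"
      using n unfolding norm_eq_1 by (simp only: inner_diff_left inner_diff_right inner_commute)
    thus ?thesis using r by simp
  qed
  have locM: "\<exists>m\<in>M. m \<bullet> x = 1" if x: "x \<in> frontier K" "x \<notin> E" for x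
    using loc[OF x] r unfolding M_def by (auto intro!: bexI)
  have frb: "frontier K \<in> sets borel" by (intro borel_closed compact_imp_closed compact_frontier comp)
  define R where "R = frontier K - N"
  have Rb [measurable]: "R \<in> sets borel" unfolding R_def using frb Nb by (rule sets.Diff)
  define Rm where "Rm m = R \<inter> {x. m \<bullet> x = 1}" for m
  have Rmb [measurable]: "Rm m \<in> sets borel" for m unfolding Rm_def by measurable
  have RE: "x \<notin> E" if "x \<in> R" for x using that EN by (auto simp: R_def)
  have R_UN: "R = (\<Union>m\<in>M. Rm m)"
    using locM RE by (auto simp: Rm_def R_def)
  have Rdisj: "disjoint_family_on Rm M"
    unfolding disjoint_family_on_def using uniq RE by (fastforce simp: Rm_def)
  define S where "S m = facet_cone m (Rm m)" for m
  have Sb [measurable]: "S m \<in> sets borel" for m unfolding S_def by measurable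
  have S_sub: "S m \<subseteq> K - N" for m
  proof
    fix y assume "y \<in> S m"
    hence y: "0 < m \<bullet> y" "m \<bullet> y \<le> 1" "y /\<^sub>R (m \<bullet> y) \<in> R" by (auto simp: S_def facet_cone_def Rm_def)
    have "(m \<bullet> y) *\<^sub>R (y /\<^sub>R (m \<bullet> y)) \<in> K"
      by (rule star) (use y frK in \<open>auto simp: R_def\<close>)
    hence "y \<in> K" using y(1) by simp
    moreover have "y \<notin> N" using y Ncone[of "inverse (m \<bullet> y)" y] by (auto simp: R_def)
    ultimately show "y \<in> K - N" by simp
  qed
  have S_UN: "K - N = (\<Union>m\<in>M. S m)"
  proof (intro equalityI subsetI)
    fix y assume y: "y \<in> K - N"
    have "y \<noteq> 0" using y by (auto simp: N_def)
    with compact_ray_exit[OF comp, of y] y obtain t where t: "t \<ge> 1" "t *\<^sub>R y \<in> frontier K" by blast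
    have "t *\<^sub>R y \<in> R" using Ncone[of t y] t y by (auto simp: R_def)
    with R_UN obtain m where m: "m \<in> M" "t *\<^sub>R y \<in> Rm m" by blast
    have "m \<bullet> y = 1 / t" using m(2) t(1) by (simp add: Rm_def field_simps)
    hence "y \<in> S m" using m(2) t(1) by (simp add: S_def facet_cone_def)
    thus "y \<in> (\<Union>m\<in>M. S m)" using m(1) by blast
  qed (use S_sub in blast)
  \<comment> \<open>If a ray met R twice, star-shapedness would put points just beyond the first one into K.\<close>
  have no_later: "t' \<le> t" if "t *\<^sub>R y \<in> R" "t' *\<^sub>R y \<in> R" "t > 0" for t t' y
  proof (rule ccontr)
    assume "\<not> t' \<le> t"
    have "t *\<^sub>R y \<in> frontier K" "t *\<^sub>R y \<notin> E" "t *\<^sub>R y \<noteq> 0"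
      using that(1) RE by (auto simp: R_def N_def)
    from move[OF this] obtain d where d: "d > 0"
      "\<forall>u. 1 < u \<and> u \<le> 1 + d \<longrightarrow> (u *\<^sub>R t *\<^sub>R y \<in> K \<longleftrightarrow> r \<le> 0)" by blast
    define u where "u = min (1 + d) (t' / t)"
    have u: "1 < u" "u \<le> 1 + d" "u * t \<le> t'"
      using \<open>\<not> t' \<le> t\<close> that(3) d(1) by (auto simp: u_def min_def field_simps)
    have "t' > 0" using \<open>\<not> t' \<le> t\<close> that(3) by simp
    have "(u * t / t') *\<^sub>R t' *\<^sub>R y \<in> K"
      by (rule star) (use that frK u \<open>t' > 0\<close> in \<open>auto simp: R_def\<close>)
    hence "u *\<^sub>R t *\<^sub>R y \<in> K" using \<open>t' > 0\<close> by simp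
    thus False using d(2) u r by auto
  qed
  have Sdisj: "disjoint_family_on S M"
    unfolding disjoint_family_on_def
  proof (intro ballI impI)
    fix m m' assume m: "m \<in> M" "m' \<in> M" "m \<noteq> m'"
    show "S m \<inter> S m' = {}"
    proof (rule ccontr)
      assume "S m \<inter> S m' \<noteq> {}"
      then obtain y where y: "y \<in> S m" "y \<in> S m'" by blast
      define t t' where "t = inverse (m \<bullet> y)" and "t' = inverse (m' \<bullet> y)"
      have t: "t > 0" "t' > 0" "t *\<^sub>R y \<in> Rm m" "t' *\<^sub>R y \<in> Rm m'"
        using y by (auto simp: S_def facet_cone_def t_def t'_def)
      hence "t' \<le> t" "t \<le> t'" using no_later[of t y t'] no_later[of t' y t] by (auto simp: Rm_def)
      hence "t = t'" by simp
      hence "m = m'" using uniq[OF m(1,2), of "t *\<^sub>R y"] t RE[of "t *\<^sub>R y"] by (simp add: Rm_def)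
      with m(3) show False ..
    qed
  qed
  obtain c where c: "c > 0" "\<And>m A. norm (m :: real ^ 'n) = 1 / r \<Longrightarrow> A \<in> sets borel \<Longrightarrow> A \<subseteq> {x. m \<bullet> x = 1} \<Longrightarrow>
     ?H A = ennreal c * emeasure lborel (facet_cone m A)"
    using hausdorff_facet[of "1 / r", where 'n = 'n] r by auto
  have E0: "E \<in> null_sets surface"
  proof -
    have "hy p \<inter> hy p' \<in> null_sets surface" if "(p, p') \<in> PP" for p p'
    proof (rule null_setsI)
      have b: "hy p \<inter> hy p' \<in> sets borel" by (intro sets.Int borel_closed hyc)
      thus "hy p \<inter> hy p' \<in> sets surface" by simp
      show "emeasure surface (hy p \<inter> hy p') = 0"
        unfolding emeasure_surface[OF b] using that n0 unfolding hy_def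
        by (intro hausdorff_outer_ridge) (auto simp: PP_def hy_def)
    qed
    thus ?thesis unfolding E_def using \<open>finite PP\<close>
      by (intro null_sets_UN' countable_finite) auto
  qed
  have NM0: "N \<inter> {x. m \<bullet> x = 1} \<in> null_sets surface" if "m \<in> M" for m
  proof (rule null_setsI)
    have b: "N \<inter> {x. m \<bullet> x = 1} \<in> sets borel" by measurable
    thus "N \<inter> {x. m \<bullet> x = 1} \<in> sets surface" by simp
    have "facet_cone m (N \<inter> {x. m \<bullet> x = 1}) \<subseteq> N"
    proof
      fix y assume "y \<in> facet_cone m (N \<inter> {x. m \<bullet> x = 1})"
      thus "y \<in> N" using Ncone[of "inverse (m \<bullet> y)" y] by (auto simp: facet_cone_def)
    qed
    hence "emeasure lborel (facet_cone m (N \<inter> {x. m \<bullet> x = 1})) \<le> emeasure lborel N"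
      by (intro emeasure_mono) auto
    hence "emeasure lborel (facet_cone m (N \<inter> {x. m \<bullet> x = 1})) = 0" using null_setsD1[OF N0] by simp
    thus "emeasure surface (N \<inter> {x. m \<bullet> x = 1}) = 0"
      unfolding emeasure_surface[OF b] by (intro hausdorff_outer_null[OF M(3)[OF that] b]) auto
  qed
  define Z where "Z = E \<union> (\<Union>m\<in>M. N \<inter> {x. m \<bullet> x = 1})"
  have Z0: "Z \<in> null_sets surface"
    unfolding Z_def using E0 NM0 M(1) by (intro null_sets.Un null_sets_UN' countable_finite)
  have frZ: "frontier K - R \<subseteq> Z" using locM by (auto simp: R_def Z_def)
  have RmK: "bounded (Rm m)" for m
    by (rule bounded_subset[OF compact_imp_bounded[OF comp]]) (use frK in \<open>auto simp: Rm_def R_def\<close>)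
  have fac: "(LINT x:Rm m|surface. U x) = c * (real (CARD('n) + k) / real CARD('n)) * (LINT y:S m|lborel. U y)"
      "set_integrable surface (Rm m) U" "emeasure surface (Rm m) < \<infinity>"
    if "m \<in> M" and U: "continuous_on UNIV U" "\<And>t y. t > 0 \<Longrightarrow> U (t *\<^sub>R y) = t ^ k * U y" for m U k
    unfolding S_def
    by (rule facet_integral[OF M(3)[OF \<open>m \<in> M\<close>] Rmb _ RmK c(1) c(2)[OF M(2)[OF \<open>m \<in> M\<close>]] U];
        force simp: Rm_def)+
  show ?thesis
  proof (intro exI[of _ c] conjI allI impI c(1))
    have "emeasure surface (frontier K) \<le> emeasure surface (R \<union> Z)"
      using frZ Z0 by (intro emeasure_mono) auto
    also have "\<dots> \<le> emeasure surface R + emeasure surface Z"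
      using Z0 by (intro emeasure_subadditive) auto
    also have "\<dots> = emeasure surface (\<Union>m\<in>M. Rm m)" using null_setsD1[OF Z0] by (simp add: R_UN)
    also have "\<dots> \<le> (\<Sum>m\<in>M. emeasure surface (Rm m))"
      using M(1) by (intro emeasure_subadditive_finite) auto
    also have "\<dots> < \<infinity>" using fac(3)[of _ "\<lambda>_. 1" 0] M(1) by (simp add: less_top)
    finally show "emeasure surface (frontier K) < \<infinity>" .
    fix k and U :: "real ^ 'n \<Rightarrow> real"
    assume "continuous_on UNIV U \<and> (\<forall>t>0. \<forall>y. U (t *\<^sub>R y) = t ^ k * U y)"
    hence U: "continuous_on UNIV U" "\<And>t y. t > 0 \<Longrightarrow> U (t *\<^sub>R y) = t ^ k * U y" by auto
    have Um [measurable]: "U \<in> borel_measurable borel" using U(1) by (rule borel_measurable_continuous_onI)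
    have "(LINT x:frontier K|surface. U x) = (LINT x:R|surface. U x)"
    proof (rule set_integral_cong_set)
      show "set_borel_measurable surface R U" "set_borel_measurable surface (frontier K) U"
        unfolding set_borel_measurable_def using frb by measurable
      show "AE x in surface. (x \<in> R) = (x \<in> frontier K)"
        using AE_not_in[OF Z0] by eventually_elim (use frZ in \<open>auto simp: R_def\<close>)
    qed
    also have "\<dots> = (\<Sum>m\<in>M. LINT x:Rm m|surface. U x)"
      unfolding R_UN using Rdisj M(1) fac(2)[OF _ U] by (intro set_integral_finite_Union) auto
    also have "\<dots> = (\<Sum>m\<in>M. c * (real (CARD('n) + k) / real CARD('n)) * (LINT y:S m|lborel. U y))"
      using fac(1)[OF _ U] by (intro sum.cong) auto
    also have "\<dots> = c * (real (CARD('n) + k) / real CARD('n)) * (\<Sum>m\<in>M. LINT y:S m|lborel. U y)"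
      by (simp only: sum_distrib_left)
    also have "(\<Sum>m\<in>M. LINT y:S m|lborel. U y) = (LINT y:K - N|lborel. U y)"
    proof -
      have "set_integrable lborel K U"
        using borel_integrable_compact[OF comp, of U] U(1) continuous_on_subset
        unfolding set_integrable_def by blast
      hence "set_integrable lborel (S m) U" for m
        by (rule set_integrable_subset) (use S_sub in auto)
      thus ?thesis
        unfolding S_UN using Sdisj M(1) by (intro set_integral_finite_Union[symmetric]) auto
    qed
    also have "\<dots> = (LINT y:K|lborel. U y)"
    proof (rule set_integral_cong_set)
      show "set_borel_measurable lborel K U" "set_borel_measurable lborel (K - N) U"
        unfolding set_borel_measurable_def using borel_compact[OF comp] by measurable
      show "AE x in lborel. (x \<in> K) = (x \<in> K - N)"
        using AE_not_in[OF N0] by eventually_elim auto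
    qed
    finally show "(LINT x:frontier K|surface. U x)
        = c * (real (CARD('n) + k) / real CARD('n)) * (LINT x:K|lborel. U x)" .
  qed
qed

section \<open>Balls\<close>

lemma orthogonal_sign_flip:
  "orthogonal_transformation (\<lambda>y :: real ^ 'n. \<chi> j. if j = i then - y $ j else y $ j)"
  unfolding orthogonal_transformation_def
proof
  show "linear (\<lambda>y :: real ^ 'n. \<chi> j. if j = i then - y $ j else y $ j)"
    by (rule linearI) (auto simp: vec_eq_iff)
  show "\<forall>v w. (\<chi> j. if j = i then - v $ j else v $ j) \<bullet> (\<chi> j. if j = i then - w $ j else (w :: real ^ 'n) $ j) = v \<bullet> w"
    by (auto simp: inner_vec_def intro!: sum.cong)
qed

lemma orthogonal_permute:
  assumes p: "bij p"
  shows "orthogonal_transformation (\<lambda>y :: real ^ 'n. \<chi> j. y $ p j)"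
  unfolding orthogonal_transformation_def
proof
  show "linear (\<lambda>y :: real ^ 'n. \<chi> j. y $ p j)"
    by (rule linearI) (auto simp: vec_eq_iff)
  show "\<forall>v w. (\<chi> j. v $ p j) \<bullet> (\<chi> j. (w :: real ^ 'n) $ p j) = v \<bullet> w"
  proof (intro allI)
    fix v w :: "real ^ 'n"
    show "(\<chi> j. v $ p j) \<bullet> (\<chi> j. w $ p j) = v \<bullet> w"
      using sum.reindex_bij_betw[OF p, of "\<lambda>i. v $ i * w $ i"] by (simp add: inner_vec_def)
  qed
qed

text \<open>
  A sign flip shows that monomials with an odd exponent have average 0. The remaining monomials of degree 2
  are the squares of the coordinates, and a permutation shows that they have equal averages. The
  factor \<open>\<tau>\<close> depends only on the coefficients of \<open>P\<close>, so it is the same for a ball and for its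
  boundary sphere.
\<close>

lemma average_quadratic_rotation_invariant:
  fixes P :: "real ^ 'n \<Rightarrow> real"
  assumes P: "poly_deg_le 2 P" and hom: "\<And>t y. P (t *\<^sub>R y) = t\<^sup>2 * P y"
  obtains \<tau> where "\<And>M S. sets M = sets borel \<Longrightarrow> compact S \<Longrightarrow>
     (\<And>f. orthogonal_transformation f \<Longrightarrow> distr M borel f = M \<and> f ` S = S) \<Longrightarrow>
     average M S P = \<tau> * average M S (\<lambda>y. (norm y)\<^sup>2)"
proof -
  obtain a where a: "\<And>x. P x = (\<Sum>j\<le>2. homogeneous_part a j x)"
    using poly_homogeneous_parts[OF P] unfolding homogeneous_part_def by blast
  have P2: "P y = homogeneous_part a 2 y" for y
  proof -
    \<comment> \<open>Comparing the values at 0, y and 2 y shows that the parts of degree 0 and 1 vanish.\<close>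
    define h where "h j = homogeneous_part a j y" for j
    have "t\<^sup>2 * P y = h 0 + t * h 1 + t\<^sup>2 * h 2" for t
    proof -
      have "t\<^sup>2 * P y = P (t *\<^sub>R y)" by (rule hom[symmetric])
      also have "\<dots> = (\<Sum>j\<le>2. t ^ j * h j)" by (simp only: a homogeneous_part_scale h_def)
      also have "\<dots> = h 0 + t * h 1 + t\<^sup>2 * h 2" by (simp add: eval_nat_numeral)
      finally show ?thesis .
    qed
    from this[of 0] this[of 1] this[of 2] show ?thesis by (simp add: h_def)
  qed
  define e :: "('n \<Rightarrow> nat) \<Rightarrow> real" where "e \<alpha> = (if \<exists>i. odd (\<alpha> i) then 0 else 1)" for \<alpha>
  define \<tau> where "\<tau> = (\<Sum>\<alpha> | (\<Sum>i\<in>UNIV. \<alpha> i) = 2. a \<alpha> * e \<alpha>) / real CARD('n)"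
  show thesis
  proof (rule that[of \<tau>])
    fix M :: "(real ^ 'n) measure" and S
    assume M: "sets M = sets borel" and S: "compact S"
      and inv: "\<And>f. orthogonal_transformation f \<Longrightarrow> distr M borel f = M \<and> f ` S = S"
    let ?A = "average M S"
    have rot: "?A (\<lambda>x. U (f x)) = ?A U" if f: "orthogonal_transformation f" and U: "continuous_on UNIV U" for f U
    proof -
      have "f \<in> borel_measurable borel"
        by (intro borel_measurable_linear orthogonal_transformation_linear f)
      hence "average M (f ` S) U = ?A (\<lambda>x. U (f x))"
        by (rule average_image[OF M _ orthogonal_transformation_inj[OF f] _ _ U])
           (use inv[OF f] S in \<open>auto simp: borel_compact\<close>)
      thus ?thesis using inv[OF f] by simp
    qed
    have lin: "?A (\<lambda>x. \<Sum>i\<in>I. b i * U i x) = (\<Sum>i\<in>I. b i * ?A (U i))"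
      if "finite I" "\<And>i. continuous_on UNIV (U i)" for I :: "'i set" and b U
      using that(1)
    proof induction
      case empty
      show ?case by (simp add: average_def)
    next
      case (insert i I)
      have "continuous_on UNIV (\<lambda>x. \<Sum>i\<in>I. b i * U i x)" using that(2) by (intro continuous_intros)
      hence "?A (\<lambda>x. b i * U i x + 1 * (\<Sum>i\<in>I. b i * U i x)) = b i * ?A (U i) + 1 * ?A (\<lambda>x. \<Sum>i\<in>I. b i * U i x)"
        using that(2) by (intro average_linear M S)
      thus ?case using insert by simp
    qed
    have cmon: "continuous_on UNIV (mon \<alpha>)" for \<alpha> :: "'n \<Rightarrow> nat" by (intro continuous_intros)
    have csq: "continuous_on UNIV (\<lambda>y :: real ^ 'n. (y $ i)\<^sup>2)" for i by (intro continuous_intros)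
    have sq: "?A (\<lambda>y. (y $ i)\<^sup>2) = ?A (\<lambda>y. (norm y)\<^sup>2) / real CARD('n)" for i
    proof -
      have same: "?A (\<lambda>y. (y $ j)\<^sup>2) = ?A (\<lambda>y. (y $ i)\<^sup>2)" for j
      proof -
        have "bij (Transposition.transpose i j)" by simp
        from rot[OF orthogonal_permute[OF this] csq[of i]] show ?thesis by simp
      qed
      have "(\<lambda>y :: real ^ 'n. (norm y)\<^sup>2) = (\<lambda>y. \<Sum>j\<in>UNIV. 1 * (y $ j)\<^sup>2)"
        by (simp add: norm_vec_def L2_set_def sum_nonneg)
      hence "?A (\<lambda>y. (norm y)\<^sup>2) = (\<Sum>j\<in>UNIV. 1 * ?A (\<lambda>y. (y $ j)\<^sup>2))"
        by (simp only: lin[OF finite_class.finite_UNIV csq])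
      also have "\<dots> = (\<Sum>j\<in>(UNIV :: 'n set). ?A (\<lambda>y. (y $ i)\<^sup>2))"
        unfolding mult_1 by (intro sum.cong refl same)
      also have "\<dots> = real CARD('n) * ?A (\<lambda>y. (y $ i)\<^sup>2)" by simp
      finally show ?thesis by simp
    qed
    have mon: "?A (mon \<alpha>) = e \<alpha> * (?A (\<lambda>y. (norm y)\<^sup>2) / real CARD('n))" if \<alpha>: "(\<Sum>i\<in>UNIV. \<alpha> i) = 2" for \<alpha>
    proof (cases "\<exists>i. odd (\<alpha> i)")
      case True
      then obtain i where i: "odd (\<alpha> i)" by blast
      have "mon \<alpha> (\<chi> j. if j = i then - y $ j else y $ j) = (-1) * mon \<alpha> y + 0 * mon \<alpha> y" for y :: "real ^ 'n"
      proof -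
        have "mon \<alpha> (\<chi> j. if j = i then - y $ j else y $ j)
            = (- y $ i) ^ \<alpha> i * (\<Prod>j\<in>UNIV - {i}. (if j = i then - y $ j else y $ j) ^ \<alpha> j)"
          by (subst prod.remove[of _ i]) auto
        also have "(\<Prod>j\<in>UNIV - {i}. (if j = i then - y $ j else y $ j) ^ \<alpha> j) = (\<Prod>j\<in>UNIV - {i}. y $ j ^ \<alpha> j)"
          by (intro prod.cong) auto
        also have "(- y $ i) ^ \<alpha> i = - (y $ i ^ \<alpha> i)" using i by simp
        also have "- (y $ i ^ \<alpha> i) * (\<Prod>j\<in>UNIV - {i}. y $ j ^ \<alpha> j) = - mon \<alpha> y"
          by (subst (2) prod.remove[of _ i]) auto
        finally show ?thesis by simp
      qed
      hence "?A (\<lambda>y. (-1) * mon \<alpha> y + 0 * mon \<alpha> y) = ?A (mon \<alpha>)"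
        using rot[OF orthogonal_sign_flip[of i] cmon[of \<alpha>]] by simp
      hence "?A (mon \<alpha>) = 0" unfolding average_linear[OF M S cmon cmon] by simp
      thus ?thesis using True by (simp add: e_def)
    next
      case False
      have "\<exists>i. \<alpha> i \<noteq> 0" using \<alpha> by (metis sum.neutral zero_neq_numeral)
      then obtain i where i: "\<alpha> i \<noteq> 0" by blast
      have "\<alpha> i \<le> 2" using member_le_sum[of i UNIV \<alpha>] \<alpha> by simp
      moreover have "even (\<alpha> i)" using False by simp
      ultimately have i2: "\<alpha> i = 2" using i by (metis One_nat_def Suc_1 le_SucE le_zero_eq odd_one)
      have "(\<Sum>j\<in>UNIV - {i}. \<alpha> j) = 0" using \<alpha> i2 by (subst (asm) sum.remove[of _ i]) auto
      hence z: "\<alpha> j = 0" if "j \<noteq> i" for j using that by simp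
      have "mon \<alpha> y = (y $ i)\<^sup>2" for y :: "real ^ 'n"
        by (subst prod.remove[of _ i]) (auto simp: i2 z)
      thus ?thesis using False sq[of i] by (simp add: e_def)
    qed
    have "?A P = ?A (\<lambda>y. \<Sum>\<alpha> | (\<Sum>i\<in>UNIV. \<alpha> i) = 2. a \<alpha> * mon \<alpha> y)"
      by (rule arg_cong[where f = ?A]) (simp add: P2 homogeneous_part_def fun_eq_iff)
    also have "\<dots> = (\<Sum>\<alpha> | (\<Sum>i\<in>UNIV. \<alpha> i) = 2. a \<alpha> * ?A (mon \<alpha>))"
      by (rule lin[OF _ cmon]) (rule finite_subset[OF _ finite_multi_index[of 2]], auto)
    also have "\<dots> = \<tau> * ?A (\<lambda>y. (norm y)\<^sup>2)"
      using mon by (simp add: \<tau>_def sum_distrib_right sum_divide_distrib mult.assoc)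
    finally show "?A P = \<tau> * ?A (\<lambda>y. (norm y)\<^sup>2)" .
  qed
qed

text \<open>
  The ball without its center is a truncated cone for the homogeneous function \<open>\<rho>\<close>, on which the
  average of \<open>\<rho> ^ 2\<close> is \<open>D / (D + 2)\<close>.
\<close>

lemma cell_avg_ball_norm_square:
  assumes r: "r > 0"
  shows "cell_avg (cball 0 r) (\<lambda>y :: real ^ 'n. (norm y)\<^sup>2) = real CARD('n) / (real CARD('n) + 2) * r\<^sup>2"
proof -
  let ?K = "cball 0 r :: (real ^ 'n) set"
  let ?D = "real CARD('n)"
  define \<rho> where "\<rho> y = norm y / r" for y :: "real ^ 'n"
  have fin: "emeasure lborel (?K - {0}) < \<infinity>"
    by (intro emeasure_bounded_finite bounded_subset[OF bounded_cball]) auto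
  have "ennreal (real (DIM(real ^ 'n) + 2)) * (\<integral>\<^sup>+y. ennreal (\<rho> y ^ 2) * indicator (?K - {0}) y \<partial>lborel)
      = ennreal (real DIM(real ^ 'n)) * emeasure lborel (?K - {0})"
    by (rule nn_integral_homogeneous_cone[of "UNIV - {0}"]) (use r fin in \<open>auto simp: \<rho>_def\<close>)
  moreover have "emeasure lborel (?K - {0}) = emeasure lborel ?K"
    by (rule emeasure_Diff_null_set) auto
  moreover have "(\<integral>\<^sup>+y. ennreal (\<rho> y ^ 2) * indicator (?K - {0}) y \<partial>lborel)
      = (\<integral>\<^sup>+y. ennreal (indicator ?K y *\<^sub>R (\<rho> y)\<^sup>2) \<partial>lborel)"
    by (intro nn_integral_cong) (auto simp: indicator_def \<rho>_def)
  moreover have int: "integrable lborel (\<lambda>y. indicator ?K y *\<^sub>R (\<rho> y)\<^sup>2)"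
    by (rule borel_integrable_compact) (use r in \<open>auto simp: \<rho>_def intro!: continuous_intros\<close>)
  hence "(\<integral>\<^sup>+y. ennreal (indicator ?K y *\<^sub>R (\<rho> y)\<^sup>2) \<partial>lborel) = ennreal (LINT y:?K|lborel. (\<rho> y)\<^sup>2)"
    unfolding set_lebesgue_integral_def by (rule nn_integral_eq_integral) auto
  moreover have "emeasure lborel ?K = ennreal (measure lborel ?K)"
    using emeasure_lborel_cball_finite[of 0 r] by (intro emeasure_eq_ennreal_measure) (auto simp: less_top)
  moreover have nn: "0 \<le> (LINT y:?K|lborel. (\<rho> y)\<^sup>2)"
    unfolding set_lebesgue_integral_def by (rule Bochner_Integration.integral_nonneg) auto
  ultimately have "(?D + 2) * (LINT y:?K|lborel. (\<rho> y)\<^sup>2) = ?D * measure lborel ?K"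
    by (simp add: ennreal_mult[symmetric] add.commute del: ennreal_plus)
  moreover have "(LINT y:?K|lborel. (\<rho> y)\<^sup>2) = (LINT y:?K|lborel. (norm y)\<^sup>2) / r\<^sup>2"
    unfolding \<rho>_def power_divide by (rule set_integral_divide_zero)
  moreover have "measure lborel ?K > 0" using r by (simp add: content_cball)
  ultimately show ?thesis using r by (simp add: cell_avg_def field_simps)
qed

text \<open>
  The ball lies in a tube over the sphere, which makes the measure positive; the neighborhoods of the
  sphere are spherical shells of volume \<open>O(d)\<close>, which makes it finite.
\<close>

lemma sphere_area:
  fixes r :: real
  assumes r: "r > 0"
  shows "0 < measure surface (sphere (0 :: real ^ 'n) r)"
proof -
  let ?H = "hausdorff_outer (CARD('n) - 1) :: (real ^ 'n) set \<Rightarrow> ennreal"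
  let ?S = "sphere (0 :: real ^ 'n) r"
  obtain i :: 'n where True by simp
  define n :: "real ^ 'n" where "n = axis i 1"
  have n: "norm n = 1" by (simp add: n_def)
  have pos: "0 < ?H ?S"
  proof (rule hausdorff_outer_positive[OF dim_cart_Suc n r])
    show "cball 0 r \<subseteq> tube n r ?S"
    proof
      fix y :: "real ^ 'n" assume "y \<in> cball 0 r"
      hence y: "norm y \<le> r" by simp
      \<comment> \<open>The line through y in direction n meets the sphere at p + s n and at p - s n, where p is the
        foot of the perpendicular from 0. Of these two points, the one on the side of y is at
        distance at most r from y.\<close>
      define p where "p = y - (n \<bullet> y) *\<^sub>R n"
      have np: "n \<bullet> p = 0" using n by (simp add: p_def inner_diff_right dot_square_norm)
      have yy: "y = p + (n \<bullet> y) *\<^sub>R n" by (simp add: p_def)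
      have sq: "(norm (p + s *\<^sub>R n))\<^sup>2 = (norm p)\<^sup>2 + s\<^sup>2" for s
      proof -
        have "n \<bullet> n = 1" using n by (simp add: dot_square_norm)
        thus ?thesis unfolding power2_norm_eq_inner
          by (simp add: inner_add_left inner_add_right inner_commute[of p n] np power2_eq_square)
      qed
      define h where "h = sqrt (r\<^sup>2 - (norm p)\<^sup>2)"
      have nyp: "(norm y)\<^sup>2 = (norm p)\<^sup>2 + (n \<bullet> y)\<^sup>2" by (subst yy) (rule sq)
      have "(norm y)\<^sup>2 \<le> r\<^sup>2" using y by (intro power_mono) auto
      hence le: "(n \<bullet> y)\<^sup>2 \<le> r\<^sup>2 - (norm p)\<^sup>2" using nyp by simp
      have "0 \<le> r\<^sup>2 - (norm p)\<^sup>2" using le zero_le_power2[of "n \<bullet> y"] by linarith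
      hence h: "h\<^sup>2 = r\<^sup>2 - (norm p)\<^sup>2" "0 \<le> h" by (simp_all add: h_def)
      have "\<bar>n \<bullet> y\<bar> \<le> h" using le h by (metis abs_le_square_iff abs_of_nonneg)
      moreover have "h \<le> r" using h r by (intro power2_le_imp_le[of h r]) auto
      moreover define s where "s = (if n \<bullet> y \<ge> 0 then h else - h)"
      ultimately have t: "\<bar>n \<bullet> y - s\<bar> \<le> r" by auto
      have "s\<^sup>2 = h\<^sup>2" by (simp add: s_def)
      hence "(norm (p + s *\<^sub>R n))\<^sup>2 = r\<^sup>2" using sq[of s] h by simp
      hence "p + s *\<^sub>R n \<in> ?S" using r by (simp add: power2_eq_iff_nonneg)
      moreover have "y = (p + s *\<^sub>R n) + (n \<bullet> y - s) *\<^sub>R n" by (simp add: p_def algebra_simps)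
      ultimately show "y \<in> tube n r ?S"
        unfolding tube_def using t by (intro image_eqI[of _ _ "(p + s *\<^sub>R n, n \<bullet> y - s)"]) (auto simp: abs_le_iff)
    qed
  qed
  have fin: "?H ?S < \<infinity>"
  proof (rule hausdorff_outer_finite[OF dim_cart_Suc])
    let ?D = "CARD('n)" and ?V = "unit_ball_vol (real CARD('n))"
    define c where "c = ?V * (2 * (real ?D * (2 * r) ^ (?D - 1)))"
    show "0 \<le> c" using r by (simp add: c_def)
    show "r > 0" by (rule r)
    fix d assume d: "0 < d" "d < r"
    have sub: "(\<Union>a\<in>?S. ball a d) \<subseteq> cball 0 (r + d) - ball 0 (r - d)"
    proof
      fix y assume "y \<in> (\<Union>a\<in>?S. ball a d)"
      then obtain a where a: "norm a = r" "dist a y < d" by auto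
      have "\<bar>norm a - norm y\<bar> \<le> dist a y" unfolding dist_norm by (rule norm_triangle_ineq3)
      thus "y \<in> cball 0 (r + d) - ball 0 (r - d)" using a by auto
    qed
    have "emeasure lborel (\<Union>a\<in>?S. ball a d) \<le> emeasure lborel (cball 0 (r + d) - ball (0 :: real ^ 'n) (r - d))"
      using sub by (intro emeasure_mono) auto
    also have "\<dots> = emeasure lborel (cball (0 :: real ^ 'n) (r + d)) - emeasure lborel (ball (0 :: real ^ 'n) (r - d))"
      using d by (intro emeasure_Diff) (auto simp: emeasure_ball)
    also have "\<dots> = ennreal (?V * ((r + d) ^ ?D - (r - d) ^ ?D))"
      using d by (simp add: emeasure_ball emeasure_cball ennreal_minus right_diff_distrib)
    also have "?V * ((r + d) ^ ?D - (r - d) ^ ?D) \<le> c * d"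
    proof -
      have "(r + d) ^ ?D - (r - d) ^ ?D = (2 * d) * (\<Sum>i<?D. (r - d) ^ (?D - Suc i) * (r + d) ^ i)"
        by (subst power_diff_sumr2) simp
      also have "\<dots> \<le> (2 * d) * (\<Sum>i<?D. (2 * r) ^ (?D - 1))"
      proof (intro mult_left_mono sum_mono)
        fix i assume "i \<in> {..<?D}"
        hence i: "?D - 1 = (?D - Suc i) + i" by simp
        have "(r - d) ^ (?D - Suc i) * (r + d) ^ i \<le> (2 * r) ^ (?D - Suc i) * (2 * r) ^ i"
          using d by (intro mult_mono power_mono) auto
        also have "\<dots> = (2 * r) ^ (?D - 1)" by (subst i) (simp add: power_add)
        finally show "(r - d) ^ (?D - Suc i) * (r + d) ^ i \<le> (2 * r) ^ (?D - 1)" .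
      qed (use d in auto)
      finally show ?thesis using unit_ball_vol_nonneg[of "real ?D"]
        by (auto simp: c_def mult_ac intro: mult_left_mono)
    qed
    finally show "emeasure lborel (\<Union>a\<in>?S. ball a d) \<le> ennreal (c * d)" by (simp add: ennreal_leI)
  qed
  have "emeasure surface ?S = ?H ?S" by (intro emeasure_surface borel_closed closed_sphere)
  thus ?thesis using pos fin unfolding measure_def by (simp add: enn2real_positive_iff)
qed

lemma bdry_avg_ball_quadratic:
  fixes P :: "real ^ 'n \<Rightarrow> real"
  assumes r: "r > 0" and P: "poly_deg_le 2 P" and hom: "\<And>t y. P (t *\<^sub>R y) = t\<^sup>2 * P y"
  shows "bdry_avg (cball 0 r) P = ((real CARD('n) + 2) / real CARD('n)) * cell_avg (cball 0 r) P"
proof -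
  let ?K = "cball (0 :: real ^ 'n) r"
  have fr: "frontier ?K = sphere 0 r" using r by simp
  obtain \<tau> where \<tau>: "\<And>M S. sets M = sets borel \<Longrightarrow> compact S \<Longrightarrow>
     (\<And>f. orthogonal_transformation f \<Longrightarrow> distr M borel f = M \<and> f ` S = S) \<Longrightarrow>
     average M S P = \<tau> * average M S (\<lambda>y. (norm y)\<^sup>2)"
    using average_quadratic_rotation_invariant[OF P hom] by metis
  have img: "f ` cball 0 r = cball 0 r" "f ` sphere 0 r = sphere 0 r"
    if f: "orthogonal_transformation f" for f :: "real ^ 'n \<Rightarrow> real ^ 'n"
    using orthogonal_transformation_norm[OF f] orthogonal_transformation_surj[OF f]
    by (force simp: image_iff surj_def)+
  have iso: "distr surface borel f = (surface :: (real ^ 'n) measure)"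
    if f: "orthogonal_transformation f" for f :: "real ^ 'n \<Rightarrow> real ^ 'n"
    using orthogonal_transformation_surj[OF f] f
    by (intro distr_surface_isometry) (auto simp: orthogonal_transformation_isometry)
  have "cell_avg ?K P = \<tau> * cell_avg ?K (\<lambda>y. (norm y)\<^sup>2)"
    unfolding cell_avg_eq by (rule \<tau>) (auto simp: img distr_lborel_orthogonal)
  hence C: "cell_avg ?K P = \<tau> * (real CARD('n) / (real CARD('n) + 2) * r\<^sup>2)"
    unfolding cell_avg_ball_norm_square[OF r] .
  have "bdry_avg ?K P = \<tau> * average surface (sphere 0 r) (\<lambda>y :: real ^ 'n. (norm y)\<^sup>2)"
    unfolding bdry_avg_eq fr by (rule \<tau>) (auto simp: img iso)
  also have "average surface (sphere 0 r) (\<lambda>y :: real ^ 'n. (norm y)\<^sup>2) = r\<^sup>2"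
  proof -
    have "(LINT y:sphere (0 :: real ^ 'n) r|surface. (norm y)\<^sup>2) = (LINT y:sphere (0 :: real ^ 'n) r|surface. r\<^sup>2)"
      by (rule set_lebesgue_integral_cong) (auto simp: borel_closed)
    also have "\<dots> = measure surface (sphere (0 :: real ^ 'n) r) * r\<^sup>2"
      using sphere_area[OF r, where 'n = 'n]
      by (subst set_integral_const) (auto simp: borel_closed measure_def)
    finally show ?thesis using sphere_area[OF r, where 'n = 'n] by (simp add: average_def)
  qed
  also have "\<tau> * r\<^sup>2 = ((real CARD('n) + 2) / real CARD('n)) * cell_avg ?K P"
  proof -
    have "a / b * (\<tau> * (b / a * r\<^sup>2)) = \<tau> * r\<^sup>2" if "a \<noteq> 0" "b \<noteq> 0" for a b :: real
      using that by simp
    thus ?thesis unfolding C by simp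
  qed
  finally show ?thesis .
qed

section \<open>Star-regular cells\<close>

lemma outward_unit_normal_translate:
  "outward_unit_normal ((+) z ` K) (z + x) n \<longleftrightarrow> outward_unit_normal K x n"
proof -
  have mem: "y \<in> (+) z ` K \<longleftrightarrow> y - z \<in> K" for y by (auto simp: image_iff) (metis add.commute diff_add_cancel)
  have all: "(\<forall>y. Q y) \<longleftrightarrow> (\<forall>y. Q (z + y))" for Q :: "real ^ 'a \<Rightarrow> bool"
    by (metis add_diff_cancel_left' add.commute diff_add_cancel)
  show ?thesis
    unfolding outward_unit_normal_def mem by (subst all) simp
qed

lemma outward_unit_normal_symmetric:
  assumes "uminus ` K = K" "outward_unit_normal K x n"
  shows "outward_unit_normal K (- x) (- n)"
proof -
  have mem: "- y \<in> K \<longleftrightarrow> y \<in> K" for y using assms(1) by (metis imageI minus_minus)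
  show ?thesis
    unfolding outward_unit_normal_def
  proof (intro conjI allI impI)
    show "norm (- n) = 1" using assms(2) by (simp add: outward_unit_normal_def)
    fix \<epsilon> :: real assume "\<epsilon> > 0"
    then obtain \<delta> where d: "\<delta> > 0" "\<And>y. dist y x < \<delta> \<Longrightarrow> n \<bullet> (y - x) < - \<epsilon> * norm (y - x) \<Longrightarrow> y \<in> K"
      "\<And>y. dist y x < \<delta> \<Longrightarrow> n \<bullet> (y - x) > \<epsilon> * norm (y - x) \<Longrightarrow> y \<notin> K"
      using assms(2) unfolding outward_unit_normal_def by blast
    show "\<exists>\<delta>>0. \<forall>y. dist y (- x) < \<delta> \<longrightarrow>
        (- n \<bullet> (y - - x) < - \<epsilon> * norm (y - - x) \<longrightarrow> y \<in> K) \<and>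
        (- n \<bullet> (y - - x) > \<epsilon> * norm (y - - x) \<longrightarrow> y \<notin> K)"
    proof (intro exI[of _ \<delta>] conjI allI impI d(1))
      fix y assume y: "dist y (- x) < \<delta>"
      have e: "dist (- y) x = dist y (- x)" "n \<bullet> (- y - x) = - n \<bullet> (y - - x)" "norm (- y - x) = norm (y - - x)"
        by (simp_all add: dist_norm inner_diff_right inner_add_right norm_minus_commute[of "- y" x] add.commute)
      show "- n \<bullet> (y - - x) < - \<epsilon> * norm (y - - x) \<Longrightarrow> y \<in> K"
        using d(2)[of "- y"] y mem[of y] unfolding e by blast
      show "- n \<bullet> (y - - x) > \<epsilon> * norm (y - - x) \<Longrightarrow> y \<notin> K"
        using d(3)[of "- y"] y mem[of y] unfolding e by blast
    qed
  qed
qed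

text \<open>
  If \<open>a\<close> sees all of \<open>K\<close>, then so does \<open>- a\<close>, and with both also their midpoint 0: the point
  \<open>t *\<^sub>R x\<close> is reached by moving from \<open>x\<close> towards \<open>a\<close> and from there towards \<open>- a\<close>.
\<close>

lemma starlike_symmetric_center:
  fixes K :: "'a::real_vector set"
  assumes K: "uminus ` K = K" and a: "\<And>x. x \<in> K \<Longrightarrow> closed_segment a x \<subseteq> K"
    and x: "x \<in> K" and t: "0 \<le> t" "t \<le> 1"
  shows "t *\<^sub>R x \<in> K"
proof -
  have mem: "- y \<in> K \<longleftrightarrow> y \<in> K" for y using K by (metis imageI minus_minus)
  have seg: "(1 - u) *\<^sub>R a + u *\<^sub>R y \<in> K" if "y \<in> K" "0 \<le> u" "u \<le> 1" for y u
    using a[OF that(1)] that unfolding closed_segment_def by blast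
  have seg': "(1 - u) *\<^sub>R (- a) + u *\<^sub>R y \<in> K" if "y \<in> K" "0 \<le> u" "u \<le> 1" for y u
  proof -
    have "- ((1 - u) *\<^sub>R a + u *\<^sub>R (- y)) \<in> K" using seg[of "- y" u] that mem by blast
    thus ?thesis by (simp add: algebra_simps)
  qed
  \<comment> \<open>Chosen such that the contributions of a and - a cancel and x gets the coefficient t.\<close>
  define v where "v = 2 * t / (1 + t)"
  define w where "w = (1 + t) / 2"
  have v: "0 \<le> v" "v \<le> 1" "0 \<le> w" "w \<le> 1" using t by (auto simp: v_def w_def field_simps)
  have wv: "w * v = t" "w * (1 - v) = 1 - w"
    using t by (auto simp: v_def w_def field_simps)
  have "(1 - w) *\<^sub>R (- a) + w *\<^sub>R ((1 - v) *\<^sub>R a + v *\<^sub>R x) \<in> K"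
    by (intro seg' seg x v)
  also have "(1 - w) *\<^sub>R (- a) + w *\<^sub>R ((1 - v) *\<^sub>R a + v *\<^sub>R x) = t *\<^sub>R x"
    by (simp add: scaleR_add_right wv)
  finally show ?thesis .
qed

lemma polytopal_cell_volume:
  assumes "polytopal_cell K"
  shows "0 < measure lborel K"
proof -
  note comp = polytopal_cell_props(1)[OF assms]
  obtain x where "x \<in> interior K" using polytopal_cell_props(3)[OF assms] by blast
  then obtain e where e: "e > 0" "ball x e \<subseteq> K" using mem_interior by blast
  have "0 < measure lborel (ball x e)" using e(1) by (simp add: content_ball)
  also have "\<dots> \<le> measure lborel K"
    using e(2) comp emeasure_compact_finite[OF comp]
    by (intro measure_mono_fmeasurable) (auto simp: fmeasurable_def borel_compact)
  finally show ?thesis .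
qed

text \<open>
  Star-regularity is stated for some center \<open>c\<close>. Adding the conditions at \<open>x\<close> and at \<open>- x\<close>, where the
  normals are \<open>n\<close> and \<open>- n\<close>, eliminates \<open>c\<close> and shows \<open>n \<bullet> x = r\<close>. The constant function 1,
  which is homogeneous of degree 0, relates the total measures.
\<close>

lemma star_regular_polytopal_quadratic:
  fixes K :: "(real ^ 'n) set"
  assumes P: "polytopal_cell K" and K: "uminus ` K = K"
    and sr: "star_regular ((+) z ` K)"
  shows "0 \<in> K" "0 < measure surface (frontier K)"
    "\<And>P. poly_deg_le 2 P \<Longrightarrow> (\<And>t y. P (t *\<^sub>R y) = t\<^sup>2 * P y) \<Longrightarrow>
        bdry_avg K P = ((real CARD('n) + 2) / real CARD('n)) * cell_avg K P"
proof -
  obtain a where a: "a \<in> (+) z ` K" "\<And>x. x \<in> (+) z ` K \<Longrightarrow> closed_segment a x \<subseteq> (+) z ` K"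
    using sr unfolding star_regular_def starlike_def by blast
  have seg: "closed_segment (a - z) x \<subseteq> K" if "x \<in> K" for x
  proof
    fix y assume "y \<in> closed_segment (a - z) x"
    hence "z + y \<in> closed_segment (z + (a - z)) (z + x)" by (simp only: closed_segment_translation_eq)
    hence "z + y \<in> (+) z ` K" using a(2)[of "z + x"] that by auto
    thus "y \<in> K" by auto
  qed
  have star: "t *\<^sub>R x \<in> K" if "x \<in> K" "0 \<le> t" "t \<le> 1" for t x
    using K seg that by (rule starlike_symmetric_center)
  show "0 \<in> K" using a(1) star[of "a - z" 0] by auto
  from sr obtain c r where "\<forall>x\<in>frontier ((+) z ` K). \<forall>n. outward_unit_normal ((+) z ` K) x n \<longrightarrow> n \<bullet> (x - c) = r"
    unfolding star_regular_def by (elim conjE exE)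
  hence cr: "n \<bullet> (x - c) = r" if "x \<in> frontier ((+) z ` K)" "outward_unit_normal ((+) z ` K) x n" for x n
    using that by simp
  have cr': "n \<bullet> (z + x - c) = r" if "x \<in> frontier K" "outward_unit_normal K x n" for x n
    using that by (intro cr) (auto simp: frontier_translation outward_unit_normal_translate)
  have nrm: "n \<bullet> x = r" if x: "x \<in> frontier K" "outward_unit_normal K x n" for x n
  proof -
    have "- x \<in> frontier K" using frontier_symmetric[OF K] x(1) by (metis imageI)
    hence "(- n) \<bullet> (z + (- x) - c) = r" using outward_unit_normal_symmetric[OF K x(2)] by (rule cr')
    with cr'[OF x] show ?thesis by (simp add: inner_diff_right inner_add_right)
  qed
  have "\<exists>b>0. emeasure surface (frontier K) < \<infinity> \<and>
    (\<forall>k U. continuous_on UNIV U \<and> (\<forall>t>0. \<forall>y. U (t *\<^sub>R y) = t ^ k * U y) \<longrightarrow>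
       (LINT x:frontier K|surface. U x) = b * (real (CARD('n) + k) / real CARD('n)) * (LINT x:K|lborel. U x))"
    by (rule polytopal_boundary_integral[OF P star nrm])
  then obtain b where b: "b > 0" "emeasure surface (frontier K) < \<infinity>"
    and b3: "\<forall>k U. continuous_on UNIV U \<and> (\<forall>t>0. \<forall>y. U (t *\<^sub>R y) = t ^ k * U y) \<longrightarrow>
       (LINT x:frontier K|surface. U x) = b * (real (CARD('n) + k) / real CARD('n)) * (LINT x:K|lborel. U x)"
    by (elim exE conjE)
  have comp: "compact K" by (rule polytopal_cell_props(1)[OF P])
  have frb: "frontier K \<in> sets borel" by (intro borel_closed compact_imp_closed compact_frontier comp)
  have vol: "measure lborel K > 0" by (rule polytopal_cell_volume[OF P])
  have "(LINT x:frontier K|surface. 1) = b * (real (CARD('n) + 0) / real CARD('n)) * (LINT x:K|lborel. 1)"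
    by (rule b3[rule_format]) auto
  hence area: "measure surface (frontier K) = b * measure lborel K"
    using b(2) frb emeasure_compact_finite[OF comp] comp by (simp add: set_integral_const borel_compact)
  thus "0 < measure surface (frontier K)" using b(1) vol by simp
  fix P :: "real ^ 'n \<Rightarrow> real"
  assume P: "poly_deg_le 2 P" "\<And>t y. P (t *\<^sub>R y) = t\<^sup>2 * P y"
  have "(LINT x:frontier K|surface. P x) = b * (real (CARD('n) + 2) / real CARD('n)) * (LINT x:K|lborel. P x)"
    by (rule b3[rule_format]) (auto intro: poly_deg_le_continuous[OF P(1)] simp: P(2))
  thus "bdry_avg K P = ((real CARD('n) + 2) / real CARD('n)) * cell_avg K P"
    using b(1) vol by (simp add: bdry_avg_def cell_avg_def area field_simps)
qed

lemma polytopal_cell_translate: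
  assumes "polytopal_cell K"
  shows "polytopal_cell ((+) z ` K)"
proof -
  obtain F where F: "finite F" "F \<noteq> {}" "\<forall>P\<in>F. polytope P \<and> interior P \<noteq> {}" "K = \<Union>F"
    using assms unfolding polytopal_cell_def by blast
  show ?thesis
    unfolding polytopal_cell_def
    using F by (intro exI[of _ "(`) ((+) z) ` F"]) (auto simp: polytope_translation_eq interior_translation image_Union)
qed

theorem theorem6p7:
  fixes K :: "(real ^ 'n) set" and z :: "real ^ 'n"
  assumes "K = cbox 0 1 \<and> z = (\<chi> i. 1 / 2)
    \<or> polytopal_cell K \<and> even_about z K
    \<or> (\<exists>r>0. K = cball z r)"
  shows "(\<forall>n. opt_weight K (2 * n + 1) = opt_weight K (2 * n)) \<and>
    (star_regular K \<longrightarrow>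
       opt_weight K 3 = ereal ((real CARD('n) + 2) / real CARD('n)) \<and>
       (\<forall>U. poly_deg_le 3 U \<and> 0 \<le> U z \<longrightarrow>
          0 \<le> opt_weight K 3 * ereal (cell_avg K U) - ereal (bdry_avg K U)))"
proof -
  define w where "w = (real CARD('n) + 2) / real CARD('n)"
  have w: "w \<ge> 1" by (simp add: w_def field_simps)
  define K0 where "K0 = (+) (- z) ` K"
  have KK0: "K = (+) z ` K0" by (simp add: K0_def image_image)
  have cases: "polytopal_cell K \<and> even_about z K \<or> (\<exists>r>0. K = cball z r)"
    using assms
  proof (elim disjE)
    assume K: "K = cbox 0 1 \<and> z = (\<chi> i. 1 / 2)"
    have "(\<chi> i. 1 / 2) \<in> box 0 (1 :: real ^ 'n)" by (simp add: mem_box_cart)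
    hence "box 0 (1 :: real ^ 'n) \<noteq> {}" by blast
    hence "polytopal_cell K"
      using K polytope_interval[of 0 "1 :: real ^ 'n"] by (intro polytope_imp_polytopal_cell) (auto simp: interior_cbox)
    moreover have "even_about z K"
    proof -
      have *: "((\<chi> i. 1 / 2) + v \<in> cbox 0 (1 :: real ^ 'n)) \<longleftrightarrow> (\<forall>i. \<bar>v $ i\<bar> \<le> 1 / 2)" for v
        by (auto simp: mem_box_cart abs_le_iff) (smt (verit) field_sum_of_halves)+
      show ?thesis
        using K *[of "- _"] * by (auto simp: even_about_def)
    qed
    ultimately show ?thesis by blast
  qed auto
  have K0: "compact K0" "uminus ` K0 = K0" "0 < measure lborel K0"
    and quad: "star_regular K \<Longrightarrow> 0 \<in> K0 \<and> 0 < measure surface (frontier K0) \<and>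
      (\<forall>P. poly_deg_le 2 P \<longrightarrow> (\<forall>t y. P (t *\<^sub>R y) = t\<^sup>2 * P y) \<longrightarrow> bdry_avg K0 P = w * cell_avg K0 P)"
  proof -
    have "compact K0 \<and> uminus ` K0 = K0 \<and> 0 < measure lborel K0 \<and> (star_regular K \<longrightarrow>
      0 \<in> K0 \<and> 0 < measure surface (frontier K0) \<and>
      (\<forall>P. poly_deg_le 2 P \<longrightarrow> (\<forall>t y. P (t *\<^sub>R y) = t\<^sup>2 * P y) \<longrightarrow> bdry_avg K0 P = w * cell_avg K0 P))"
      using cases
    proof
      assume K: "polytopal_cell K \<and> even_about z K"
      hence P: "polytopal_cell K0" unfolding K0_def by (intro polytopal_cell_translate) simp
      have mem: "y \<in> K0 \<longleftrightarrow> - y \<in> K0" for y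
        using K unfolding KK0 even_about_def by (auto simp: image_iff)
      have sym: "uminus ` K0 = K0"
      proof (intro equalityI subsetI)
        fix x assume "x \<in> K0"
        thus "x \<in> uminus ` K0" using mem[of x] by (intro image_eqI[of _ _ "- x"]) auto
      next
        fix x assume "x \<in> uminus ` K0"
        then obtain y where "x = - y" "y \<in> K0" by blast
        thus "x \<in> K0" using mem[of y] by simp
      qed
      show ?thesis
        using polytopal_cell_props(1)[OF P] polytopal_cell_volume[OF P] sym
          star_regular_polytopal_quadratic[OF P sym, of z] unfolding KK0[symmetric] w_def by blast
    next
      assume "\<exists>r>0. K = cball z r"
      then obtain r where r: "r > 0" "K = cball z r" by blast
      have K: "K0 = cball 0 r"
        using cball_translation[of "- z" z r] unfolding K0_def r(2) by (simp only: left_minus)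
      have "uminus ` cball (0 :: real ^ 'n) r = cball 0 r"
      proof (intro equalityI subsetI)
        fix x :: "real ^ 'n" assume "x \<in> cball 0 r"
        thus "x \<in> uminus ` cball 0 r" by (intro image_eqI[of _ _ "- x"]) auto
      qed auto
      moreover have "0 < measure lborel (cball (0 :: real ^ 'n) r)" using r by (simp add: content_cball)
      ultimately show ?thesis
        using r(1) sphere_area[OF r(1), where 'n = 'n] bdry_avg_ball_quadratic[OF r(1), where 'n = 'n]
        unfolding K w_def by auto
    qed
    thus "compact K0" "uminus ` K0 = K0" "0 < measure lborel K0"
      and "star_regular K \<Longrightarrow> 0 \<in> K0 \<and> 0 < measure surface (frontier K0) \<and>
      (\<forall>P. poly_deg_le 2 P \<longrightarrow> (\<forall>t y. P (t *\<^sub>R y) = t\<^sup>2 * P y) \<longrightarrow> bdry_avg K0 P = w * cell_avg K0 P)"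
      by blast+
  qed
  have ow: "opt_weight K k = opt_weight K0 k" for k
    unfolding KK0 by (rule opt_weight_translate[OF K0(1)])
  show ?thesis
  proof (intro conjI allI impI)
    show "opt_weight K (2 * n + 1) = opt_weight K (2 * n)" for n
      unfolding ow by (rule opt_weight_even_cell[OF K0(1,2)])
    assume sr: "star_regular K"
    have id: "bdry_avg K0 U = w * cell_avg K0 U + (1 - w) * U 0" if "poly_deg_le 3 U" for U
      using quad[OF sr] by (intro bdry_avg_cubic[OF K0] that) auto
    have ow3: "opt_weight K 3 = ereal w"
      unfolding ow using quad[OF sr] by (intro opt_weight_cubic[OF K0(1) _ K0(3) w id]) auto
    thus "opt_weight K 3 = ereal ((real CARD('n) + 2) / real CARD('n))" by (simp add: w_def)
    fix U :: "real ^ 'n \<Rightarrow> real" assume U: "poly_deg_le 3 U \<and> 0 \<le> U z"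
    have "cell_avg K U = cell_avg K0 (\<lambda>y. U (z + y))" "bdry_avg K U = bdry_avg K0 (\<lambda>y. U (z + y))"
      unfolding KK0 by (rule average_translate[OF K0(1) poly_deg_le_continuous[OF conjunct1[OF U]]])+
    hence "bdry_avg K U = w * cell_avg K U + (1 - w) * U z"
      using id[OF poly_deg_le_translate[OF conjunct1[OF U], of z]] by simp
    moreover have "(1 - w) * U z \<le> 0" using w U by (simp add: mult_nonpos_nonneg)
    ultimately have "0 \<le> w * cell_avg K U - bdry_avg K U" by simp
    thus "0 \<le> opt_weight K 3 * ereal (cell_avg K U) - ereal (bdry_avg K U)"
      by (simp add: ow3)
  qed
qed

end
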